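(* Assume that $(\mathfrak g,\mathfrak g^\theta)$ is an irreducible symmetric pair, and let $$P_{Z(\check B)}=\{\mu\in P^+(\pi)\mid\Theta(\mu)=\mu+w_0\mu-w_0'\mu\}.$$ Then $P_{Z(\check B)}$ is given by the following list. 1) If $\mathfrak g=\mathfrak g'\oplus\mathfrak g'$ (with $\mathfrak g'$ simple and $\theta$ interchanging the two components) and $P^+(\pi)=P^+(\pi')\times P^+(\pi')$, then $P_{Z(\check B)}=\{(\mu,-w_0^1\mu)\mid\mu\in P^+(\pi')\}$, where $w_0^1$ is the longest element of the Weyl group of $\mathfrak g'$. 2) If $\mathfrak g$ is one of $B_n,C_n,E_7,E_8,F_4,G_2$, then $P_{Z(\check B)}=P^+(\pi)$. 3) If $(\mathfrak g,\mathfrak g^\theta)$ is of type $AI$, $AII$, ($DI$, case 3), ($DIII$, case 1), $EI$, or $EIV$, then $P_{Z(\check B)}=\{\mu\in P^+(\pi)\mid\mu=-w_0\mu\}$. 4) If $(\mathfrak g,\mathfrak g^\theta)$ is of type $AIII$, $AIV$, $EII$, $EIII$, or ($DIII$, case 2), then $P_{Z(\check B)}=P^+(\pi)$. 5) If $(\mathfrak g,\mathfrak g^\theta)$ is of type ($DI$, case 1) or $DII$, then $P_{Z(\check B)}=P^+(\pi)$ if $r$ is even, and $P_{Z(\check B)}=\sum_{i=1}^{n-2}\mathbb N\omega_i+\mathbb N(\omega_{n-1}+\omega_n)$ if $r$ is odd. 6) If $(\mathfrak g,\mathfrak g^\theta)$ is of type ($DI$, case 2), then $P_{Z(\check B)}=P^+(\pi)$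 if $n$ is odd, and $P_{Z(\check B)}=\sum_{i=1}^{n-2}\mathbb N\omega_i+\mathbb N(\omega_{n-1}+\omega_n)$ if $n$ is even.
   Context: $\mathbb N$ contains $0$. $\mathfrak g$ is a finite-dimensional complex semisimple Lie algebra of rank $n$ with Cartan subalgebra $\mathfrak h$, simple roots $\pi=\{\alpha_1,\dots,\alpha_n\}$ (standard Bourbaki numbering), fundamental weights $\omega_1,\dots,\omega_n$, dominant integral weights $P^+(\pi)$, Weyl group $W$ with longest element $w_0$, Chevalley generators $e_i,f_i$. $\theta$ is an involutive automorphism of $\mathfrak g$ with fixed subalgebra $\mathfrak g^\theta$, maximally split: $\theta(\mathfrak h)=\mathfrak h$, and, with $\Theta$ the induced involution of $\mathfrak h^*$, if $\Theta(\alpha_i)=\alpha_i$ then $\theta(e_i)=e_i$, $\theta(f_i)=f_i$, while if $\Theta(\alpha_i)\ne\alpha_i$ then $\theta(e_i)$ (resp. $\theta(f_i)$) is a root vector for a negative (resp. positive) root. $\pi_\Theta=\{\alpha_i:\Theta(\alpha_i)=\alpha_i\}$; $w_0'$ is the longest element of the subgroup of $W$ generated by the simple reflections for $\pi_\Theta$. $p$ is the permutation of $\{1,\dots,n\}$ with $p(i)=i$ for $\alpha_i\in\pi_\Theta$ and $\Theta(\alpha_i)\in-\alpha_{p(i)}+\mathbb Z\pi_\Theta$ otherwise. The pair is irreducible iff $\mathfrak g$ is simple, or $\mathfrak g=\mathfrak g'\oplus\mathfrak g'$ with $\mathfrak g'$ simple and $\theta$ interchanging the two components. In the latter case $\pi'$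 denotes the simple roots of $\mathfrak g'$, and the two components are identified so that $P^+(\pi)=P^+(\pi')\times P^+(\pi')$ and $\Theta(\mu,\nu)=(-\nu,-\mu)$. Types for simple $\mathfrak g$ (Araki's list): Type $A_n$: $AI$: $\pi_\Theta=\emptyset$, $p=\mathrm{id}$ ($\Theta=-\mathrm{id}$). $AII$: $n\ge3$ odd, $\pi_\Theta=\{\alpha_i: i\text{ odd}\}$, $p=\mathrm{id}$. $AIII$ ($2\le r\le(n+1)/2$) and $AIV$ ($r=1$, $n\ge2$): $\pi_\Theta=\{\alpha_j:r+1\le j\le n-r\}$, $p(i)=n+1-i$ for $\alpha_i\notin\pi_\Theta$. Type $D_n$ ($n\ge4$): ($DI$, case 1) ($2\le r\le n-2$) and $DII$ ($r=1$): $\pi_\Theta=\{\alpha_{r+1},\dots,\alpha_n\}$, $p=\mathrm{id}$. ($DI$, case 2) ($r=n-1$): $\pi_\Theta=\emptyset$, $p$ interchanges $n-1$ and $n$ and fixes all other indices. ($DI$, case 3) ($r=n$): $\pi_\Theta=\emptyset$, $p=\mathrm{id}$. ($DIII$, case 1): $n$ even, $\pi_\Theta=\{\alpha_{2j-1}:1\le j\le n/2\}$, $p=\mathrm{id}$. ($DIII$, case 2): $n$ odd, $\pi_\Theta=\{\alpha_{2j-1}:1\le j\le(n-1)/2\}$, $p$ interchanges $n-1$ and $n$ and fixes all other indices. Type $E_6$: $EI$: $\pi_\Theta=\emptyset$, $p=\mathrm{id}$. $EII$: $\pi_\Theta=\emptyset$, $p$ the nontrivial diagram automorphism. $EIII$: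 $\pi_\Theta=\{\alpha_3,\alpha_4,\alpha_5\}$, $p$ interchanges $1$ and $6$ and fixes all other indices. $EIV$: $\pi_\Theta=\{\alpha_2,\alpha_3,\alpha_4,\alpha_5\}$, $p=\mathrm{id}$. *)

theory Defs
  imports Complex_Main "HOL-Library.FuncSet" "HOL-Library.Function_Algebras"
    "HOL-Combinatorics.Permutations"
begin

section \<open>Complex semisimple Lie algebras with Chevalley generators\<close>

text \<open>
  The underlying space of the Lie algebra is the whole type \<open>'g\<close>, with an explicit complex scalar
  multiplication.  The simple roots and the Chevalley generators are indexed by the set \<open>idx\<close> of
  natural numbers.  It is \<open>{1..n}\<close> for a Lie algebra of rank \<open>n\<close>, and a subset of it
  for the components of a decomposable Lie algebra, see \<open>component\<close> below.
  Values outside \<open>idx\<close> are irrelevant.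
\<close>

record 'g lie_data =
  smult :: "complex \<Rightarrow> 'g \<Rightarrow> 'g"
  brk :: "'g \<Rightarrow> 'g \<Rightarrow> 'g"
  csa :: "'g set"
  idx :: "nat set"
  sroot :: "nat \<Rightarrow> 'g \<Rightarrow> complex"
  gen_e :: "nat \<Rightarrow> 'g"
  gen_f :: "nat \<Rightarrow> 'g"

definition lie_algebra :: "'g::ab_group_add lie_data \<Rightarrow> bool" where
  "lie_algebra G \<longleftrightarrow>
     vector_space (smult G) \<and>
     (\<exists>S. finite S \<and> module.span (smult G) S = UNIV) \<and>
     (\<forall>x. Vector_Spaces.linear (smult G) (smult G) (\<lambda>y. brk G x y)) \<and>
     (\<forall>y. Vector_Spaces.linear (smult G) (smult G) (\<lambda>x. brk G x y)) \<and>
     (\<forall>x. brk G x x = 0) \<and>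
     (\<forall>x y z. brk G x (brk G y z) + brk G y (brk G z x) + brk G z (brk G x y) = 0)"

definition lie_ideal :: "'g::ab_group_add lie_data \<Rightarrow> 'g set \<Rightarrow> bool" where
  "lie_ideal G A \<longleftrightarrow>
     module.subspace (smult G) A \<and> (\<forall>x. \<forall>a\<in>A. brk G x a \<in> A)"

definition derived_alg :: "'g::ab_group_add lie_data \<Rightarrow> 'g set \<Rightarrow> 'g set" where
  "derived_alg G A = module.span (smult G) {brk G x y | x y. x \<in> A \<and> y \<in> A}"

definition lie_solvable :: "'g::ab_group_add lie_data \<Rightarrow> 'g set \<Rightarrow> bool" where
  "lie_solvable G A \<longleftrightarrow> (\<exists>k. (derived_alg G ^^ k) A = {0})"

definition lie_semisimple :: "'g::ab_group_add lie_data \<Rightarrow> bool" where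
  "lie_semisimple G \<longleftrightarrow> (\<forall>A. lie_ideal G A \<and> lie_solvable G A \<longrightarrow> A = {0})"

text \<open>A subalgebra \<open>A\<close> is simple as a Lie algebra in its own right.\<close>

definition lie_simple :: "'g::ab_group_add lie_data \<Rightarrow> 'g set \<Rightarrow> bool" where
  "lie_simple G A \<longleftrightarrow>
     (\<exists>x\<in>A. \<exists>y\<in>A. brk G x y \<noteq> 0) \<and>
     (\<forall>I. I \<subseteq> A \<and> module.subspace (smult G) I \<and> (\<forall>a\<in>A. \<forall>x\<in>I. brk G a x \<in> I)
        \<longrightarrow> I = {0} \<or> I = A)"

text \<open>
  Cartan subalgebras of complex semisimple Lie algebras (the definition in Hall's textbook):
  abelian, self-centralizing, and acting by diagonalizable endomorphisms \<open>ad h\<close>, that is,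
  the eigenvectors of each \<open>ad h\<close> span the Lie algebra.
\<close>

definition cartan_subalgebra :: "'g::ab_group_add lie_data \<Rightarrow> bool" where
  "cartan_subalgebra G \<longleftrightarrow>
     module.subspace (smult G) (csa G) \<and>
     (\<forall>h\<in>csa G. \<forall>k\<in>csa G. brk G h k = 0) \<and>
     (\<forall>x. (\<forall>h\<in>csa G. brk G h x = 0) \<longrightarrow> x \<in> csa G) \<and>
     (\<forall>h\<in>csa G. module.span (smult G) {x. \<exists>c. brk G h x = smult G c x} = UNIV)"

text \<open>
  The dual space of the Cartan subalgebra.  A linear functional on \<open>csa G\<close> is
  represented by its extension by zero to the whole type, so that equality of functions is equality
  of functionals.  The operations on functionals are the pointwise ones.
\<close>

definition weight_space :: "'g::ab_group_add lie_data \<Rightarrow> ('g \<Rightarrow> complex) set" where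
  "weight_space G = {l. (\<forall>x\<in>csa G. \<forall>y\<in>csa G. l (x + y) = l x + l y) \<and>
     (\<forall>c. \<forall>x\<in>csa G. l (smult G c x) = c * l x) \<and> (\<forall>x. x \<notin> csa G \<longrightarrow> l x = 0)}"

definition root_space :: "'g::ab_group_add lie_data \<Rightarrow> ('g \<Rightarrow> complex) \<Rightarrow> 'g set" where
  "root_space G b = {x. \<forall>h\<in>csa G. brk G h x = smult G (b h) x}"

definition roots :: "'g::ab_group_add lie_data \<Rightarrow> ('g \<Rightarrow> complex) set" where
  "roots G = {b \<in> weight_space G. b \<noteq> 0 \<and> root_space G b \<noteq> {0}}"

definition nat_span :: "nat set \<Rightarrow> (nat \<Rightarrow> 'g \<Rightarrow> complex) \<Rightarrow> ('g \<Rightarrow> complex) set" where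
  "nat_span I v = {\<lambda>x. \<Sum>i\<in>I. of_nat (c i) * v i x | c :: nat \<Rightarrow> nat. True}"

definition int_span :: "nat set \<Rightarrow> (nat \<Rightarrow> 'g \<Rightarrow> complex) \<Rightarrow> ('g \<Rightarrow> complex) set" where
  "int_span I v = {\<lambda>x. \<Sum>i\<in>I. of_int (c i) * v i x | c :: nat \<Rightarrow> int. True}"

definition pos_roots :: "'g::ab_group_add lie_data \<Rightarrow> ('g \<Rightarrow> complex) set" where
  "pos_roots G = roots G \<inter> nat_span (idx G) (sroot G)"

definition neg_roots :: "'g::ab_group_add lie_data \<Rightarrow> ('g \<Rightarrow> complex) set" where
  "neg_roots G = {b \<in> roots G. - b \<in> nat_span (idx G) (sroot G)}"

definition simple_roots :: "'g::ab_group_add lie_data \<Rightarrow> bool" where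
  "simple_roots G \<longleftrightarrow>
     finite (idx G) \<and> (\<forall>i\<in>idx G. sroot G i \<in> roots G) \<and>
     (\<forall>c :: nat \<Rightarrow> complex. (\<lambda>x. \<Sum>i\<in>idx G. c i * sroot G i x) = 0 \<longrightarrow> (\<forall>i\<in>idx G. c i = 0)) \<and>
     roots G = pos_roots G \<union> neg_roots G"

text \<open>
  The simple coroots.  Normalized as in \<open>chevalley_generators\<close>, \<open>[e\<^sub>i, f\<^sub>i]\<close> is the
  element of \<open>[g\<^sub>\<alpha>, g\<^sub>-\<^sub>\<alpha>]\<close> on which \<open>\<alpha> = \<alpha>\<^sub>i\<close> takes the value 2.
\<close>

definition coroot :: "'g::ab_group_add lie_data \<Rightarrow> nat \<Rightarrow> 'g" where
  "coroot G i = brk G (gen_e G i) (gen_f G i)"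

definition chevalley_generators :: "'g::ab_group_add lie_data \<Rightarrow> bool" where
  "chevalley_generators G \<longleftrightarrow>
     (\<forall>i\<in>idx G. gen_e G i \<in> root_space G (sroot G i) \<and>
        gen_f G i \<in> root_space G (- sroot G i) \<and>
        coroot G i \<in> csa G \<and> sroot G i (coroot G i) = 2)"

definition semisimple_lie_algebra :: "'g::ab_group_add lie_data \<Rightarrow> bool" where
  "semisimple_lie_algebra G \<longleftrightarrow>
     lie_algebra G \<and> lie_semisimple G \<and> cartan_subalgebra G \<and>
     simple_roots G \<and> chevalley_generators G"


section \<open>Weights and the Weyl group\<close>

definition dominant_weights :: "'g::ab_group_add lie_data \<Rightarrow> ('g \<Rightarrow> complex) set" where
  "dominant_weights G = {m \<in> weight_space G. \<forall>i\<in>idx G. m (coroot G i) \<in> \<nat>}"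

definition fund_weight :: "'g::ab_group_add lie_data \<Rightarrow> nat \<Rightarrow> 'g \<Rightarrow> complex" where
  "fund_weight G i = (THE w. w \<in> weight_space G \<and>
     (\<forall>j\<in>idx G. w (coroot G j) = (if j = i then 1 else 0)))"

definition simple_refl ::
    "'g::ab_group_add lie_data \<Rightarrow> nat \<Rightarrow> ('g \<Rightarrow> complex) \<Rightarrow> ('g \<Rightarrow> complex)" where
  "simple_refl G i m = (\<lambda>x. m x - m (coroot G i) * sroot G i x)"

text \<open>The product of a word of simple reflections, as a map of the weight space.\<close>

definition weyl_elt ::
    "'g::ab_group_add lie_data \<Rightarrow> nat list \<Rightarrow> ('g \<Rightarrow> complex) \<Rightarrow> ('g \<Rightarrow> complex)" where
  "weyl_elt G ws = restrict (\<lambda>m. foldr (simple_refl G) ws m) (weight_space G)"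

text \<open>
  The subgroup generated by the simple reflections for \<open>J\<close> (they are involutions, so words
  suffice).  The Weyl group itself is the case \<open>J = idx G\<close>.
\<close>

definition weyl_subgroup ::
    "'g::ab_group_add lie_data \<Rightarrow> nat set \<Rightarrow> (('g \<Rightarrow> complex) \<Rightarrow> ('g \<Rightarrow> complex)) set" where
  "weyl_subgroup G J = {weyl_elt G ws | ws. set ws \<subseteq> J}"

definition weyl_length ::
    "'g::ab_group_add lie_data \<Rightarrow> nat set \<Rightarrow> (('g \<Rightarrow> complex) \<Rightarrow> ('g \<Rightarrow> complex)) \<Rightarrow> nat" where
  "weyl_length G J w = (LEAST k. \<exists>ws. set ws \<subseteq> J \<and> length ws = k \<and> w = weyl_elt G ws)"

definition longest_elt ::
    "'g::ab_group_add lie_data \<Rightarrow> nat set \<Rightarrow> ('g \<Rightarrow> complex) \<Rightarrow> ('g \<Rightarrow> complex)" where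
  "longest_elt G J = (THE w. w \<in> weyl_subgroup G J \<and>
     (\<forall>v\<in>weyl_subgroup G J. weyl_length G J v \<le> weyl_length G J w))"

definition w0 :: "'g::ab_group_add lie_data \<Rightarrow> ('g \<Rightarrow> complex) \<Rightarrow> ('g \<Rightarrow> complex)" where
  "w0 G = longest_elt G (idx G)"


section \<open>Symmetric pairs\<close>

definition involutive_automorphism :: "'g::ab_group_add lie_data \<Rightarrow> ('g \<Rightarrow> 'g) \<Rightarrow> bool" where
  "involutive_automorphism G \<theta> \<longleftrightarrow>
     Vector_Spaces.linear (smult G) (smult G) \<theta> \<and>
     (\<forall>x y. \<theta> (brk G x y) = brk G (\<theta> x) (\<theta> y)) \<and> (\<forall>x. \<theta> (\<theta> x) = x)"

text \<open>The involution of the weight space induced by \<open>\<theta>\<close> (which stabilizes \<open>csa G\<close>).\<close>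

definition Theta :: "('g \<Rightarrow> 'g) \<Rightarrow> ('g \<Rightarrow> complex) \<Rightarrow> ('g \<Rightarrow> complex)" where
  "Theta \<theta> m = (\<lambda>x. m (\<theta> x))"

definition pi_Theta :: "'g::ab_group_add lie_data \<Rightarrow> ('g \<Rightarrow> 'g) \<Rightarrow> nat set" where
  "pi_Theta G \<theta> = {i \<in> idx G. Theta \<theta> (sroot G i) = sroot G i}"

definition w0' :: "'g::ab_group_add lie_data \<Rightarrow> ('g \<Rightarrow> 'g) \<Rightarrow> ('g \<Rightarrow> complex) \<Rightarrow> ('g \<Rightarrow> complex)" where
  "w0' G \<theta> = longest_elt G (pi_Theta G \<theta>)"

definition maximally_split :: "'g::ab_group_add lie_data \<Rightarrow> ('g \<Rightarrow> 'g) \<Rightarrow> bool" where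
  "maximally_split G \<theta> \<longleftrightarrow>
     involutive_automorphism G \<theta> \<and> \<theta> ` csa G = csa G \<and>
     (\<forall>i\<in>pi_Theta G \<theta>. \<theta> (gen_e G i) = gen_e G i \<and> \<theta> (gen_f G i) = gen_f G i) \<and>
     (\<forall>i\<in>idx G - pi_Theta G \<theta>.
        (\<exists>b\<in>neg_roots G. \<theta> (gen_e G i) \<in> root_space G b - {0}) \<and>
        (\<exists>b\<in>pos_roots G. \<theta> (gen_f G i) \<in> root_space G b - {0}))"

definition PZB :: "'g::ab_group_add lie_data \<Rightarrow> ('g \<Rightarrow> 'g) \<Rightarrow> ('g \<Rightarrow> complex) set" where
  "PZB G \<theta> = {m \<in> dominant_weights G. Theta \<theta> m = m + w0 G m - w0' G \<theta> m}"

definition satake_perm :: "'g::ab_group_add lie_data \<Rightarrow> ('g \<Rightarrow> 'g) \<Rightarrow> (nat \<Rightarrow> nat) \<Rightarrow> bool" where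
  "satake_perm G \<theta> p \<longleftrightarrow>
     p permutes idx G \<and> (\<forall>i\<in>pi_Theta G \<theta>. p i = i) \<and>
     (\<forall>i\<in>idx G - pi_Theta G \<theta>. \<exists>z\<in>int_span (pi_Theta G \<theta>) (sroot G).
        Theta \<theta> (sroot G i) = - sroot G (p i) + z)"

text \<open>The Lie algebra is the direct sum of two simple ideals \<open>A\<close> and \<open>B\<close>, and \<open>\<theta>\<close> interchanges them.\<close>

definition interchanged :: "'g::ab_group_add lie_data \<Rightarrow> ('g \<Rightarrow> 'g) \<Rightarrow> 'g set \<Rightarrow> 'g set \<Rightarrow> bool" where
  "interchanged G \<theta> A B \<longleftrightarrow>
     lie_ideal G A \<and> lie_ideal G B \<and> lie_simple G A \<and> lie_simple G B \<and>
     A \<inter> B = {0} \<and> (\<forall>x. \<exists>a\<in>A. \<exists>b\<in>B. x = a + b) \<and> \<theta> ` A = B \<and> \<theta> ` B = A"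

definition irreducible_pair :: "'g::ab_group_add lie_data \<Rightarrow> ('g \<Rightarrow> 'g) \<Rightarrow> bool" where
  "irreducible_pair G \<theta> \<longleftrightarrow> lie_simple G UNIV \<or> (\<exists>A B. interchanged G \<theta> A B)"

text \<open>
  The Cartan subalgebra, simple roots and Chevalley generators of a simple ideal \<open>A\<close>.  The weights,
  dominant weights and Weyl group of \<open>component G A\<close> depend on these and on the bracket only; they
  are those of \<open>A\<close>.
\<close>

definition component :: "'g::ab_group_add lie_data \<Rightarrow> 'g set \<Rightarrow> 'g lie_data" where
  "component G A = G\<lparr>csa := csa G \<inter> A, idx := {i \<in> idx G. gen_e G i \<in> A},
     sroot := (\<lambda>i x. if x \<in> A then sroot G i x else 0)\<rparr>"

text \<open>
  The weight \<open>(\<mu>, \<nu>)\<close> for weights \<open>\<mu>\<close>, \<open>\<nu>\<close> of \<open>A\<close>, in the situation of \<open>interchanged\<close>.  The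
  Cartan subalgebra of \<open>B\<close> is identified with that of \<open>A\<close> by \<open>- \<theta>\<close>; it is the only
  linear identification for which \<open>\<Theta>(\<mu>, \<nu>) = (-\<nu>, -\<mu>)\<close>.  As \<open>\<theta>\<close> is maximally split, it matches the
  simple roots of the two components.
\<close>

definition pair_weight ::
    "'g::ab_group_add lie_data \<Rightarrow> ('g \<Rightarrow> 'g) \<Rightarrow> 'g set \<Rightarrow> 'g set \<Rightarrow>
     ('g \<Rightarrow> complex) \<Rightarrow> ('g \<Rightarrow> complex) \<Rightarrow> ('g \<Rightarrow> complex)" where
  "pair_weight G \<theta> A B \<mu> \<nu> = (THE l. l \<in> weight_space G \<and>
     (\<forall>x\<in>csa G \<inter> A. l x = \<mu> x) \<and> (\<forall>x\<in>csa G \<inter> B. l x = \<nu> (- \<theta> x)))"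


section \<open>Types\<close>

datatype dynkin = TypeA nat | TypeB nat | TypeC nat | TypeD nat | TypeE nat | TypeF4 | TypeG2

definition linked :: "(nat \<times> nat) set \<Rightarrow> nat \<Rightarrow> nat \<Rightarrow> int" where
  "linked E i j = (if i = j then 2 else if (i, j) \<in> E \<or> (j, i) \<in> E then -1 else 0)"

text \<open>
  Bourbaki numbering; the entry at \<open>(i, j)\<close> is the value of \<open>\<alpha>\<^sub>i\<close> on the coroot of \<open>\<alpha>\<^sub>j\<close>.
\<close>

fun cartan_matrix :: "dynkin \<Rightarrow> nat \<Rightarrow> nat \<Rightarrow> int" where
  "cartan_matrix (TypeA n) i j = linked {(k, k + 1) | k. True} i j"
| "cartan_matrix (TypeB n) i j =
     (if i = n - 1 \<and> j = n then -2 else linked {(k, k + 1) | k. True} i j)"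
| "cartan_matrix (TypeC n) i j =
     (if i = n \<and> j = n - 1 then -2 else linked {(k, k + 1) | k. True} i j)"
| "cartan_matrix (TypeD n) i j = linked ({(k, k + 1) | k. k \<le> n - 2} \<union> {(n - 2, n)}) i j"
| "cartan_matrix (TypeE n) i j = linked {(1,3), (2,4), (3,4), (4,5), (5,6), (6,7), (7,8)} i j"
| "cartan_matrix TypeF4 i j = (if i = 2 \<and> j = 3 then -2 else linked {(1,2), (2,3), (3,4)} i j)"
| "cartan_matrix TypeG2 i j = (if i = 2 \<and> j = 1 then -3 else linked {(1,2)} i j)"

fun dynkin_rank :: "dynkin \<Rightarrow> nat" where
  "dynkin_rank (TypeA n) = n"
| "dynkin_rank (TypeB n) = n"
| "dynkin_rank (TypeC n) = n"
| "dynkin_rank (TypeD n) = n"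
| "dynkin_rank (TypeE n) = n"
| "dynkin_rank TypeF4 = 4"
| "dynkin_rank TypeG2 = 2"

fun dynkin_valid :: "dynkin \<Rightarrow> bool" where
  "dynkin_valid (TypeA n) \<longleftrightarrow> n \<ge> 1"
| "dynkin_valid (TypeB n) \<longleftrightarrow> n \<ge> 2"
| "dynkin_valid (TypeC n) \<longleftrightarrow> n \<ge> 2"
| "dynkin_valid (TypeD n) \<longleftrightarrow> n \<ge> 4"
| "dynkin_valid (TypeE n) \<longleftrightarrow> n \<in> {6, 7, 8}"
| "dynkin_valid TypeF4 \<longleftrightarrow> True"
| "dynkin_valid TypeG2 \<longleftrightarrow> True"

definition has_type :: "'g::ab_group_add lie_data \<Rightarrow> dynkin \<Rightarrow> bool" where
  "has_type G X \<longleftrightarrow> dynkin_valid X \<and> idx G = {1..dynkin_rank X} \<and>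
     (\<forall>i\<in>idx G. \<forall>j\<in>idx G. sroot G i (coroot G j) = of_int (cartan_matrix X i j))"

definition satake_type ::
    "'g::ab_group_add lie_data \<Rightarrow> ('g \<Rightarrow> 'g) \<Rightarrow> dynkin \<Rightarrow> nat set \<Rightarrow> (nat \<Rightarrow> nat) \<Rightarrow> bool" where
  "satake_type G \<theta> X J p \<longleftrightarrow> has_type G X \<and> pi_Theta G \<theta> = J \<and> satake_perm G \<theta> p"

definition type_AI :: "'g::ab_group_add lie_data \<Rightarrow> ('g \<Rightarrow> 'g) \<Rightarrow> nat \<Rightarrow> bool" where
  "type_AI G \<theta> n \<longleftrightarrow> satake_type G \<theta> (TypeA n) {} id"

definition type_AII :: "'g::ab_group_add lie_data \<Rightarrow> ('g \<Rightarrow> 'g) \<Rightarrow> nat \<Rightarrow> bool" where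
  "type_AII G \<theta> n \<longleftrightarrow> n \<ge> 3 \<and> odd n \<and> satake_type G \<theta> (TypeA n) {i \<in> {1..n}. odd i} id"

definition A_perm :: "nat \<Rightarrow> nat \<Rightarrow> nat \<Rightarrow> nat" where
  "A_perm n r i = (if i \<in> {1..n} - {r+1..n-r} then n + 1 - i else i)"

definition type_AIII :: "'g::ab_group_add lie_data \<Rightarrow> ('g \<Rightarrow> 'g) \<Rightarrow> nat \<Rightarrow> nat \<Rightarrow> bool" where
  "type_AIII G \<theta> n r \<longleftrightarrow>
     2 \<le> r \<and> 2 * r \<le> n + 1 \<and> satake_type G \<theta> (TypeA n) {r+1..n-r} (A_perm n r)"

definition type_AIV :: "'g::ab_group_add lie_data \<Rightarrow> ('g \<Rightarrow> 'g) \<Rightarrow> nat \<Rightarrow> bool" where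
  "type_AIV G \<theta> n \<longleftrightarrow> n \<ge> 2 \<and> satake_type G \<theta> (TypeA n) {2..n-1} (A_perm n 1)"

definition type_DI_case1 :: "'g::ab_group_add lie_data \<Rightarrow> ('g \<Rightarrow> 'g) \<Rightarrow> nat \<Rightarrow> nat \<Rightarrow> bool" where
  "type_DI_case1 G \<theta> n r \<longleftrightarrow> 2 \<le> r \<and> r \<le> n - 2 \<and> satake_type G \<theta> (TypeD n) {r+1..n} id"

definition type_DII :: "'g::ab_group_add lie_data \<Rightarrow> ('g \<Rightarrow> 'g) \<Rightarrow> nat \<Rightarrow> nat \<Rightarrow> bool" where
  "type_DII G \<theta> n r \<longleftrightarrow> r = 1 \<and> satake_type G \<theta> (TypeD n) {r+1..n} id"

definition type_DI_case2 :: "'g::ab_group_add lie_data \<Rightarrow> ('g \<Rightarrow> 'g) \<Rightarrow> nat \<Rightarrow> bool" where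
  "type_DI_case2 G \<theta> n \<longleftrightarrow> satake_type G \<theta> (TypeD n) {} (transpose (n - 1) n)"

definition type_DI_case3 :: "'g::ab_group_add lie_data \<Rightarrow> ('g \<Rightarrow> 'g) \<Rightarrow> nat \<Rightarrow> bool" where
  "type_DI_case3 G \<theta> n \<longleftrightarrow> satake_type G \<theta> (TypeD n) {} id"

definition type_DIII_case1 :: "'g::ab_group_add lie_data \<Rightarrow> ('g \<Rightarrow> 'g) \<Rightarrow> nat \<Rightarrow> bool" where
  "type_DIII_case1 G \<theta> n \<longleftrightarrow>
     even n \<and> satake_type G \<theta> (TypeD n) {2 * j - 1 | j. 1 \<le> j \<and> j \<le> n div 2} id"

definition type_DIII_case2 :: "'g::ab_group_add lie_data \<Rightarrow> ('g \<Rightarrow> 'g) \<Rightarrow> nat \<Rightarrow> bool" where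
  "type_DIII_case2 G \<theta> n \<longleftrightarrow>
     odd n \<and> satake_type G \<theta> (TypeD n) {2 * j - 1 | j. 1 \<le> j \<and> j \<le> (n - 1) div 2}
       (transpose (n - 1) n)"

definition type_EI :: "'g::ab_group_add lie_data \<Rightarrow> ('g \<Rightarrow> 'g) \<Rightarrow> bool" where
  "type_EI G \<theta> \<longleftrightarrow> satake_type G \<theta> (TypeE 6) {} id"

definition type_EII :: "'g::ab_group_add lie_data \<Rightarrow> ('g \<Rightarrow> 'g) \<Rightarrow> bool" where
  "type_EII G \<theta> \<longleftrightarrow> satake_type G \<theta> (TypeE 6) {} (transpose 1 6 \<circ> transpose 3 5)"

definition type_EIII :: "'g::ab_group_add lie_data \<Rightarrow> ('g \<Rightarrow> 'g) \<Rightarrow> bool" where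
  "type_EIII G \<theta> \<longleftrightarrow> satake_type G \<theta> (TypeE 6) {3, 4, 5} (transpose 1 6)"

definition type_EIV :: "'g::ab_group_add lie_data \<Rightarrow> ('g \<Rightarrow> 'g) \<Rightarrow> bool" where
  "type_EIV G \<theta> \<longleftrightarrow> satake_type G \<theta> (TypeE 6) {2, 3, 4, 5} id"

text \<open>The set \<open>\<Sum>\<^sub>i\<^sub>\<le>\<^sub>n\<^sub>-\<^sub>2 \<nat>\<omega>\<^sub>i + \<nat>(\<omega>\<^sub>n\<^sub>-\<^sub>1 + \<omega>\<^sub>n)\<close>.\<close>

definition D_weights :: "'g::ab_group_add lie_data \<Rightarrow> nat \<Rightarrow> ('g \<Rightarrow> complex) set" where
  "D_weights G n =
     {a + (\<lambda>x. of_nat d * (fund_weight G (n - 1) x + fund_weight G n x)) | a d.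
        a \<in> nat_span {1..n-2} (fund_weight G)}"

end

theory Submission
  imports Defs
begin

text \<open>
  Put \<open>T = \<Theta>\<close>. The map \<open>- w\<^sub>0' T\<close> preserves the positive roots, so it permutes the simple roots by an
  involutive diagram automorphism \<open>d\<close> (the twist), which equals \<open>p\<close> off \<open>\<pi>\<^sub>\<Theta>\<close>; likewise \<open>- w\<^sub>0\<close> permutes
  them by the opposition involution. Since \<open>T = - w\<^sub>0' d\<close>, the condition on \<open>\<mu>\<close> reads
  \<open>w\<^sub>0' (\<mu> - d \<mu>) = \<mu> + w\<^sub>0 \<mu>\<close>. It holds for every \<open>\<mu>\<close> if \<open>d\<close> is the opposition; it says \<open>\<mu> = - w\<^sub>0 \<mu>\<close> if
  \<open>d\<close> is the identity, and \<open>d \<mu> = \<mu>\<close> if the opposition is the identity. The twist is read off the Satake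
  diagram. No reduced words are needed for the opposition: it is a diagram automorphism, and the Weyl
  group acts trivially on weights modulo roots, which leaves only one possibility.
\<close>

section \<open>Joint eigenvectors\<close>

context vector_space
begin

text \<open>No root system is given, only a Lie algebra whose roots split into positive and negative
  ones. That the roots are finite in number and stable under simple reflections, and that the
  coroots span the Cartan subalgebra, has to be extracted first. In the theory of the Weyl group,
  finiteness and integral coefficients then take the place of an invariant form and of reducedness.
  A map such as - w0' T is known through its action on roots, while weights are evaluated on
  coroots; \<open>coroot_transport\<close> bridges the two.

  The subtle case is the one where d is the opposition. There v = mu - d mu equals mu + w0 mu, and
  the claim becomes w0' v = v. Now T v = w0' v, so T negates w0' v - v; but this difference is a
  combination of roots of \<open>pi_Theta\<close>, which T fixes, so it is zero.

  For the opposition, one character of weights modulo roots decides between the few diagram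
  automorphisms. Only D4, with its triality, needs two characters. The twist in type D4 is handled
  by a node known to be fixed, or by an empty \<open>pi_Theta\<close>, where it is p
  everywhere.\<close>

lemma joint_eigenvectors_independent:
  assumes "finite S"
    and lin: "\<And>h. h \<in> H \<Longrightarrow> Vector_Spaces.linear scale scale (T h)"
    and distinct: "\<And>k l. k \<in> S \<Longrightarrow> l \<in> S \<Longrightarrow> k \<noteq> l \<Longrightarrow> \<exists>h\<in>H. ev k h \<noteq> ev l h"
    and eig: "\<And>k h. k \<in> S \<Longrightarrow> h \<in> H \<Longrightarrow> T h (x k) = scale (ev k h) (x k)"
    and "sum x S = 0"
  shows "\<forall>k\<in>S. x k = 0"
  using assms(1) distinct eig assms(5)
proof (induction S arbitrary: x rule: finite_induct)
  case empty
  then show ?case by simp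
next
  case (insert a S)
  \<comment> \<open>Subtracting the scalar \<open>ev a h\<close> from \<open>T h\<close> kills the
    summand at \<open>a\<close>. What is left is again a vanishing sum of joint eigenvectors, over
    the smaller index set.\<close>
  have shifted: "scale (ev k h - ev a h) (x k) = 0" if h: "h \<in> H" and "k \<in> S" for h k
  proof -
    interpret Th: Vector_Spaces.linear scale scale "T h" using lin h .
    let ?y = "\<lambda>k. scale (ev k h - ev a h) (x k)"
    have eq: "x a + sum x S = 0" using insert by simp
    have "0 = T h (x a + sum x S) - scale (ev a h) (x a + sum x S)"
      unfolding eq by (simp add: Th.zero)
    also have "\<dots> = (\<Sum>k\<in>S. T h (x k) - scale (ev a h) (x k))"
      using insert.prems(2) h
      by (simp add: Th.add Th.sum scale_right_distrib scale_sum_right sum_subtractf)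
    also have "\<dots> = sum ?y S"
      by (rule sum.cong) (auto simp: insert.prems(2) h scale_left_diff_distrib)
    finally have "sum ?y S = 0" by simp
    moreover have "T h' (?y k) = scale (ev k h') (?y k)" if "k \<in> S" "h' \<in> H" for k h'
    proof -
      interpret Th': Vector_Spaces.linear scale scale "T h'" using lin that by blast
      show ?thesis using insert.prems(2)[of k h'] that by (simp add: Th'.scale mult.commute)
    qed
    ultimately have "\<forall>k\<in>S. ?y k = 0"
      using insert.IH[of ?y] insert.prems(1) by blast
    then show ?thesis using that by blast
  qed
  have "x k = 0" if k: "k \<in> S" for k
  proof -
    have "k \<noteq> a" using that insert.hyps by blast
    then obtain h where "h \<in> H" "ev k h \<noteq> ev a h"
      using insert.prems(1)[of k a] k by auto
    then show ?thesis using shifted[OF _ that, of h] by simp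
  qed
  then show ?case using insert by simp
qed

text \<open>Eigenvectors for different systems of eigenvalues are independent, so the size of a
  spanning set bounds the number of systems. Both the finiteness of the set of roots and the
  termination of root strings come from this bound.\<close>

lemma finite_joint_eigenvalues:
  assumes "finite B" "span B = UNIV"
    and lin: "\<And>h. h \<in> H \<Longrightarrow> Vector_Spaces.linear scale scale (T h)"
    and distinct: "\<And>k l. k \<in> K \<Longrightarrow> l \<in> K \<Longrightarrow> k \<noteq> l \<Longrightarrow> \<exists>h\<in>H. ev k h \<noteq> ev l h"
    and ex: "\<And>k. k \<in> K \<Longrightarrow> \<exists>x. x \<noteq> 0 \<and> (\<forall>h\<in>H. T h x = scale (ev k h) x)"
  shows "finite K"
proof -
  obtain x where x: "\<And>k. k \<in> K \<Longrightarrow> x k \<noteq> 0"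
    "\<And>k h. k \<in> K \<Longrightarrow> h \<in> H \<Longrightarrow> T h (x k) = scale (ev k h) (x k)"
    using ex by metis
  have inj: "inj_on x K"
  proof (rule inj_onI, rule ccontr)
    fix k l assume kl: "k \<in> K" "l \<in> K" "x k = x l" "k \<noteq> l"
    then obtain h where h: "h \<in> H" "ev k h \<noteq> ev l h" using distinct by blast
    have "scale (ev k h) (x k) = scale (ev l h) (x k)"
      using x(2)[of k h] x(2)[of l h] kl h by simp
    then show False using h x(1)[of k] kl by simp
  qed
  show ?thesis
  proof (rule finite_if_finite_subsets_card_bdd[where C="card B", THEN conjunct1])
    fix F assume F: "F \<subseteq> K" "finite F"
    have "independent (x ` F)"
    proof (rule independent_if_scalars_zero)
      fix f v assume sum0: "(\<Sum>y\<in>x ` F. scale (f y) y) = 0" and v: "v \<in> x ` F"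
      have "(\<Sum>k\<in>F. scale (f (x k)) (x k)) = 0"
        using sum0 inj F by (subst (asm) sum.reindex) (auto intro: inj_on_subset)
      moreover have "T h (scale (f (x k)) (x k)) = scale (ev k h) (scale (f (x k)) (x k))"
        if "k \<in> F" "h \<in> H" for k h
      proof -
        interpret Th: Vector_Spaces.linear scale scale "T h" using lin that by blast
        show ?thesis using x(2)[of k h] that F by (auto simp: Th.scale mult.commute)
      qed
      ultimately have "\<forall>k\<in>F. scale (f (x k)) (x k) = 0"
        using joint_eigenvectors_independent[of F H T ev "\<lambda>k. scale (f (x k)) (x k)"]
          F lin distinct by blast
      then show "f v = 0" using v x(1) F by auto
    qed (use F in auto)
    then have "card (x ` F) \<le> card B"
      using independent_span_bound[of B "x ` F"] assms by auto
    then show "card F \<le> card B"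
      using card_image[of x F] inj_on_subset[OF inj F(1)] by simp
  qed
qed

text \<open>Indexing the components by their eigenvalues makes these distinct by construction, which
  is the form that \<open>joint_eigenvectors_independent\<close> consumes.\<close>

lemma eigenvector_decomposition:
  assumes "span {x. \<exists>c. T x = scale c x} = UNIV" and "Vector_Spaces.linear scale scale T"
  shows "\<exists>S x. finite S \<and> (\<forall>c\<in>S. T (x c) = scale c (x c)) \<and> v = sum x S"
proof -
  interpret T: Vector_Spaces.linear scale scale T by fact
  have "v \<in> span {x. \<exists>c. T x = scale c x}" using assms by simp
  then show ?thesis
  proof (induction rule: span_induct_alt)
    case base
    then show ?case by (intro exI[of _ "{}"]) auto
  next
    case (step c v w)
    then obtain S x d where *: "finite S" "\<forall>c\<in>S. T (x c) = scale c (x c)" "w = sum x S"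
      "T v = scale d v" by auto
    \<comment> \<open>\<open>x\<close> is unconstrained outside \<open>S\<close>, so the component
      for a new eigenvalue \<open>d\<close> has to start from 0 and not from
      \<open>x d\<close>.\<close>
    define x' where "x' = x(d := (if d \<in> S then x d else 0) + scale c v)"
    have "sum x' (S - {d}) = sum x (S - {d})"
      by (rule sum.cong) (auto simp: x'_def)
    moreover have "sum x' (insert d S) = x' d + sum x' (S - {d})"
      using * by (simp add: sum.insert_remove)
    moreover have "sum x S = (if d \<in> S then x d else 0) + sum x (S - {d})"
      using * by (simp add: sum.remove)
    ultimately have "scale c v + w = sum x' (insert d S)"
      using * by (simp add: x'_def)
    moreover have "T (x' k) = scale k (x' k)" if "k \<in> insert d S" for k
      using * that
      by (cases "k = d") (auto simp: x'_def T.add T.scale T.zero scale_right_distrib mult.commute)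
    ultimately show ?case using * by (metis finite_insert)
  qed
qed

text \<open>Simultaneous diagonalization. A joint eigenvector of the old maps is split into
  eigencomponents of the new map, and commutation makes every component a joint eigenvector
  again.\<close>

lemma joint_eigenvectors_span:
  assumes "finite H"
    and "\<And>h. h \<in> H \<Longrightarrow> Vector_Spaces.linear scale scale (T h)"
    and "\<And>h. h \<in> H \<Longrightarrow> span {x. \<exists>c. T h x = scale c x} = UNIV"
    and "\<And>h k x. h \<in> H \<Longrightarrow> k \<in> H \<Longrightarrow> T h (T k x) = T k (T h x)"
  shows "span {x. \<forall>h\<in>H. \<exists>c. T h x = scale c x} = UNIV"
  using assms
proof (induction H rule: finite_induct)
  case empty
  then show ?case by simp
next
  case (insert a H)
  interpret Ta: Vector_Spaces.linear scale scale "T a" using insert by blast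
  let ?E = "\<lambda>H. {x. \<forall>h\<in>H. \<exists>c. T h x = scale c x}"
  have IH: "span (?E H) = UNIV" using insert by blast
  have "v \<in> span (?E (insert a H))" if v: "v \<in> ?E H" for v
  proof -
    obtain S x where S: "finite S" "\<forall>c\<in>S. T a (x c) = scale c (x c)" "v = sum x S"
      using eigenvector_decomposition[of "T a" v] insert.prems by blast
    have "x k \<in> ?E (insert a H)" if "k \<in> S" for k
    proof -
      have "T h (x k) = scale d (x k)" if h: "h \<in> H" and d: "T h v = scale d v" for h d
      proof -
        interpret Th: Vector_Spaces.linear scale scale "T h" using insert h by blast
        \<comment> \<open>\<open>?y c\<close> measures the failure of \<open>x c\<close> to be an
          eigenvector of \<open>T h\<close>. The failures lie in distinct eigenspaces of
          \<open>T a\<close> and add up to the failure for \<open>v\<close>, which is zero.\<close>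
        let ?y = "\<lambda>c. T h (x c) - scale d (x c)"
        have "sum ?y S = 0"
          using d unfolding S(3) by (simp add: sum_subtractf Th.sum scale_sum_right)
        moreover have "T a (?y c) = scale c (?y c)" if "c \<in> S" for c
        proof -
          have "T a (T h (x c)) = T h (T a (x c))" using insert.prems(3) h by blast
          then show ?thesis using S(2) that
            by (simp add: Ta.diff Ta.scale Th.scale scale_right_diff_distrib mult.commute)
        qed
        ultimately have "\<forall>c\<in>S. ?y c = 0"
          using S(1) insert.prems(1)
            joint_eigenvectors_independent[of S "{()}" "\<lambda>_. T a" "\<lambda>c _. c" ?y] by blast
        then show ?thesis using \<open>k \<in> S\<close> by auto
      qed
      then show ?thesis using v S(2) that by blast
    qed
    then show ?thesis unfolding S(3) by (intro span_sum span_base)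
  qed
  then have "span (?E H) \<subseteq> span (?E (insert a H))"
    by (intro span_minimal) auto
  then show ?case using IH by blast
qed

end

section \<open>Roots of a semisimple Lie algebra\<close>

lemma weight_spaceI:
  assumes "\<And>x y. x \<in> csa G \<Longrightarrow> y \<in> csa G \<Longrightarrow> l (x + y) = l x + l y"
    and "\<And>c x. x \<in> csa G \<Longrightarrow> l (smult G c x) = c * l x"
    and "\<And>x. x \<notin> csa G \<Longrightarrow> l x = 0"
  shows "l \<in> weight_space G"
  using assms by (auto simp: weight_space_def)

lemma weight_space_add: "l \<in> weight_space G \<Longrightarrow> x \<in> csa G \<Longrightarrow> y \<in> csa G \<Longrightarrow> l (x + y) = l x + l y"
  and weight_space_scale: "l \<in> weight_space G \<Longrightarrow> x \<in> csa G \<Longrightarrow> l (smult G c x) = c * l x"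
  and weight_space_out: "l \<in> weight_space G \<Longrightarrow> x \<notin> csa G \<Longrightarrow> l x = 0"
  by (auto simp: weight_space_def)

lemma zero_in_weight_space: "0 \<in> weight_space G"
  by (simp add: weight_space_def)

lemma weight_space_uminus: "l \<in> weight_space G \<Longrightarrow> - l \<in> weight_space G"
  and weight_space_plus: "l \<in> weight_space G \<Longrightarrow> m \<in> weight_space G \<Longrightarrow> l + m \<in> weight_space G"
  and weight_space_minus: "l \<in> weight_space G \<Longrightarrow> m \<in> weight_space G \<Longrightarrow> l - m \<in> weight_space G"
  and weight_space_cmult: "l \<in> weight_space G \<Longrightarrow> (\<lambda>x. c * l x) \<in> weight_space G"
  by (auto simp: weight_space_def algebra_simps)

lemma weight_space_sum:
  "(\<And>i. i \<in> S \<Longrightarrow> f i \<in> weight_space G) \<Longrightarrow> (\<lambda>x. \<Sum>i\<in>S. c i * f i x) \<in> weight_space G"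
  by (auto simp: weight_space_def algebra_simps sum.distrib sum_distrib_left)

lemma simple_refl_weight_space:
  "m \<in> weight_space G \<Longrightarrow> sroot G i \<in> weight_space G \<Longrightarrow> simple_refl G i m \<in> weight_space G"
  unfolding simple_refl_def by (auto simp: weight_space_def algebra_simps)

locale semisimple =
  fixes G :: "'g::ab_group_add lie_data"
  assumes semisimple: "semisimple_lie_algebra G"
begin

sublocale vector_space "smult G"
  using semisimple by (simp add: semisimple_lie_algebra_def lie_algebra_def)

lemma finite_spanning: obtains B where "finite B" "span B = UNIV"
  using semisimple by (auto simp: semisimple_lie_algebra_def lie_algebra_def)

lemma brk_linear_right: "Vector_Spaces.linear (smult G) (smult G) (brk G x)"
  using semisimple by (simp add: semisimple_lie_algebra_def lie_algebra_def)

lemma brk_linear_left: "Vector_Spaces.linear (smult G) (smult G) (\<lambda>x. brk G x y)"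
  using semisimple by (simp add: semisimple_lie_algebra_def lie_algebra_def)

sublocale br: Vector_Spaces.linear "smult G" "smult G" "brk G x" for x
  by (rule brk_linear_right)

sublocale bl: Vector_Spaces.linear "smult G" "smult G" "\<lambda>x. brk G x y" for y
  by (rule brk_linear_left)

lemma brk_self: "brk G x x = 0"
  using semisimple by (simp add: semisimple_lie_algebra_def lie_algebra_def)

lemma brk_anticomm: "brk G x y = - brk G y x"
proof -
  have "brk G (x + y) (x + y) = (brk G x x + brk G x y) + (brk G y x + brk G y y)"
    by (simp only: br.add bl.add add_ac)
  then have "brk G x y + brk G y x = 0" by (simp only: brk_self) simp
  then show ?thesis by (metis add.commute eq_neg_iff_add_eq_0)
qed

lemma jacobi: "brk G x (brk G y z) = brk G (brk G x y) z + brk G y (brk G x z)"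
proof -
  have "brk G x (brk G y z) + brk G y (brk G z x) + brk G z (brk G x y) = 0"
    using semisimple by (simp add: semisimple_lie_algebra_def lie_algebra_def)
  moreover have "brk G y (brk G z x) = - brk G y (brk G x z)"
    using brk_anticomm[of z x] by (simp add: br.neg)
  moreover have "brk G z (brk G x y) = - brk G (brk G x y) z"
    by (rule brk_anticomm)
  ultimately show ?thesis by (simp add: algebra_simps)
qed

lemma csa_subspace: "subspace (csa G)"
  and csa_commute: "h \<in> csa G \<Longrightarrow> k \<in> csa G \<Longrightarrow> brk G h k = 0"
  and csa_self_centralizing: "(\<And>h. h \<in> csa G \<Longrightarrow> brk G h x = 0) \<Longrightarrow> x \<in> csa G"
  and csa_diagonalizable: "h \<in> csa G \<Longrightarrow> span {x. \<exists>c. brk G h x = smult G c x} = UNIV"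
  using semisimple unfolding semisimple_lie_algebra_def cartan_subalgebra_def by blast+

lemma finite_idx: "finite (idx G)"
  and sroot_roots: "i \<in> idx G \<Longrightarrow> sroot G i \<in> roots G"
  and roots_pos_neg: "roots G = pos_roots G \<union> neg_roots G"
  using semisimple by (auto simp: semisimple_lie_algebra_def simple_roots_def)

lemma sroot_independent:
  "(\<lambda>x. \<Sum>i\<in>idx G. c i * sroot G i x) = 0 \<Longrightarrow> i \<in> idx G \<Longrightarrow> c i = 0"
  using semisimple by (auto simp: semisimple_lie_algebra_def simple_roots_def)

lemma gen_e_root: "i \<in> idx G \<Longrightarrow> gen_e G i \<in> root_space G (sroot G i)"
  and gen_f_root: "i \<in> idx G \<Longrightarrow> gen_f G i \<in> root_space G (- sroot G i)"
  and coroot_csa: "i \<in> idx G \<Longrightarrow> coroot G i \<in> csa G"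
  and sroot_coroot: "i \<in> idx G \<Longrightarrow> sroot G i (coroot G i) = 2"
  using semisimple by (auto simp: semisimple_lie_algebra_def chevalley_generators_def)

lemma roots_weight_space: "b \<in> roots G \<Longrightarrow> b \<in> weight_space G"
  by (simp add: roots_def)

lemma sroot_weight_space: "i \<in> idx G \<Longrightarrow> sroot G i \<in> weight_space G"
  using sroot_roots roots_weight_space by blast

lemma brk_commute: "h \<in> csa G \<Longrightarrow> k \<in> csa G \<Longrightarrow> brk G h (brk G k x) = brk G k (brk G h x)"
  using jacobi[of h k x] csa_commute[of h k] by (simp add: bl.zero)

lemma csa_spanning: obtains B where "finite B" "B \<subseteq> csa G" "csa G \<subseteq> span B"
proof -
  obtain B where B: "B \<subseteq> csa G" "independent B" "csa G \<subseteq> span B"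
    using maximal_independent_subset[of "csa G"] by blast
  obtain C where "finite C" "span C = UNIV" using finite_spanning .
  then have "finite B" using independent_span_bound[of C B] B by auto
  then show thesis using that B by blast
qed

text \<open>The elements acting on \<open>x\<close> by a scalar form a subspace, so it is enough to
  test a spanning set. If \<open>x\<close> is nonzero, the scalar is determined by the element and
  is therefore linear in it.\<close>

lemma joint_eigenvector_root_space:
  assumes "\<And>h. h \<in> B \<Longrightarrow> \<exists>c. brk G h x = smult G c x" "csa G \<subseteq> span B"
  shows "\<exists>b\<in>weight_space G. x \<in> root_space G b"
proof (cases "x = 0")
  case True
  then show ?thesis using zero_in_weight_space by (intro bexI[of _ 0]) (auto simp: root_space_def br.zero)
next
  case False
  have "subspace {h. \<exists>c. brk G h x = smult G c x}"
  proof (rule subspaceI)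
    show "0 \<in> {h. \<exists>c. brk G h x = smult G c x}" by (auto simp: bl.zero intro: exI[of _ 0])
  next
    fix h k assume "h \<in> {h. \<exists>c. brk G h x = smult G c x}" "k \<in> {h. \<exists>c. brk G h x = smult G c x}"
    then show "h + k \<in> {h. \<exists>c. brk G h x = smult G c x}"
      by (auto simp: bl.add scale_left_distrib[symmetric])
  next
    fix c h assume "h \<in> {h. \<exists>c. brk G h x = smult G c x}"
    then show "smult G c h \<in> {h. \<exists>c. brk G h x = smult G c x}" by (auto simp: bl.scale)
  qed
  then have "span B \<subseteq> {h. \<exists>c. brk G h x = smult G c x}"
    using assms(1) by (intro span_minimal) auto
  then have "\<forall>h\<in>csa G. \<exists>c. brk G h x = smult G c x" using assms(2) by blast
  then obtain b where b: "\<And>h. h \<in> csa G \<Longrightarrow> brk G h x = smult G (b h) x" by metis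
  \<comment> \<open>Functionals are compared as functions on the whole type, so the eigenvalue
    function is cut off outside \<open>csa G\<close>.\<close>
  define b' where "b' h = (if h \<in> csa G then b h else 0)" for h
  have b': "brk G h x = smult G (b' h) x" if "h \<in> csa G" for h
    using b[OF that] that by (simp add: b'_def)
  have eqI: "c = d" if "smult G c x = smult G d x" for c d
    using that False by simp
  have "b' \<in> weight_space G"
  proof (rule weight_spaceI)
    fix h k assume hk: "h \<in> csa G" "k \<in> csa G"
    then have "h + k \<in> csa G" using csa_subspace subspace_add by blast
    then show "b' (h + k) = b' h + b' k"
      using b'[of h] b'[of k] b'[of "h + k"] hk by (intro eqI) (simp add: bl.add scale_left_distrib)
  next
    fix c h assume h: "h \<in> csa G"
    then have "smult G c h \<in> csa G" using csa_subspace subspace_scale by blast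
    then show "b' (smult G c h) = c * b' h"
      using b'[of h] b'[of "smult G c h"] h by (intro eqI) (auto simp: bl.scale)
  next
    fix h assume "h \<notin> csa G"
    then show "b' h = 0" by (simp add: b'_def)
  qed
  then show ?thesis using b' by (auto simp: root_space_def)
qed

text \<open>Weight zero is included, so this is the full root space decomposition. A finite spanning
  set of \<open>csa G\<close> makes the induction of \<open>joint_eigenvectors_span\<close>
  applicable.\<close>

lemma root_spaces_span: "span {x. \<exists>b\<in>weight_space G. x \<in> root_space G b} = UNIV"
proof -
  obtain B where B: "finite B" "B \<subseteq> csa G" "csa G \<subseteq> span B" using csa_spanning .
  have "span {x. \<forall>h\<in>B. \<exists>c. brk G h x = smult G c x} = UNIV"
  proof (rule joint_eigenvectors_span)
    show "brk G h (brk G k x) = brk G k (brk G h x)" if "h \<in> B" "k \<in> B" for h k x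
      using brk_commute that B by blast
  qed (use B csa_diagonalizable brk_linear_right in auto)
  moreover have "{x. \<forall>h\<in>B. \<exists>c. brk G h x = smult G c x} \<subseteq> {x. \<exists>b\<in>weight_space G. x \<in> root_space G b}"
    using joint_eigenvector_root_space[of B] B by blast
  ultimately show ?thesis using span_mono by blast
qed

text \<open>If all simple roots vanish at \<open>h\<close>, so do all roots. Then \<open>h\<close>
  acts by zero on every root space and is central, and the line through it is an abelian ideal,
  which semisimplicity forbids unless \<open>h\<close> is zero.\<close>

lemma sroots_separate:
  assumes h: "h \<in> csa G" and "\<And>i. i \<in> idx G \<Longrightarrow> sroot G i h = 0"
  shows "h = 0"
proof -
  have b0: "b h = 0" if "b \<in> roots G" for b
  proof -
    have "b \<in> pos_roots G \<union> neg_roots G" using that roots_pos_neg by blast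
    then have "b \<in> nat_span (idx G) (sroot G) \<or> - b \<in> nat_span (idx G) (sroot G)"
      by (auto simp: pos_roots_def neg_roots_def)
    then obtain c where "b = (\<lambda>x. \<Sum>i\<in>idx G. of_nat (c i) * sroot G i x) \<or>
      - b = (\<lambda>x. \<Sum>i\<in>idx G. of_nat (c i) * sroot G i x)"
      by (auto simp: nat_span_def)
    then have "b h = (\<Sum>i\<in>idx G. of_nat (c i) * sroot G i h) \<or>
      (- b) h = (\<Sum>i\<in>idx G. of_nat (c i) * sroot G i h)"
      by metis
    then show ?thesis using assms(2) by simp
  qed
  have "subspace {x. brk G h x = 0}"
    by (rule subspaceI) (auto simp: br.zero br.add br.scale)
  moreover have "brk G h x = 0" if "b \<in> weight_space G" "x \<in> root_space G b" for b x
  proof (cases "b = 0 \<or> x = 0")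
    case True
    then show ?thesis using that h by (auto simp: root_space_def br.zero)
  next
    case False
    then have "b \<in> roots G" using that by (auto simp: roots_def)
    then show ?thesis using b0 that h by (simp add: root_space_def)
  qed
  ultimately have "span {x. \<exists>b\<in>weight_space G. x \<in> root_space G b} \<subseteq> {x. brk G h x = 0}"
    by (intro span_minimal) auto
  then have central: "brk G h x = 0" for x using root_spaces_span by auto
  have anni: "brk G x a = 0" if "a \<in> span {h}" for x a
  proof -
    obtain c where "a = smult G c h" using \<open>a \<in> span {h}\<close> by (auto simp: span_singleton)
    then show ?thesis using central[of x] brk_anticomm[of x h] by (simp add: br.scale)
  qed
  then have "lie_ideal G (span {h})"
    by (auto simp: lie_ideal_def span_zero)
  moreover have "{brk G x y | x y. x \<in> span {h} \<and> y \<in> span {h}} = {0}"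
    using anni span_zero by force
  then have "(derived_alg G ^^ 1) (span {h}) = {0}"
    using span_insert_0[of "{}"] by (simp add: derived_alg_def)
  then have "lie_solvable G (span {h})" unfolding lie_solvable_def by blast
  ultimately have "span {h} = {0}"
    using semisimple by (auto simp: semisimple_lie_algebra_def lie_semisimple_def)
  then show ?thesis using span_base[of h "{h}"] by auto
qed

lemma weight_eqI:
  assumes "b \<in> weight_space G" "c \<in> weight_space G" "\<And>h. h \<in> csa G \<Longrightarrow> b h = c h"
  shows "b = c"
proof (rule ext)
  fix h show "b h = c h" using assms by (cases "h \<in> csa G") (auto simp: weight_space_out)
qed

lemma finite_roots: "finite (roots G)"
proof -
  obtain B where B: "finite B" "span B = UNIV" using finite_spanning .
  show ?thesis
  proof (rule finite_joint_eigenvalues[OF B, of "csa G" "brk G" _ "\<lambda>b. b"])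
    fix k l assume "k \<in> roots G" "l \<in> roots G" "k \<noteq> l"
    then show "\<exists>h\<in>csa G. k h \<noteq> l h" using weight_eqI roots_weight_space by blast
  next
    fix k assume k: "k \<in> roots G"
    have "0 \<in> root_space G k" by (simp add: root_space_def br.zero)
    then obtain x where "x \<in> root_space G k" "x \<noteq> 0"
      using k by (auto simp: roots_def)
    then show "\<exists>x. x \<noteq> 0 \<and> (\<forall>h\<in>csa G. brk G h x = smult G (k h) x)"
      by (auto simp: root_space_def)
  qed (rule brk_linear_right)
qed

section \<open>Strings of sl2 triples and the reflections they induce on roots\<close>

lemma eigenvector_shift_nilpotent:
  assumes "Vector_Spaces.linear (smult G) (smult G) H"
    and HE: "\<And>y. H (E y) = E (H y) + smult G c (E y)" and "c \<noteq> 0"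
    and E: "Vector_Spaces.linear (smult G) (smult G) E"
    and x: "x \<noteq> 0" "H x = smult G lam x"
  shows "\<exists>p. (E ^^ p) x \<noteq> 0 \<and> (E ^^ Suc p) x = 0"
proof -
  interpret E: Vector_Spaces.linear "smult G" "smult G" E by fact
  have eig: "H ((E ^^ p) x) = smult G (lam + of_nat p * c) ((E ^^ p) x)" for p
    by (induction p) (auto simp: x HE E.scale E.add scale_left_distrib algebra_simps)
  have "\<exists>p. (E ^^ p) x = 0"
  proof (rule ccontr)
    assume nz: "\<not> (\<exists>p. (E ^^ p) x = 0)"
    obtain B where B: "finite B" "span B = UNIV" using finite_spanning .
    \<comment> \<open>Otherwise the values lam + p c, pairwise distinct because \<open>c\<close> is
      nonzero, would all be eigenvalues of \<open>H\<close>.\<close>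
    have "finite (range (\<lambda>p. lam + of_nat p * c))"
      by (rule finite_joint_eigenvalues[OF B, of "{()}" "\<lambda>_. H" _ "\<lambda>c _. c"])
        (use assms nz eig in \<open>auto simp del: funpow.simps\<close>)
    moreover have "inj (\<lambda>p::nat. lam + of_nat p * c)" using \<open>c \<noteq> 0\<close> by (auto intro: injI)
    ultimately show False using finite_imageD infinite_UNIV_nat by blast
  qed
  then obtain q where q: "(E ^^ q) x = 0" "\<And>p. p < q \<Longrightarrow> (E ^^ p) x \<noteq> 0"
    using exists_least_iff[of "\<lambda>p. (E ^^ p) x = 0"] by blast
  then show ?thesis using x by (cases q) (auto simp del: funpow.simps simp: funpow_0)
qed

text \<open>Climbing from \<open>x\<close> with \<open>E\<close> ends at a highest vector v of
  weight m = lam + 2p. On the string below it \<open>E\<close> undoes \<open>F\<close> up to an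
  explicit factor. The factor met just below the last nonzero vector F^k v must vanish, which forces
  m = k.\<close>

lemma sl2_string:
  assumes E: "Vector_Spaces.linear (smult G) (smult G) E"
    and F: "Vector_Spaces.linear (smult G) (smult G) F"
    and H: "Vector_Spaces.linear (smult G) (smult G) H"
    and HE: "\<And>y. H (E y) = E (H y) + smult G 2 (E y)"
    and HF: "\<And>y. H (F y) = F (H y) + smult G (- 2) (F y)"
    and EF: "\<And>y. E (F y) = F (E y) + H y"
    and x: "x \<noteq> 0" "H x = smult G lam x"
  shows "\<exists>p k :: nat. lam + 2 * of_nat p = of_nat k \<and> (\<forall>j\<le>k. (F ^^ j) ((E ^^ p) x) \<noteq> 0)"
proof -
  interpret E: Vector_Spaces.linear "smult G" "smult G" E by fact
  interpret F: Vector_Spaces.linear "smult G" "smult G" F by fact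
  obtain p where p: "(E ^^ p) x \<noteq> 0" "(E ^^ Suc p) x = 0"
    using eigenvector_shift_nilpotent[OF H HE _ E x] by auto
  define v where "v = (E ^^ p) x"
  define m where "m = lam + 2 * of_nat p"
  have "H ((E ^^ p) x) = smult G (lam + 2 * of_nat p) ((E ^^ p) x)" for p
    by (induction p) (auto simp: x HE E.scale E.add scale_left_distrib algebra_simps)
  then have v: "v \<noteq> 0" "E v = 0" "H v = smult G m v" using p by (auto simp: v_def m_def)
  obtain k where k: "(F ^^ k) v \<noteq> 0" "(F ^^ Suc k) v = 0"
    using eigenvector_shift_nilpotent[OF H HF _ F v(1,3)] by auto
  have HFv: "H ((F ^^ j) v) = smult G (m - 2 * of_nat j) ((F ^^ j) v)" for j
  proof (induction j)
    case 0
    then show ?case by (simp add: v)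
  next
    case (Suc j)
    have "H ((F ^^ Suc j) v) = smult G (m - 2 * of_nat j + (- 2)) ((F ^^ Suc j) v)"
      unfolding funpow.simps o_apply HF Suc.IH by (simp only: F.scale scale_left_distrib)
    then show ?case by (simp add: algebra_simps)
  qed
  \<comment> \<open>The factor (j+1)(m - j) is the sum of the weights m, m - 2, ..., m - 2j
    collected while \<open>E\<close> is commuted past the copies of \<open>F\<close>, since
    \<open>E\<close> kills \<open>v\<close>.\<close>
  have EFv: "E ((F ^^ Suc j) v) = smult G (of_nat (Suc j) * (m - of_nat j)) ((F ^^ j) v)" for j
  proof (induction j)
    case 0
    then show ?case by (simp add: EF v F.zero)
  next
    case (Suc j)
    have "E ((F ^^ Suc (Suc j)) v) = F (E ((F ^^ Suc j) v)) + H ((F ^^ Suc j) v)"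
      using EF[of "(F ^^ Suc j) v"] by simp
    also have "\<dots> = smult G (of_nat (Suc j) * (m - of_nat j) + (m - 2 * of_nat (Suc j))) ((F ^^ Suc j) v)"
      unfolding Suc.IH HFv by (simp add: F.scale scale_left_distrib)
    also have "of_nat (Suc j) * (m - of_nat j) + (m - 2 * of_nat (Suc j)) = of_nat (Suc (Suc j)) * (m - of_nat (Suc j))"
      by (simp add: algebra_simps)
    finally show ?case .
  qed
  have "m = of_nat k" using EFv[of k] k by (simp add: E.zero del: of_nat_Suc)
  moreover have "(F ^^ j) v \<noteq> 0" if "j \<le> k" for j
  proof
    assume "(F ^^ j) v = 0"
    moreover have "(F ^^ k) v = (F ^^ (k - j)) ((F ^^ j) v)"
      using that by (metis comp_apply funpow_add le_add_diff_inverse2)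
    moreover have "(F ^^ i) 0 = 0" for i by (induction i) (auto simp: F.zero)
    ultimately show False using k by simp
  qed
  ultimately show ?thesis unfolding v_def m_def by blast
qed

lemma root_space_brk:
  assumes "x \<in> root_space G a" "y \<in> root_space G b"
  shows "brk G x y \<in> root_space G (\<lambda>h. a h + b h)"
  using assms jacobi[of _ x y] by (simp add: root_space_def br.scale bl.scale scale_left_distrib)

lemma root_space_funpow:
  assumes "e \<in> root_space G a" "x \<in> root_space G b"
  shows "(brk G e ^^ p) x \<in> root_space G (\<lambda>h. b h + of_nat p * a h)"
proof (induction p)
  case 0
  then show ?case using assms by simp
next
  case (Suc p)
  show ?case using root_space_brk[OF assms(1) Suc.IH] by (simp add: algebra_simps)
qed

text \<open>Let the top of the string be p steps above \<open>b\<close> and let its weight be k, so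
  that b(h) = k - 2p. The reflected weight b - (k - 2p) a is reached from the top by k - p steps
  downward, and these vectors are nonzero up to step k. The sign condition gives p \<le> k; the
  other sign is covered by exchanging \<open>e\<close> and \<open>f\<close>.\<close>

lemma reflected_weight:
  assumes e: "e \<in> root_space G a" and f: "f \<in> root_space G (- a)"
    and ah: "brk G e f \<in> csa G" "a (brk G e f) = 2"
    and x: "x \<noteq> 0" "x \<in> root_space G b"
    and sgn: "Re (b (brk G e f)) \<ge> 0"
  shows "\<exists>y. y \<noteq> 0 \<and> y \<in> root_space G (\<lambda>z. b z - b (brk G e f) * a z)"
proof -
  let ?h = "brk G e f" and ?E = "brk G e" and ?F = "brk G f"
  have he: "brk G ?h e = smult G 2 e" and hf: "brk G ?h f = smult G (- 2) f"
    using e f ah by (auto simp: root_space_def)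
  have "\<exists>p k :: nat. b ?h + 2 * of_nat p = of_nat k \<and> (\<forall>j\<le>k. (?F ^^ j) ((?E ^^ p) x) \<noteq> 0)"
  proof (rule sl2_string[where H = "brk G ?h"])
    show "brk G ?h (?E y) = ?E (brk G ?h y) + smult G 2 (?E y)" for y
      using jacobi[of ?h e y] he by (simp add: bl.scale add.commute)
    show "brk G ?h (?F y) = ?F (brk G ?h y) + smult G (- 2) (?F y)" for y
      using jacobi[of ?h f y] hf bl.scale[of "- 2" f y] by (simp only: add.commute)
    show "?E (?F y) = ?F (?E y) + brk G ?h y" for y
      using jacobi[of e f y] by (simp add: add.commute)
    show "brk G ?h x = smult G (b ?h) x" using x ah by (simp add: root_space_def)
  qed (use brk_linear_right x in auto)
  then obtain p k :: nat where pk: "b ?h + 2 * of_nat p = of_nat k"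
    "\<And>j. j \<le> k \<Longrightarrow> (?F ^^ j) ((?E ^^ p) x) \<noteq> 0" by blast
  have bh: "b ?h = of_nat k - 2 * of_nat p" using pk(1) by (simp add: algebra_simps)
  then have "real k - 2 * real p \<ge> 0" using sgn by simp
  then have "p \<le> k" by linarith
  have "(?F ^^ (k - p)) ((?E ^^ p) x) \<in> root_space G (\<lambda>h. (b h + of_nat p * a h) + of_nat (k - p) * (- a) h)"
    by (intro root_space_funpow e f x)
  moreover have "(\<lambda>h. (b h + of_nat p * a h) + of_nat (k - p) * (- a) h) = (\<lambda>z. b z - b ?h * a z)"
    using \<open>p \<le> k\<close> by (auto simp: bh of_nat_diff algebra_simps)
  ultimately show ?thesis using pk(2)[of "k - p"] by auto
qed

lemma simple_refl_simple_refl: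
  "i \<in> idx G \<Longrightarrow> simple_refl G i (simple_refl G i m) = m"
  by (auto simp: simple_refl_def sroot_coroot algebra_simps)

lemma simple_refl_roots:
  assumes i: "i \<in> idx G" and b: "b \<in> roots G"
  shows "simple_refl G i b \<in> roots G"
proof -
  have h: "brk G (gen_e G i) (gen_f G i) = coroot G i" by (simp add: coroot_def)
  \<comment> \<open>With \<open>gen_e\<close> and \<open>gen_f\<close> exchanged, the triple belongs
    to the opposite root and the opposite coroot. It induces the same reflection and covers the
    negative values of \<open>b\<close> on the coroot.\<close>
  have h': "brk G (gen_f G i) (gen_e G i) = - coroot G i"
    using brk_anticomm[of "gen_f G i"] by (simp add: h)
  have mh: "- coroot G i \<in> csa G"
    using coroot_csa[OF i] csa_subspace subspace_neg by blast
  have neg: "l (- coroot G i) = - l (coroot G i)" if "l \<in> weight_space G" for l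
    using weight_space_scale[OF that coroot_csa[OF i], of "- 1"] by simp
  have "0 \<in> root_space G b" by (simp add: root_space_def br.zero)
  then obtain x where x: "x \<noteq> 0" "x \<in> root_space G b" using b by (auto simp: roots_def)
  have "\<exists>y. y \<noteq> 0 \<and> y \<in> root_space G (simple_refl G i b)"
  proof (cases "Re (b (coroot G i)) \<ge> 0")
    case True
    then show ?thesis
      using reflected_weight[OF gen_e_root[OF i] gen_f_root[OF i] _ _ x] sroot_coroot[OF i]
        coroot_csa[OF i] by (simp add: h simple_refl_def)
  next
    case False
    then show ?thesis
      using reflected_weight[where e = "gen_f G i" and f = "gen_e G i" and a = "- sroot G i", OF _ _ _ _ x]
        gen_e_root[OF i] gen_f_root[OF i] sroot_coroot[OF i] mh
        neg[OF roots_weight_space[OF b]] neg[OF sroot_weight_space[OF i]]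
      by (simp add: h' simple_refl_def)
  qed
  moreover have "simple_refl G i b \<noteq> 0"
  proof
    assume "simple_refl G i b = 0"
    then have "b = simple_refl G i 0" using simple_refl_simple_refl[OF i, of b] by simp
    also have "\<dots> = 0" by (auto simp: simple_refl_def)
    finally show False using b by (simp add: roots_def)
  qed
  ultimately show ?thesis
    using simple_refl_weight_space roots_weight_space[OF b] sroot_weight_space[OF i]
    by (auto simp: roots_def)
qed

end

section \<open>Simple reflections and fundamental weights\<close>

text \<open>The hypothesis says that the rows of \<open>M\<close> are independent. There are as many
  rows as coordinates, so a right-hand side outside their span would give an independent set larger
  than the dimension. Functions vanishing off \<open>I\<close> serve as coordinate vectors, so the
  index set needs no enumeration.\<close>

lemma nondegenerate_solvable:
  fixes M :: "'i \<Rightarrow> 'i \<Rightarrow> complex"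
  assumes "finite I"
    and nondeg: "\<And>c. (\<And>j. j \<in> I \<Longrightarrow> (\<Sum>i\<in>I. c i * M i j) = 0) \<Longrightarrow> \<forall>i\<in>I. c i = 0"
  shows "\<exists>c. \<forall>j\<in>I. (\<Sum>i\<in>I. c i * M i j) = b j"
proof -
  interpret F: vector_space "\<lambda>(c::complex) (f :: 'i \<Rightarrow> complex). (\<lambda>j. c * f j)"
    by unfold_locales (auto simp: algebra_simps)
  define v where "v i = (\<lambda>j. if j \<in> I then M i j else 0)" for i
  define e where "e i = (\<lambda>j. if j = i then 1 else 0 :: complex)" for i :: 'i
  have sum_fun: "(\<Sum>i\<in>S. f i) x = (\<Sum>i\<in>S. f i x)" for f :: "'b \<Rightarrow> 'i \<Rightarrow> complex" and S x
    by (induction S rule: infinite_finite_induct) auto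
  have inj: "inj_on v I"
  proof (rule inj_onI, rule ccontr)
    fix i k assume ik: "i \<in> I" "k \<in> I" "v i = v k" "i \<noteq> k"
    define c where "c l = (if l = i then 1 else if l = k then -1 else 0 :: complex)" for l
    have "(\<Sum>l\<in>I. c l * M l j) = 0" if "j \<in> I" for j
    proof -
      have "(\<Sum>l\<in>I. c l * M l j) = (\<Sum>l\<in>{i, k}. c l * M l j)"
        using ik \<open>finite I\<close> by (intro sum.mono_neutral_right) (auto simp: c_def)
      also have "\<dots> = M i j - M k j" using ik by (simp add: c_def)
      also have "\<dots> = 0" using fun_cong[OF ik(3), of j] that by (simp add: v_def)
      finally show ?thesis .
    qed
    then have "c i = 0" using nondeg ik by blast
    then show False by (simp add: c_def)
  qed
  have ind: "F.independent (v ` I)"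
  proof (rule F.independent_if_scalars_zero)
    fix f x assume s: "(\<Sum>y\<in>v ` I. (\<lambda>j. f y * y j)) = 0" and x: "x \<in> v ` I"
    have "(\<Sum>i\<in>I. f (v i) * M i j) = 0" if "j \<in> I" for j
    proof -
      have "(\<Sum>y\<in>v ` I. (\<lambda>j. f y * y j)) j = (\<Sum>i\<in>I. f (v i) * v i j)"
        by (simp add: sum_fun sum.reindex inj)
      then show ?thesis using s that by (simp add: v_def)
    qed
    then show "f x = 0" using nondeg[of "\<lambda>i. f (v i)"] x by blast
  qed (use \<open>finite I\<close> in auto)
  have expand: "u = (\<Sum>i\<in>I. (\<lambda>j. u i * e i j))" if "\<And>j. j \<notin> I \<Longrightarrow> u j = 0" for u
  proof (rule ext)
    fix j
    have "(\<Sum>i\<in>I. (\<lambda>j. u i * e i j)) j = (\<Sum>i\<in>I. if i = j then u i else 0)"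
      unfolding sum_fun by (rule sum.cong) (auto simp: e_def)
    then show "u j = (\<Sum>i\<in>I. (\<lambda>j. u i * e i j)) j"
      using that[of j] \<open>finite I\<close> by (cases "j \<in> I") simp_all
  qed
  have in_span: "u \<in> F.span (e ` I)" if "\<And>j. j \<notin> I \<Longrightarrow> u j = 0" for u
  proof -
    have "(\<Sum>i\<in>I. (\<lambda>j. u i * e i j)) \<in> F.span (e ` I)"
      by (intro F.span_sum F.span_scale F.span_base imageI)
    then show ?thesis using expand[of u] that by metis
  qed
  have sub: "v ` I \<subseteq> F.span (e ` I)" by (auto intro!: in_span simp: v_def)
  define b' where "b' j = (if j \<in> I then b j else 0)" for j
  have "b' \<in> F.span (v ` I)"
  proof (rule ccontr)
    assume notin: "b' \<notin> F.span (v ` I)"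
    then have "F.independent (insert b' (v ` I))" using ind F.independent_insertI by blast
    moreover have "insert b' (v ` I) \<subseteq> F.span (e ` I)" using sub in_span[of b'] by (simp add: b'_def)
    ultimately have "card (insert b' (v ` I)) \<le> card (e ` I)"
      using F.independent_span_bound[of "e ` I"] \<open>finite I\<close> by blast
    moreover have "b' \<notin> v ` I" using notin F.span_base by blast
    ultimately show False
      using card_image[OF inj] card_image_le[OF \<open>finite I\<close>, of e] \<open>finite I\<close> by simp
  qed
  then obtain u where u: "b' = (\<Sum>y\<in>v ` I. (\<lambda>j. u y * y j))"
    using F.span_finite[of "v ` I"] \<open>finite I\<close> by auto
  have "(\<Sum>i\<in>I. u (v i) * M i j) = b j" if "j \<in> I" for j
  proof -
    have "b' j = (\<Sum>i\<in>I. u (v i) * v i j)" unfolding u by (simp add: sum_fun sum.reindex inj)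
    then show ?thesis using that by (simp add: b'_def v_def)
  qed
  then show ?thesis by (intro exI[of _ "\<lambda>i. u (v i)"]) blast
qed

text \<open>Linearity is required on all functions, not only on the weight space. Reflections and
  \<open>Theta\<close> are given by formulas that make sense everywhere, so no membership conditions
  arise in computations.\<close>

definition fun_linear :: "(('g \<Rightarrow> complex) \<Rightarrow> ('g \<Rightarrow> complex)) \<Rightarrow> bool" where
  "fun_linear \<phi> \<longleftrightarrow> (\<forall>l m. \<phi> (l + m) = \<phi> l + \<phi> m) \<and> (\<forall>c l. \<phi> (\<lambda>x. c * l x) = (\<lambda>x. c * \<phi> l x))"

lemma fun_linear_add: "fun_linear \<phi> \<Longrightarrow> \<phi> (l + m) = \<phi> l + \<phi> m"
  and fun_linear_cmult: "fun_linear \<phi> \<Longrightarrow> \<phi> (\<lambda>x. c * l x) = (\<lambda>x. c * \<phi> l x)"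
  by (auto simp: fun_linear_def)

lemma fun_linear_0: "fun_linear \<phi> \<Longrightarrow> \<phi> 0 = 0"
  using fun_linear_cmult[of \<phi> 0 0] by (simp add: zero_fun_def)

lemma fun_linear_uminus: "fun_linear \<phi> \<Longrightarrow> \<phi> (- l) = - \<phi> l"
  using fun_linear_cmult[of \<phi> "- 1" l] by (simp add: fun_Compl_def)

lemma fun_linear_diff: "fun_linear \<phi> \<Longrightarrow> \<phi> (l - m) = \<phi> l - \<phi> m"
  using fun_linear_add[of \<phi> l "- m"] fun_linear_uminus[of \<phi> m] by simp

lemma fun_linear_sum:
  assumes "fun_linear \<phi>"
  shows "\<phi> (\<lambda>x. \<Sum>i\<in>S. c i * f i x) = (\<lambda>x. \<Sum>i\<in>S. c i * \<phi> (f i) x)"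
proof (induction S rule: infinite_finite_induct)
  case (insert i S)
  have "(\<lambda>x. \<Sum>i\<in>insert i S. c i * f i x) = (\<lambda>x. c i * f i x) + (\<lambda>x. \<Sum>i\<in>S. c i * f i x)"
    using insert by auto
  then have "\<phi> (\<lambda>x. \<Sum>i\<in>insert i S. c i * f i x) = (\<lambda>x. c i * \<phi> (f i) x) + \<phi> (\<lambda>x. \<Sum>i\<in>S. c i * f i x)"
    using fun_linear_add[OF assms] fun_linear_cmult[OF assms] by simp
  then show ?case using insert by auto
qed (use fun_linear_0[OF assms] in \<open>auto simp: zero_fun_def\<close>)

lemma fun_linear_comp: "fun_linear \<phi> \<Longrightarrow> fun_linear \<psi> \<Longrightarrow> fun_linear (\<lambda>l. \<phi> (\<psi> l))"
  by (simp add: fun_linear_def)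

lemma fun_linear_neg: "fun_linear \<phi> \<Longrightarrow> fun_linear (\<lambda>l. - \<phi> l)"
  by (auto simp: fun_linear_def)

lemma fun_linear_simple_refl: "fun_linear (simple_refl G i)"
  by (auto simp: fun_linear_def simple_refl_def algebra_simps)

lemma fun_linear_Theta: "fun_linear (Theta \<theta>)"
  by (auto simp: fun_linear_def Theta_def)

text \<open>\<open>weyl_elt\<close> cuts this action off outside the weight space to make equality
  of Weyl group elements meaningful; the action without the cut is linear on all functions.\<close>

abbreviation word_act :: "'g::ab_group_add lie_data \<Rightarrow> nat list \<Rightarrow> ('g \<Rightarrow> complex) \<Rightarrow> ('g \<Rightarrow> complex)" where
  "word_act G ws \<equiv> foldr (simple_refl G) ws"

lemma fun_linear_word_act: "fun_linear (word_act G ws)"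
proof (induction ws)
  case Nil
  then show ?case by (simp add: fun_linear_def)
next
  case (Cons i ws)
  have "word_act G (i # ws) = (\<lambda>l. simple_refl G i (word_act G ws l))" by auto
  then show ?case using fun_linear_comp[OF fun_linear_simple_refl Cons.IH] by metis
qed

definition root_span :: "'g::ab_group_add lie_data \<Rightarrow> nat set \<Rightarrow> ('g \<Rightarrow> complex) set" where
  "root_span G J = {\<lambda>x. \<Sum>j\<in>J. c j * sroot G j x | c. True}"

lemma root_spanI: "(\<lambda>x. \<Sum>j\<in>J. c j * sroot G j x) \<in> root_span G J"
  by (auto simp: root_span_def)

lemma root_span_add: "z \<in> root_span G J \<Longrightarrow> y \<in> root_span G J \<Longrightarrow> z + y \<in> root_span G J"
proof -
  assume "z \<in> root_span G J" "y \<in> root_span G J"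
  then obtain c d where "z = (\<lambda>x. \<Sum>j\<in>J. c j * sroot G j x)" "y = (\<lambda>x. \<Sum>j\<in>J. d j * sroot G j x)"
    by (auto simp: root_span_def)
  then have "z + y = (\<lambda>x. \<Sum>j\<in>J. (c j + d j) * sroot G j x)"
    by (auto simp: sum.distrib algebra_simps)
  then show "z + y \<in> root_span G J" by (auto simp: root_span_def)
qed

lemma root_span_cmult: "z \<in> root_span G J \<Longrightarrow> (\<lambda>x. a * z x) \<in> root_span G J"
proof -
  assume "z \<in> root_span G J"
  then obtain c where "z = (\<lambda>x. \<Sum>j\<in>J. c j * sroot G j x)" by (auto simp: root_span_def)
  then have "(\<lambda>x. a * z x) = (\<lambda>x. \<Sum>j\<in>J. (a * c j) * sroot G j x)"
    by (auto simp: sum_distrib_left algebra_simps)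
  then show "(\<lambda>x. a * z x) \<in> root_span G J" using root_spanI[of "\<lambda>j. a * c j" G J] by (simp add: mult.assoc)
qed

lemma root_span_uminus: "z \<in> root_span G J \<Longrightarrow> - z \<in> root_span G J"
  using root_span_cmult[of z G J "- 1"] by (simp add: fun_Compl_def)

lemma root_span_diff: "z \<in> root_span G J \<Longrightarrow> y \<in> root_span G J \<Longrightarrow> z - y \<in> root_span G J"
  using root_span_add[of z G J "- y"] root_span_uminus[of y G J] by simp

lemma root_span_0: "0 \<in> root_span G J"
  using root_spanI[of "\<lambda>_. 0" G J] by (simp add: zero_fun_def)

lemma root_span_sroot: "finite J \<Longrightarrow> j \<in> J \<Longrightarrow> sroot G j \<in> root_span G J"
proof -
  assume "finite J" "j \<in> J"
  then have "sroot G j = (\<lambda>x. \<Sum>k\<in>J. (if k = j then 1 else 0) * sroot G k x)"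
    by (auto simp: if_distrib[of "\<lambda>a. a * _"] cong: if_cong)
  then show ?thesis using root_spanI[of "\<lambda>k. if k = j then 1 else 0" G J] by metis
qed

lemma root_span_fixed:
  assumes "fun_linear \<phi>" "\<And>j. j \<in> J \<Longrightarrow> \<phi> (sroot G j) = sroot G j" "z \<in> root_span G J"
  shows "\<phi> z = z"
proof -
  obtain c where "z = (\<lambda>x. \<Sum>j\<in>J. c j * sroot G j x)" using assms by (auto simp: root_span_def)
  then show ?thesis using fun_linear_sum[OF assms(1), of c "sroot G" J] assms(2) by simp
qed

section \<open>The reflection action on roots and the nondegeneracy of the Cartan matrix\<close>

context semisimple
begin

text \<open>Zero counts as \<open>pos\<close>, so opposite signs exclude each other only for nonzero
  elements.\<close>

abbreviation "pos b \<equiv> b \<in> nat_span (idx G) (sroot G)"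

text \<open>
  Roots are closed under negation; adding the negatives by hand avoids the Killing form.
\<close>

definition signed_roots :: "('g \<Rightarrow> complex) set" where
  "signed_roots = roots G \<union> uminus ` roots G"

lemma finite_signed_roots: "finite signed_roots"
  using finite_roots by (simp add: signed_roots_def)

lemma signed_roots_weight_space: "b \<in> signed_roots \<Longrightarrow> b \<in> weight_space G"
  using roots_weight_space weight_space_uminus by (auto simp: signed_roots_def)

lemma signed_roots_uminus: "b \<in> signed_roots \<Longrightarrow> - b \<in> signed_roots"
  by (auto simp: signed_roots_def)

lemma signed_roots_nonzero: "b \<in> signed_roots \<Longrightarrow> b \<noteq> 0"
  by (auto simp: signed_roots_def roots_def)

lemma sroot_signed_roots: "i \<in> idx G \<Longrightarrow> sroot G i \<in> signed_roots"
  using sroot_roots by (simp add: signed_roots_def)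

lemma signed_roots_pos_or_neg: "b \<in> signed_roots \<Longrightarrow> pos b \<or> pos (- b)"
proof -
  have "pos b \<or> pos (- b)" if "b \<in> roots G" for b
  proof -
    have "b \<in> pos_roots G \<union> neg_roots G" using that roots_pos_neg by blast
    then show ?thesis by (auto simp: pos_roots_def neg_roots_def)
  qed
  then show "b \<in> signed_roots \<Longrightarrow> pos b \<or> pos (- b)" by (force simp: signed_roots_def)
qed

lemma simple_refl_signed_roots:
  "i \<in> idx G \<Longrightarrow> b \<in> signed_roots \<Longrightarrow> simple_refl G i b \<in> signed_roots"
  using simple_refl_roots[of i] fun_linear_uminus[OF fun_linear_simple_refl, of G i]
  by (auto simp: signed_roots_def)

lemma word_act_signed_roots:
  "set ws \<subseteq> idx G \<Longrightarrow> b \<in> signed_roots \<Longrightarrow> word_act G ws b \<in> signed_roots"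
  by (induction ws) (auto intro: simple_refl_signed_roots)

lemma word_act_weight_space:
  "set ws \<subseteq> idx G \<Longrightarrow> m \<in> weight_space G \<Longrightarrow> word_act G ws m \<in> weight_space G"
  by (induction ws) (auto intro: simple_refl_weight_space sroot_weight_space)

lemma word_act_append: "word_act G (ws @ us) m = word_act G ws (word_act G us m)"
  by simp

lemma word_act_rev: "set ws \<subseteq> idx G \<Longrightarrow> word_act G (rev ws) (word_act G ws m) = m"
  by (induction ws arbitrary: m) (auto simp: simple_refl_simple_refl)

lemma word_act_rev': "set ws \<subseteq> idx G \<Longrightarrow> word_act G ws (word_act G (rev ws) m) = m"
  using word_act_rev[of "rev ws" m] by simp

lemma simple_refl_sroot: "i \<in> idx G \<Longrightarrow> simple_refl G i (sroot G i) = - sroot G i"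
  by (auto simp: simple_refl_def sroot_coroot)

lemma sroot_coeff_unique:
  assumes "(\<lambda>x. \<Sum>i\<in>idx G. c i * sroot G i x) = (\<lambda>x. \<Sum>i\<in>idx G. d i * sroot G i x)" "i \<in> idx G"
  shows "c i = d i"
proof -
  have "(\<lambda>x. \<Sum>i\<in>idx G. (c i - d i) * sroot G i x) = 0"
    using fun_cong[OF assms(1)] by (auto simp: left_diff_distrib sum_subtractf)
  then show ?thesis using sroot_independent[of "\<lambda>i. c i - d i" i] assms(2) by simp
qed

lemma simple_refl_root_span:
  "finite J \<Longrightarrow> i \<in> J \<Longrightarrow> simple_refl G i m - m \<in> root_span G J"
proof -
  assume "finite J" "i \<in> J"
  then have "(\<lambda>x. (- m (coroot G i)) * sroot G i x) \<in> root_span G J"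
    by (intro root_span_cmult root_span_sroot)
  moreover have "simple_refl G i m - m = (\<lambda>x. (- m (coroot G i)) * sroot G i x)"
    by (auto simp: simple_refl_def)
  ultimately show ?thesis by simp
qed

lemma word_act_root_span:
  "finite J \<Longrightarrow> set ws \<subseteq> J \<Longrightarrow> word_act G ws m - m \<in> root_span G J"
proof (induction ws)
  case Nil
  then show ?case using root_span_0 by (simp add: zero_fun_def)
next
  case (Cons i ws)
  have "(simple_refl G i (word_act G ws m) - word_act G ws m) + (word_act G ws m - m) \<in> root_span G J"
  proof (rule root_span_add)
    show "simple_refl G i (word_act G ws m) - word_act G ws m \<in> root_span G J"
      by (rule simple_refl_root_span) (use Cons.prems in auto)
    show "word_act G ws m - m \<in> root_span G J"
      by (rule Cons.IH) (use Cons.prems in auto)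
  qed
  moreover have "(simple_refl G i (word_act G ws m) - word_act G ws m) + (word_act G ws m - m) =
    word_act G (i # ws) m - m" by (simp add: fun_eq_iff)
  ultimately show ?case by metis
qed

lemma word_act_fixed:
  "(\<And>j. j \<in> set ws \<Longrightarrow> m (coroot G j) = 0) \<Longrightarrow> word_act G ws m = m"
  by (induction ws) (auto simp: simple_refl_def)

text \<open>
  Summing over the finite group generated by the reflections in \<open>J\<close> kills each simple root
  of \<open>J\<close>, but multiplies an invariant vector by the group order.
\<close>

lemma root_span_nondegenerate:
  assumes J: "J \<subseteq> idx G" and z: "z \<in> root_span G J"
    and z0: "\<And>j. j \<in> J \<Longrightarrow> z (coroot G j) = 0"
  shows "z = 0"
proof -
  obtain c where c: "z = (\<lambda>x. \<Sum>j\<in>J. c j * sroot G j x)" using z by (auto simp: root_span_def)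
  \<comment> \<open>Words are identified when they agree on \<open>signed_roots\<close>. This makes
    \<open>T\<close> finite at once, and the simple roots, where the elements are evaluated, lie in
    that set.\<close>
  define T where "T = {restrict (word_act G ws) signed_roots | ws. set ws \<subseteq> J}"
  have "T \<subseteq> signed_roots \<rightarrow>\<^sub>E signed_roots"
    using word_act_signed_roots J by (auto simp: T_def)
  then have "finite T"
    by (rule finite_subset) (intro finite_PiE finite_signed_roots)
  moreover have "restrict (word_act G []) signed_roots \<in> T"
    unfolding T_def by (intro CollectI exI[of _ "[]"]) simp
  ultimately have cardT: "card T > 0" by (auto simp: card_gt_0_iff)
  have inv: "(\<Sum>j\<in>J. c j * t (sroot G j) x) = z x" if tT: "t \<in> T" for t x
  proof -
    obtain ws where ws: "set ws \<subseteq> J" "t = restrict (word_act G ws) signed_roots"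
      using tT by (auto simp: T_def)
    have "word_act G ws z = z" by (rule word_act_fixed) (use ws z0 in blast)
    then have "z = word_act G ws z" ..
    also have "\<dots> = (\<lambda>x. \<Sum>j\<in>J. c j * word_act G ws (sroot G j) x)"
      unfolding c by (rule fun_linear_sum[OF fun_linear_word_act])
    finally have "z x = (\<Sum>j\<in>J. c j * word_act G ws (sroot G j) x)" by meson
    also have "\<dots> = (\<Sum>j\<in>J. c j * t (sroot G j) x)"
      using sroot_signed_roots J by (intro sum.cong) (auto simp: ws)
    finally show ?thesis by simp
  qed
  have zero: "(\<Sum>t\<in>T. t (sroot G j) x) = 0" if j: "j \<in> J" for j x
  proof -
    \<comment> \<open>Right multiplication by the reflection in \<open>j\<close>. It is an
      involution of \<open>T\<close> that changes the sign of the value at \<open>sroot G j\<close>,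
      so the sum of these values is its own negative.\<close>
    define f where "f t = restrict (\<lambda>b. t (simple_refl G j b)) signed_roots" for t :: "('g \<Rightarrow> complex) \<Rightarrow> 'g \<Rightarrow> complex"
    have jI: "j \<in> idx G" using j J by blast
    have fT: "f t \<in> T" if tT: "t \<in> T" for t
    proof -
      obtain ws where ws: "set ws \<subseteq> J" "t = restrict (word_act G ws) signed_roots"
        using tT by (auto simp: T_def)
      have "f t = restrict (word_act G (ws @ [j])) signed_roots"
        using simple_refl_signed_roots[OF jI] by (auto simp: f_def ws)
      then show ?thesis using ws(1) j unfolding T_def by (intro CollectI exI[of _ "ws @ [j]"]) simp
    qed
    have ff: "f (f t) = t" if tT: "t \<in> T" for t
    proof -
      have "f (f t) = restrict t signed_roots"
        using simple_refl_signed_roots[OF jI] by (auto simp: f_def simple_refl_simple_refl[OF jI])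
      also have "\<dots> = t" using tT by (auto simp: T_def)
      finally show ?thesis .
    qed
    have neg: "f t (sroot G j) x = - t (sroot G j) x" if tT: "t \<in> T" for t
    proof -
      obtain ws where "t = restrict (word_act G ws) signed_roots" using tT by (auto simp: T_def)
      then show ?thesis
        using sroot_signed_roots[OF jI] signed_roots_uminus simple_refl_sroot[OF jI]
        by (simp add: f_def fun_linear_uminus[OF fun_linear_word_act])
    qed
    have "(\<Sum>t\<in>T. t (sroot G j) x) = (\<Sum>t\<in>T. f t (sroot G j) x)"
      by (rule sum.reindex_bij_witness[of _ f f]) (use fT ff in auto)
    also have "\<dots> = - (\<Sum>t\<in>T. t (sroot G j) x)" using neg by (simp add: sum_negf)
    finally show ?thesis by simp
  qed
  have "z x = 0" for x
  proof -
    have "of_nat (card T) * z x = (\<Sum>t\<in>T. \<Sum>j\<in>J. c j * t (sroot G j) x)" using inv by simp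
    also have "\<dots> = (\<Sum>j\<in>J. c j * (\<Sum>t\<in>T. t (sroot G j) x))"
      by (subst sum.swap) (simp add: sum_distrib_left)
    also have "\<dots> = 0" using zero by simp
    finally show ?thesis using cardT by simp
  qed
  then show ?thesis by auto
qed

lemma root_span_idx_weight_space: "z \<in> root_span G (idx G) \<Longrightarrow> z \<in> weight_space G"
  using weight_space_sum[of "idx G" "sroot G" G] sroot_weight_space by (auto simp: root_span_def)

text \<open>By \<open>root_span_nondegenerate\<close> a combination of simple roots killed by all
  coroots is zero, so the Cartan matrix is invertible and the equations for a dual basis can be
  solved within the span of the simple roots.\<close>

lemma ex_fund_weight:
  assumes "i \<in> idx G"
  shows "\<exists>w\<in>root_span G (idx G). \<forall>j\<in>idx G. w (coroot G j) = (if j = i then 1 else 0)"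
proof -
  have "\<exists>c. \<forall>j\<in>idx G. (\<Sum>k\<in>idx G. c k * sroot G k (coroot G j)) = (if j = i then 1 else 0)"
  proof (rule nondegenerate_solvable[OF finite_idx])
    fix c assume *: "\<And>j. j \<in> idx G \<Longrightarrow> (\<Sum>k\<in>idx G. c k * sroot G k (coroot G j)) = 0"
    have "(\<lambda>x. \<Sum>k\<in>idx G. c k * sroot G k x) = 0"
      using * root_spanI by (intro root_span_nondegenerate[of "idx G"]) auto
    then show "\<forall>i\<in>idx G. c i = 0" using sroot_independent by blast
  qed
  then obtain c where "\<forall>j\<in>idx G. (\<Sum>k\<in>idx G. c k * sroot G k (coroot G j)) = (if j = i then 1 else 0)" ..
  then show ?thesis using root_spanI[of c G "idx G"] by (intro bexI) auto
qed

lemma weight_space_eval_sum: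
  assumes "m \<in> weight_space G" "finite S" "\<And>j. j \<in> S \<Longrightarrow> h j \<in> csa G"
  shows "m (\<Sum>j\<in>S. smult G (c j) (h j)) = (\<Sum>j\<in>S. c j * m (h j))"
  using assms(2,3)
proof (induction S rule: finite_induct)
  case empty
  have "0 \<in> csa G" using csa_subspace subspace_0 by blast
  then have "m 0 = 0" using weight_space_scale[OF assms(1), of 0 0] by simp
  then show ?case by simp
next
  case (insert j S)
  have "(\<Sum>j\<in>S. smult G (c j) (h j)) \<in> csa G" "smult G (c j) (h j) \<in> csa G"
    using insert csa_subspace subspace_sum subspace_scale by (meson insertCI)+
  then show ?case
    using insert weight_space_add[OF assms(1)] weight_space_scale[OF assms(1)] by simp
qed

text \<open>The point is that the simple coroots span \<open>csa G\<close>. For given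
  \<open>h\<close>, the combination of coroots with the values of the fundamental weights at
  \<open>h\<close> as coefficients agrees with \<open>h\<close> under every simple root, and simple
  roots separate the points of the Cartan subalgebra.\<close>

lemma weights_eq_if_coroots:
  assumes "l \<in> weight_space G" "m \<in> weight_space G"
    and "\<And>j. j \<in> idx G \<Longrightarrow> l (coroot G j) = m (coroot G j)"
  shows "l = m"
proof (rule weight_eqI[OF assms(1,2)])
  obtain w where w: "\<And>i. i \<in> idx G \<Longrightarrow> w i \<in> root_span G (idx G)"
    "\<And>i j. i \<in> idx G \<Longrightarrow> j \<in> idx G \<Longrightarrow> w i (coroot G j) = (if j = i then 1 else 0)"
    using ex_fund_weight by metis
  have root_expand: "sroot G i = (\<lambda>x. \<Sum>j\<in>idx G. sroot G i (coroot G j) * w j x)" if i: "i \<in> idx G" for i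
  proof -
    let ?y = "\<lambda>x. \<Sum>j\<in>idx G. sroot G i (coroot G j) * w j x"
    have "?y \<in> root_span G (idx G)"
    proof -
      have "(\<lambda>x. \<Sum>j\<in>S. sroot G i (coroot G j) * w j x) \<in> root_span G (idx G)" if "S \<subseteq> idx G" "finite S" for S
        using that(2,1)
      proof (induction S rule: finite_induct)
        case empty
        then show ?case using root_span_0 by (simp add: zero_fun_def)
      next
        case (insert j S)
        then have "(\<lambda>x. sroot G i (coroot G j) * w j x) + (\<lambda>x. \<Sum>j\<in>S. sroot G i (coroot G j) * w j x) \<in> root_span G (idx G)"
          using w(1) by (intro root_span_add root_span_cmult) auto
        then show ?case using insert by (simp add: plus_fun_def)
      qed
      then show ?thesis using finite_idx by simp
    qed
    then have "sroot G i - ?y \<in> root_span G (idx G)"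
      using root_span_sroot[OF finite_idx i] root_span_diff by blast
    moreover have "(sroot G i - ?y) (coroot G k) = 0" if "k \<in> idx G" for k
    proof -
      have "?y (coroot G k) = (\<Sum>j\<in>idx G. if j = k then sroot G i (coroot G j) else 0)"
        using w(2) that by (intro sum.cong) auto
      then show ?thesis using that finite_idx by simp
    qed
    ultimately have "sroot G i - ?y = 0" by (intro root_span_nondegenerate[of "idx G"]) auto
    then show ?thesis by simp
  qed
  fix h assume h: "h \<in> csa G"
  define k where "k = (\<Sum>j\<in>idx G. smult G (w j h) (coroot G j))"
  have kcsa: "k \<in> csa G" unfolding k_def
    using csa_subspace subspace_sum subspace_scale coroot_csa by meson
  have "sroot G i (h - k) = 0" if i: "i \<in> idx G" for i
  proof -
    have "sroot G i k = (\<Sum>j\<in>idx G. w j h * sroot G i (coroot G j))"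
      unfolding k_def using i
      by (intro weight_space_eval_sum) (auto simp: finite_idx coroot_csa sroot_weight_space)
    also have "\<dots> = sroot G i h" by (subst (2) root_expand[OF i]) (simp add: mult.commute)
    finally have eq: "sroot G i k = sroot G i h" .
    have "sroot G i (h - k) = sroot G i (h + smult G (- 1) k)" by simp
    also have "\<dots> = sroot G i h + - 1 * sroot G i k"
      using weight_space_add[OF sroot_weight_space[OF i] h] kcsa csa_subspace subspace_scale
        weight_space_scale[OF sroot_weight_space[OF i]] by metis
    finally show ?thesis using eq by simp
  qed
  moreover have "h - k \<in> csa G" using csa_subspace subspace_diff h kcsa by blast
  ultimately have hk: "h = k" using sroots_separate[of "h - k"] by simp
  have "m' h = (\<Sum>j\<in>idx G. w j h * m' (coroot G j))" if "m' \<in> weight_space G" for m'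
    by (subst hk, unfold k_def, rule weight_space_eval_sum) (auto simp: that finite_idx coroot_csa)
  from this[OF assms(1)] this[OF assms(2)] show "l h = m h" using assms(3) by simp
qed

lemma fund_weight:
  assumes "i \<in> idx G"
  shows "fund_weight G i \<in> weight_space G"
    and "j \<in> idx G \<Longrightarrow> fund_weight G i (coroot G j) = (if j = i then 1 else 0)"
    and "fund_weight G i \<in> root_span G (idx G)"
proof -
  let ?P = "\<lambda>w. w \<in> weight_space G \<and> (\<forall>j\<in>idx G. w (coroot G j) = (if j = i then 1 else 0))"
  obtain w where w: "w \<in> root_span G (idx G)" "\<forall>j\<in>idx G. w (coroot G j) = (if j = i then 1 else 0)"
    using ex_fund_weight[OF assms] by blast
  have Pw: "?P w" using w root_span_idx_weight_space by blast
  have "v = w" if "?P v" for v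
    by (rule weights_eq_if_coroots) (use that Pw in simp_all)
  then have "fund_weight G i = w" unfolding fund_weight_def using Pw by (intro the_equality) blast+
  then show "fund_weight G i \<in> weight_space G"
    and "j \<in> idx G \<Longrightarrow> fund_weight G i (coroot G j) = (if j = i then 1 else 0)"
    and "fund_weight G i \<in> root_span G (idx G)"
    using w Pw by auto
qed

lemma weight_expansion:
  assumes "m \<in> weight_space G"
  shows "m = (\<lambda>x. \<Sum>i\<in>idx G. m (coroot G i) * fund_weight G i x)"
proof (rule weights_eq_if_coroots[OF assms])
  show "(\<lambda>x. \<Sum>i\<in>idx G. m (coroot G i) * fund_weight G i x) \<in> weight_space G"
    by (intro weight_space_sum fund_weight)
  fix j assume j: "j \<in> idx G"
  have "(\<Sum>i\<in>idx G. m (coroot G i) * fund_weight G i (coroot G j)) = (\<Sum>i\<in>idx G. if i = j then m (coroot G i) else 0)"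
    using j by (intro sum.cong) (auto simp: fund_weight)
  then show "m (coroot G j) = (\<Sum>i\<in>idx G. m (coroot G i) * fund_weight G i (coroot G j))"
    using j finite_idx by simp
qed

text \<open>The fundamental weights were constructed inside the span of the simple roots, and every
  weight is a combination of them. Hence identities that are linear in the weight can be checked on
  simple roots.\<close>

lemma weight_space_root_span: "weight_space G = root_span G (idx G)"
proof
  show "root_span G (idx G) \<subseteq> weight_space G" using root_span_idx_weight_space by blast
  have "(\<lambda>x. \<Sum>i\<in>S. m (coroot G i) * fund_weight G i x) \<in> root_span G (idx G)"
    if "S \<subseteq> idx G" "finite S" for S m
    using that(2,1)
  proof (induction S rule: finite_induct)
    case empty
    then show ?case using root_span_0 by (simp add: zero_fun_def)
  next
    case (insert i S)
    then have "(\<lambda>x. m (coroot G i) * fund_weight G i x) + (\<lambda>x. \<Sum>i\<in>S. m (coroot G i) * fund_weight G i x) \<in> root_span G (idx G)"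
      using fund_weight(3) by (intro root_span_add root_span_cmult) auto
    then show ?case using insert by (simp add: plus_fun_def)
  qed
  then show "weight_space G \<subseteq> root_span G (idx G)"
    using weight_expansion finite_idx by (metis order_refl subsetI)
qed

text \<open>
  The product of two reflections with the same root is unipotent; since it permutes a finite set, it
  is the identity.
\<close>

lemma coroot_transport:
  assumes "fun_linear \<phi>" and R: "\<phi> ` signed_roots \<subseteq> signed_roots" and inj: "inj_on \<phi> (weight_space G)"
    and i: "i \<in> idx G" and k: "k \<in> idx G" and ik: "\<phi> (sroot G i) = sroot G k"
    and x: "x \<in> weight_space G"
  shows "\<phi> x (coroot G k) = x (coroot G i)"
proof -
  have injR: "inj_on \<phi> signed_roots" using inj signed_roots_weight_space by (meson inj_on_subset subsetI)
  have onto: "\<phi> ` signed_roots = signed_roots"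
    using endo_inj_surj[OF finite_signed_roots R injR] .
  have root: "\<phi> b (coroot G k) = b (coroot G i)" if b: "b \<in> signed_roots" for b
  proof -
    \<comment> \<open>The map taking \<open>b\<close> to b + D(b) \<alpha>, where \<alpha> is the
      simple root of \<open>i\<close>, is the reflection in \<open>k\<close> pulled back along
      \<phi> and followed by the reflection in \<open>i\<close>. \<open>D\<close> is constant on the
      line through \<open>b\<close>, so the iterates form an arithmetic progression of
      roots.\<close>
    define D where "D b = \<phi> b (coroot G k) - b (coroot G i)" for b
    have step: "(\<lambda>x. b x + D b * sroot G i x) \<in> signed_roots" if b: "b \<in> signed_roots" for b
    proof -
      define c where "c = \<phi> b (coroot G k)"
      have "simple_refl G k (\<phi> b) \<in> \<phi> ` signed_roots"
        using simple_refl_signed_roots[OF k] R b onto by blast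
      then obtain b' where b': "b' \<in> signed_roots" "\<phi> b' = simple_refl G k (\<phi> b)" by auto
      let ?y = "b - (\<lambda>x. c * sroot G i x)"
      have "\<phi> ?y = \<phi> b'"
        unfolding b'(2) using fun_linear_diff[OF assms(1)] fun_linear_cmult[OF assms(1)] ik
        by (auto simp: simple_refl_def c_def)
      moreover have "?y \<in> weight_space G"
        using signed_roots_weight_space[OF b] sroot_weight_space[OF i]
        by (intro weight_space_minus weight_space_cmult)
      ultimately have "?y = b'" using inj signed_roots_weight_space[OF b'(1)] by (metis inj_onD)
      then have "simple_refl G i ?y \<in> signed_roots" using simple_refl_signed_roots[OF i] b' by simp
      moreover have "simple_refl G i ?y = (\<lambda>x. b x + D b * sroot G i x)"
        by (auto simp: simple_refl_def D_def c_def sroot_coroot[OF i] algebra_simps)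
      ultimately show ?thesis by simp
    qed
    have invariant: "D (\<lambda>x. b x + c * sroot G i x) = D b" for b c
    proof -
      have "\<phi> (\<lambda>x. b x + c * sroot G i x) = \<phi> b + (\<lambda>x. c * sroot G k x)"
        using fun_linear_add[OF assms(1), of b "\<lambda>x. c * sroot G i x"] fun_linear_cmult[OF assms(1)] ik
        by (simp add: plus_fun_def)
      then show ?thesis using sroot_coroot[OF i] sroot_coroot[OF k] by (simp add: D_def)
    qed
    have "(\<lambda>x. b x + of_nat n * D b * sroot G i x) \<in> signed_roots" for n
    proof (induction n)
      case 0
      then show ?case using b by simp
    next
      case (Suc n)
      then show ?case using step[OF Suc.IH] invariant[of b "of_nat n * D b"] by (simp add: algebra_simps)
    qed
    then have "range (\<lambda>n::nat. (\<lambda>x. b x + of_nat n * D b * sroot G i x)) \<subseteq> signed_roots" by blast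
    then have "\<not> inj (\<lambda>n::nat. (\<lambda>x. b x + of_nat n * D b * sroot G i x))"
      using finite_signed_roots finite_subset finite_imageD infinite_UNIV_nat by blast
    then obtain p q :: nat where pq: "p \<noteq> q"
      "(\<lambda>x. b x + of_nat p * D b * sroot G i x) = (\<lambda>x. b x + of_nat q * D b * sroot G i x)"
      unfolding inj_def by blast
    from fun_cong[OF pq(2), of "coroot G i"] pq(1) have "D b = 0" by (simp add: sroot_coroot[OF i])
    then show ?thesis by (simp add: D_def)
  qed
  \<comment> \<open>The simple roots span the weight space, so the identity extends from roots to
    all weights.\<close>
  obtain c where c: "x = (\<lambda>x. \<Sum>j\<in>idx G. c j * sroot G j x)"
    using x weight_space_root_span by (auto simp: root_span_def)
  have "\<phi> x (coroot G k) = (\<Sum>j\<in>idx G. c j * \<phi> (sroot G j) (coroot G k))"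
    unfolding c by (subst fun_linear_sum[OF assms(1)]) simp
  also have "\<dots> = x (coroot G i)" unfolding c using root sroot_signed_roots by simp
  finally show ?thesis .
qed

end

section \<open>Longest elements\<close>

lemma weyl_elt_apply: "m \<in> weight_space G \<Longrightarrow> weyl_elt G ws m = word_act G ws m"
  by (simp add: weyl_elt_def)

lemma weyl_elt_eq_iff:
  "weyl_elt G ws = weyl_elt G us \<longleftrightarrow> (\<forall>m\<in>weight_space G. word_act G ws m = word_act G us m)"
proof
  assume eq: "weyl_elt G ws = weyl_elt G us"
  show "\<forall>m\<in>weight_space G. word_act G ws m = word_act G us m"
  proof
    fix m assume m: "m \<in> weight_space G"
    show "word_act G ws m = word_act G us m"
      using weyl_elt_apply[OF m, of ws] weyl_elt_apply[OF m, of us] fun_cong[OF eq, of m] by simp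
  qed
next
  assume "\<forall>m\<in>weight_space G. word_act G ws m = word_act G us m"
  then show "weyl_elt G ws = weyl_elt G us" unfolding weyl_elt_def by (intro restrict_ext) blast
qed

lemma weyl_elt_in_subgroup: "set ws \<subseteq> J \<Longrightarrow> weyl_elt G ws \<in> weyl_subgroup G J"
  by (auto simp: weyl_subgroup_def)

lemma weyl_length_word:
  assumes "set ws \<subseteq> J"
  obtains us where "set us \<subseteq> J" "length us = weyl_length G J (weyl_elt G ws)" "weyl_elt G us = weyl_elt G ws"
proof -
  have "\<exists>us. set us \<subseteq> J \<and> length us = weyl_length G J (weyl_elt G ws) \<and> weyl_elt G ws = weyl_elt G us"
    unfolding weyl_length_def by (rule LeastI_ex) (use assms in blast)
  then show thesis using that by metis
qed

lemma weyl_length_le: "set us \<subseteq> J \<Longrightarrow> weyl_length G J (weyl_elt G us) \<le> length us"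
  unfolding weyl_length_def by (rule Least_le) blast

context semisimple
begin

section \<open>Coefficients in the simple roots and the signs of roots\<close>

definition coef :: "('g \<Rightarrow> complex) \<Rightarrow> nat \<Rightarrow> complex" where
  "coef b = (SOME c. b = (\<lambda>x. \<Sum>i\<in>idx G. c i * sroot G i x))"

lemma coef_expand:
  assumes "b \<in> weight_space G"
  shows "b = (\<lambda>x. \<Sum>i\<in>idx G. coef b i * sroot G i x)"
proof -
  have "\<exists>c. b = (\<lambda>x. \<Sum>i\<in>idx G. c i * sroot G i x)"
    using assms weight_space_root_span by (auto simp: root_span_def)
  then show ?thesis unfolding coef_def by (rule someI_ex)
qed

lemma coef_eq:
  assumes "b = (\<lambda>x. \<Sum>i\<in>idx G. c i * sroot G i x)" "i \<in> idx G"
  shows "coef b i = c i"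
proof -
  have "b \<in> weight_space G"
    unfolding assms(1) weight_space_root_span by (rule root_spanI)
  from trans[OF coef_expand[OF this, symmetric] assms(1)] show ?thesis
    using assms(2) by (rule sroot_coeff_unique)
qed

lemma coef_add:
  assumes "l \<in> weight_space G" "m \<in> weight_space G" "i \<in> idx G"
  shows "coef (l + m) i = coef l i + coef m i"
proof (rule coef_eq[OF _ assms(3)], rule ext)
  fix x show "(l + m) x = (\<Sum>i\<in>idx G. (coef l i + coef m i) * sroot G i x)"
    using fun_cong[OF coef_expand[OF assms(1)], of x] fun_cong[OF coef_expand[OF assms(2)], of x]
    by (simp add: distrib_right sum.distrib)
qed

lemma coef_cmult:
  assumes "l \<in> weight_space G" "i \<in> idx G"
  shows "coef (\<lambda>x. c * l x) i = c * coef l i"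
proof (rule coef_eq[OF _ assms(2)], rule ext)
  fix x show "c * l x = (\<Sum>i\<in>idx G. (c * coef l i) * sroot G i x)"
    using fun_cong[OF coef_expand[OF assms(1)], of x] by (simp add: sum_distrib_left mult.assoc)
qed

lemma coef_uminus: "l \<in> weight_space G \<Longrightarrow> i \<in> idx G \<Longrightarrow> coef (- l) i = - coef l i"
  using coef_cmult[of l i "- 1"] by (simp add: fun_Compl_def)

lemma coef_root_span:
  assumes "J \<subseteq> idx G" "z = (\<lambda>x. \<Sum>j\<in>J. c j * sroot G j x)" "i \<in> idx G"
  shows "coef z i = (if i \<in> J then c i else 0)"
proof (rule coef_eq[OF _ assms(3)], rule ext)
  fix x
  have "(\<Sum>i\<in>idx G. (if i \<in> J then c i else 0) * sroot G i x) = (\<Sum>i\<in>J. (if i \<in> J then c i else 0) * sroot G i x)"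
    using assms finite_idx by (intro sum.mono_neutral_right) auto
  then show "z x = (\<Sum>i\<in>idx G. (if i \<in> J then c i else 0) * sroot G i x)"
    unfolding assms(2) by simp
qed

lemma coef_sroot:
  assumes "j \<in> idx G" "i \<in> idx G" shows "coef (sroot G j) i = (if i = j then 1 else 0)"
  using coef_root_span[of "{j}" "sroot G j" "\<lambda>_. 1" i] assms by simp

lemma root_spanD_coef:
  assumes "J \<subseteq> idx G" "z \<in> root_span G J"
  shows "z = (\<lambda>x. \<Sum>j\<in>J. coef z j * sroot G j x)" and "i \<in> idx G \<Longrightarrow> i \<notin> J \<Longrightarrow> coef z i = 0"
proof -
  obtain c where c: "z = (\<lambda>x. \<Sum>j\<in>J. c j * sroot G j x)" using assms by (auto simp: root_span_def)
  show "z = (\<lambda>x. \<Sum>j\<in>J. coef z j * sroot G j x)"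
    using assms(1) coef_root_span[OF assms(1) c] by (subst c) (auto intro!: sum.cong ext)
  show "i \<in> idx G \<Longrightarrow> i \<notin> J \<Longrightarrow> coef z i = 0" using coef_root_span[OF assms(1) c] by simp
qed

lemma root_span_mono:
  assumes "J \<subseteq> K" "finite K" "z \<in> root_span G J"
  shows "z \<in> root_span G K"
proof -
  obtain c where c: "z = (\<lambda>x. \<Sum>j\<in>J. c j * sroot G j x)" using assms by (auto simp: root_span_def)
  have "z = (\<lambda>x. \<Sum>j\<in>K. (if j \<in> J then c j else 0) * sroot G j x)"
  proof (rule ext)
    fix x
    have "(\<Sum>j\<in>K. (if j \<in> J then c j else 0) * sroot G j x) = (\<Sum>j\<in>J. (if j \<in> J then c j else 0) * sroot G j x)"
      using assms by (intro sum.mono_neutral_right) auto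
    then show "z x = (\<Sum>j\<in>K. (if j \<in> J then c j else 0) * sroot G j x)" unfolding c by simp
  qed
  then show ?thesis using root_spanI by metis
qed

lemma root_span_weight_space: "J \<subseteq> idx G \<Longrightarrow> z \<in> root_span G J \<Longrightarrow> z \<in> weight_space G"
  using root_span_mono[of J "idx G"] finite_idx weight_space_root_span by blast

lemma pos_iff: "pos b \<longleftrightarrow> b \<in> weight_space G \<and> (\<forall>i\<in>idx G. coef b i \<in> \<nat>)"
proof
  assume "pos b"
  then obtain c :: "nat \<Rightarrow> nat" where c: "b = (\<lambda>x. \<Sum>i\<in>idx G. of_nat (c i) * sroot G i x)"
    by (auto simp: nat_span_def)
  then show "b \<in> weight_space G \<and> (\<forall>i\<in>idx G. coef b i \<in> \<nat>)"
    using coef_eq[OF c] root_spanI[of "\<lambda>i. of_nat (c i)" G "idx G"] weight_space_root_span by auto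
next
  assume *: "b \<in> weight_space G \<and> (\<forall>i\<in>idx G. coef b i \<in> \<nat>)"
  then have "\<forall>i\<in>idx G. \<exists>n. coef b i = of_nat n" by (auto simp: Nats_def)
  then obtain c :: "nat \<Rightarrow> nat" where "\<forall>i\<in>idx G. coef b i = of_nat (c i)" by metis
  then have "b = (\<lambda>x. \<Sum>i\<in>idx G. of_nat (c i) * sroot G i x)"
    using coef_expand[of b] * by (auto intro!: sum.cong ext)
  then show "pos b" unfolding nat_span_def by blast
qed

lemma Nats_uminus_zero: "(a::complex) \<in> \<nat> \<Longrightarrow> - a \<in> \<nat> \<Longrightarrow> a = 0"
proof -
  assume "a \<in> \<nat>" "- a \<in> \<nat>"
  then obtain n m where nm: "a = of_nat n" "- a = of_nat m" by (auto simp: Nats_def)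
  then have "of_nat (n + m) = (0::complex)" by (metis add.right_inverse of_nat_add)
  then have "n + m = 0" by (simp only: of_nat_eq_0_iff)
  then show "a = 0" using nm by simp
qed

lemma pos_uminus_pos: "pos b \<Longrightarrow> pos (- b) \<Longrightarrow> b = 0"
proof -
  assume *: "pos b" "pos (- b)"
  then have b: "b \<in> weight_space G" by (simp add: pos_iff)
  have "coef b i = 0" if "i \<in> idx G" for i
    using * b that Nats_uminus_zero[of "coef b i"] by (auto simp: pos_iff coef_uminus)
  then show "b = 0" using coef_expand[OF b] by (simp add: zero_fun_def)
qed

lemma signed_roots_neg_iff: "b \<in> signed_roots \<Longrightarrow> pos (- b) \<longleftrightarrow> \<not> pos b"
  using signed_roots_pos_or_neg pos_uminus_pos signed_roots_nonzero by blast

lemma pos_sroot: "i \<in> idx G \<Longrightarrow> pos (sroot G i)"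
  by (auto simp: pos_iff sroot_weight_space coef_sroot)

lemma coef_signed_root_Ints: "b \<in> signed_roots \<Longrightarrow> i \<in> idx G \<Longrightarrow> coef b i \<in> \<int>"
proof -
  assume b: "b \<in> signed_roots" and i: "i \<in> idx G"
  have "coef b i \<in> \<nat> \<or> - coef b i \<in> \<nat>"
    using signed_roots_pos_or_neg[OF b] coef_uminus[OF signed_roots_weight_space[OF b] i] i
    by (auto simp: pos_iff)
  then have "coef b i \<in> \<int> \<or> - coef b i \<in> \<int>" using Nats_subset_Ints by blast
  then show "coef b i \<in> \<int>" by simp
qed

text \<open>A word moves a weight by a combination of the simple roots among its letters.
  Coefficients outside \<open>J\<close> can therefore be read before or after applying the longest
  element of \<open>J\<close>.\<close>

lemma coef_word_act:
  assumes ws: "set ws \<subseteq> idx G" and m: "m \<in> weight_space G" and i: "i \<in> idx G" "i \<notin> set ws"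
  shows "coef (word_act G ws m) i = coef m i"
proof -
  have z: "word_act G ws m - m \<in> root_span G (set ws)" by (rule word_act_root_span) auto
  have "coef (word_act G ws m) i = coef ((word_act G ws m - m) + m) i" by (simp add: fun_eq_iff)
  also have "\<dots> = coef (word_act G ws m - m) i + coef m i"
    using root_span_weight_space[OF ws z] m i by (intro coef_add)
  also have "coef (word_act G ws m - m) i = 0" using root_spanD_coef(2)[OF ws z] i by blast
  finally show ?thesis by simp
qed

text \<open>The reflection changes the coefficient at \<open>i\<close> alone, so any other nonzero
  coefficient would keep the root positive. The multiple stays open here, as reducedness of
  \<open>signed_roots\<close> has not been established.\<close>

lemma simple_refl_pos:
  assumes i: "i \<in> idx G" and b: "b \<in> signed_roots" "pos b" and neg: "pos (- simple_refl G i b)"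
  shows "\<exists>c::nat. b = (\<lambda>x. of_nat c * sroot G i x)"
proof -
  have bw: "b \<in> weight_space G" using b signed_roots_weight_space by blast
  have sw: "simple_refl G i b \<in> weight_space G"
    using simple_refl_weight_space[OF bw sroot_weight_space[OF i]] .
  have zero: "coef b k = 0" if "k \<in> idx G" "k \<noteq> i" for k
  proof -
    have "coef (simple_refl G i b) k = coef b k"
      using coef_word_act[of "[i]" b k] i bw that by simp
    then have "- coef b k \<in> \<nat>" using neg that coef_uminus[OF sw] by (auto simp: pos_iff)
    then show ?thesis using b that Nats_uminus_zero by (auto simp: pos_iff)
  qed
  obtain c where c: "coef b i = of_nat c" using b i by (auto simp: pos_iff Nats_def)
  have "b x = of_nat c * sroot G i x" for x
  proof -
    have "b x = (\<Sum>k\<in>idx G. coef b k * sroot G k x)" using fun_cong[OF coef_expand[OF bw]] .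
    also have "\<dots> = (\<Sum>k\<in>idx G. if k = i then coef b k * sroot G k x else 0)"
      using zero by (intro sum.cong) auto
    finally show ?thesis using i finite_idx c by simp
  qed
  then show ?thesis by blast
qed

lemma inj_on_word_act: "set ws \<subseteq> idx G \<Longrightarrow> inj_on (word_act G ws) A"
  using word_act_rev by (metis inj_on_inverseI)

lemma word_act_coroot:
  assumes "set ws \<subseteq> idx G" "i \<in> idx G" "k \<in> idx G" "word_act G ws (sroot G i) = sroot G k" "x \<in> weight_space G"
  shows "word_act G ws x (coroot G k) = x (coroot G i)"
  using assms word_act_signed_roots inj_on_word_act
  by (intro coroot_transport) (auto simp: fun_linear_word_act)

text \<open>The image of the simple root of \<open>k\<close> starts positive and ends negative as
  the letters act from right to left. At the letter \<open>i\<close> where the sign turns, the image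
  is the simple root of \<open>i\<close>. Hence the part w of the word to the right of that letter
  satisfies s_i w = w s_k, and appending \<open>k\<close> amounts to deleting that letter.\<close>

lemma exchange:
  assumes "set ws \<subseteq> idx G" "k \<in> idx G" "pos (- word_act G ws (sroot G k))"
  shows "\<exists>us p vs. ws = us @ p # vs \<and>
    (\<forall>m\<in>weight_space G. word_act G (us @ vs) m = word_act G (ws @ [k]) m)"
  using assms
proof (induction ws)
  case Nil
  then have "pos (- sroot G k)" by (simp only: foldr.simps id_apply)
  then show ?case
    using Nil pos_sroot[of k] pos_uminus_pos sroot_signed_roots signed_roots_nonzero by blast
next
  case (Cons i ws)
  let ?b = "word_act G ws (sroot G k)"
  have i: "i \<in> idx G" and ws: "set ws \<subseteq> idx G" and k: "k \<in> idx G" using Cons.prems by auto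
  have b: "?b \<in> signed_roots" using word_act_signed_roots ws sroot_signed_roots k by blast
  show ?case
  proof (cases "pos ?b")
    case False
    then have "pos (- ?b)" using signed_roots_neg_iff b by blast
    then obtain us p vs where "ws = us @ p # vs"
      "\<forall>m\<in>weight_space G. word_act G (us @ vs) m = word_act G (ws @ [k]) m"
      using Cons.IH ws k by blast
    then have "i # ws = (i # us) @ p # vs"
      "\<forall>m\<in>weight_space G. word_act G ((i # us) @ vs) m = word_act G ((i # ws) @ [k]) m" by auto
    then show ?thesis by blast
  next
    case True
    have "pos (- simple_refl G i ?b)" using Cons.prems(3) by (simp only: foldr.simps comp_apply)
    then obtain c :: nat where c: "?b = (\<lambda>x. of_nat c * sroot G i x)"
      using simple_refl_pos[OF i b True] by blast
    \<comment> \<open>The simple root of \<open>k\<close> is \<open>c\<close> times the root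
      \<open>?a\<close>. Its coefficient at \<open>k\<close> is 1 and that of \<open>?a\<close> is
      an integer, so \<open>c\<close> is 1.\<close>
    let ?a = "word_act G (rev ws) (sroot G i)"
    have a: "?a \<in> signed_roots" using word_act_signed_roots[of "rev ws"] ws sroot_signed_roots i by simp
    have "sroot G k = word_act G (rev ws) ?b" using word_act_rev[OF ws] by simp
    also have "\<dots> = (\<lambda>x. of_nat c * ?a x)"
      unfolding c by (rule fun_linear_cmult[OF fun_linear_word_act])
    finally have "coef (sroot G k) k = of_nat c * coef ?a k"
      using coef_cmult[OF signed_roots_weight_space[OF a] k] by metis
    moreover obtain n where "coef ?a k = of_int n"
      using coef_signed_root_Ints[OF a k] by (auto simp: Ints_def)
    ultimately have "of_int (int c * n) = (1::complex)" using k by (simp add: coef_sroot)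
    then have "int c * n = 1" by (simp only: of_int_eq_1_iff)
    then have "c = 1" by (simp add: zmult_eq_1_iff)
    then have bi: "?b = sroot G i" using c by simp
    have "word_act G ws m = word_act G ((i # ws) @ [k]) m" if m: "m \<in> weight_space G" for m
    proof -
      \<comment> \<open>This is s_i w = w s_k applied to \<open>m\<close>. That \<open>ws\<close>
        also carries the coroot of \<open>k\<close> to that of \<open>i\<close> is
        \<open>coroot_transport\<close>.\<close>
      have "simple_refl G i (word_act G ws m) = word_act G ws m - (\<lambda>x. m (coroot G k) * sroot G i x)"
        using word_act_coroot[OF ws k i bi m] by (auto simp: simple_refl_def)
      also have "\<dots> = word_act G ws (m - (\<lambda>x. m (coroot G k) * sroot G k x))"
        unfolding fun_linear_diff[OF fun_linear_word_act] fun_linear_cmult[OF fun_linear_word_act] bi ..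
      also have "m - (\<lambda>x. m (coroot G k) * sroot G k x) = simple_refl G k m"
        by (auto simp: simple_refl_def)
      finally show ?thesis
        using simple_refl_simple_refl[OF i, of "word_act G ws m"] by simp
    qed
    then show ?thesis by (intro exI[of _ "[]"] exI[of _ i] exI[of _ ws]) simp
  qed
qed

text \<open>A shortest word for the element cannot have a last letter \<open>k\<close>: its
  remainder would make the simple root of \<open>k\<close> negative, and exchange would produce a
  word shorter by two letters. So the shortest word is empty.\<close>

lemma word_act_identity_if_pos:
  assumes J: "J \<subseteq> idx G" and ws: "set ws \<subseteq> J"
    and pos: "\<And>j. j \<in> J \<Longrightarrow> pos (word_act G ws (sroot G j))" and m: "m \<in> weight_space G"
  shows "word_act G ws m = m"
proof -
  obtain us where us: "set us \<subseteq> J" "length us = weyl_length G J (weyl_elt G ws)" "weyl_elt G us = weyl_elt G ws"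
    using weyl_length_word[OF ws] .
  have eq: "word_act G us m = word_act G ws m" if "m \<in> weight_space G" for m
    using us(3) that weyl_elt_eq_iff by blast
  show ?thesis
  proof (cases us rule: rev_cases)
    case Nil
    then show ?thesis using eq[OF m] by simp
  next
    case (snoc vs k)
    have k: "k \<in> J" "k \<in> idx G" and vs: "set vs \<subseteq> J" "set vs \<subseteq> idx G" using snoc us J by auto
    have "word_act G us (sroot G k) = - word_act G vs (sroot G k)"
      using simple_refl_sroot[OF k(2)] fun_linear_uminus[OF fun_linear_word_act] by (simp add: snoc)
    then have "pos (- word_act G vs (sroot G k))"
      using eq[OF sroot_weight_space[OF k(2)]] pos[OF k(1)] by simp
    then obtain xs p ys where x: "vs = xs @ p # ys"
      "\<forall>m\<in>weight_space G. word_act G (xs @ ys) m = word_act G (vs @ [k]) m"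
      using exchange[OF vs(2) k(2)] by blast
    then have "weyl_elt G (xs @ ys) = weyl_elt G ws" using us(3) snoc weyl_elt_eq_iff by metis
    moreover have "set (xs @ ys) \<subseteq> J" using vs x by auto
    ultimately have "weyl_length G J (weyl_elt G ws) \<le> length (xs @ ys)" using weyl_length_le by metis
    then show ?thesis using us(2) snoc x(1) by simp
  qed
qed

text \<open>A characterization of words for the longest element by signs instead of length. It is
  stable under reversal, under concatenation of orthogonal components and under diagram
  automorphisms, all of which are used.\<close>

definition inverts :: "nat set \<Rightarrow> nat list \<Rightarrow> bool" where
  "inverts J ws \<longleftrightarrow> set ws \<subseteq> J \<and> (\<forall>j\<in>J. pos (- word_act G ws (sroot G j)))"

lemma pos_sum:
  assumes "finite S" "\<And>j. j \<in> S \<Longrightarrow> pos (f j)" "\<And>j. j \<in> S \<Longrightarrow> c j \<in> \<nat>"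
  shows "pos (\<lambda>x. \<Sum>j\<in>S. c j * f j x)"
  using assms
proof (induction S rule: finite_induct)
  case empty
  have "coef 0 i = 0" if "i \<in> idx G" for i
    using coef_cmult[OF zero_in_weight_space that, of 0] by (simp add: zero_fun_def)
  then show ?case using zero_in_weight_space by (auto simp: pos_iff zero_fun_def)
next
  case (insert j S)
  let ?l = "\<lambda>x. c j * f j x" and ?m = "\<lambda>x. \<Sum>j\<in>S. c j * f j x"
  have m: "pos ?m" using insert by blast
  have l: "?l \<in> weight_space G" using insert.prems(1)[of j] by (simp add: pos_iff weight_space_cmult)
  have "coef (?l + ?m) i \<in> \<nat>" if i: "i \<in> idx G" for i
  proof -
    have "coef (?l + ?m) i = c j * coef (f j) i + coef ?m i"
      using coef_add[OF l _ i] coef_cmult[OF _ i] m insert.prems(1)[of j] by (simp add: pos_iff)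
    then show ?thesis
      using m insert.prems(1)[of j] insert.prems(2)[of j] i by (auto simp: pos_iff)
  qed
  then have "pos (?l + ?m)" using l m by (simp add: pos_iff weight_space_plus)
  then show ?case using insert by (simp add: plus_fun_def)
qed

text \<open>Expanding a positive root of \<open>J\<close> in simple roots shows that its image is
  negative. Equality is a count: negation matches the two finite sets and the action is
  injective.\<close>

lemma inverts_pos_roots:
  assumes J: "J \<subseteq> idx G" and ws: "inverts J ws"
  shows "word_act G ws ` {b \<in> signed_roots. b \<in> root_span G J \<and> pos b} =
    {b \<in> signed_roots. b \<in> root_span G J \<and> pos (- b)}" (is "_ ` ?P = ?N")
proof -
  have fin: "finite J" and wsI: "set ws \<subseteq> idx G" and wsJ: "set ws \<subseteq> J"
    using J finite_idx finite_subset ws by (auto simp: inverts_def)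
  have sub: "word_act G ws b \<in> ?N" if "b \<in> ?P" for b
  proof -
    have b: "b \<in> signed_roots" "b \<in> root_span G J" "pos b" using that by auto
    have "word_act G ws b - b \<in> root_span G J" using word_act_root_span[OF fin wsJ] .
    then have "(word_act G ws b - b) + b \<in> root_span G J" using b root_span_add by blast
    then have 1: "word_act G ws b \<in> root_span G J" by (simp add: fun_eq_iff)
    have "- word_act G ws b = (\<lambda>x. \<Sum>j\<in>J. coef b j * (- word_act G ws (sroot G j)) x)"
    proof -
      have "word_act G ws b = (\<lambda>x. \<Sum>j\<in>J. coef b j * word_act G ws (sroot G j) x)"
        by (subst root_spanD_coef(1)[OF J b(2)]) (rule fun_linear_sum[OF fun_linear_word_act])
      then show ?thesis by (simp add: fun_eq_iff sum_negf)
    qed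
    moreover have "pos (\<lambda>x. \<Sum>j\<in>J. coef b j * (- word_act G ws (sroot G j)) x)"
    proof (rule pos_sum[OF fin])
      show "pos (- word_act G ws (sroot G j))" if "j \<in> J" for j
        using ws that by (simp only: inverts_def)
      show "coef b j \<in> \<nat>" if "j \<in> J" for j using b(3) that J by (auto simp: pos_iff)
    qed
    ultimately have "pos (- word_act G ws b)" by simp
    then show ?thesis using 1 word_act_signed_roots[OF wsI b(1)] by simp
  qed
  have finP: "finite ?P" "finite ?N" using finite_signed_roots by auto
  have "?N = uminus ` ?P"
  proof
    show "?N \<subseteq> uminus ` ?P"
    proof
      fix b assume "b \<in> ?N"
      then have "- b \<in> ?P" using signed_roots_uminus root_span_uminus by auto
      then have "- (- b) \<in> uminus ` ?P" by blast
      then show "b \<in> uminus ` ?P" by simp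
    qed
  qed (use signed_roots_uminus root_span_uminus in auto)
  then have "card ?N \<le> card ?P" using card_image_le[OF finP(1)] by metis
  then have "card ?N \<le> card (word_act G ws ` ?P)" using card_image[OF inj_on_word_act[OF wsI]] by metis
  then show ?thesis using card_seteq[OF finP(2), of "word_act G ws ` ?P"] sub by blast
qed

text \<open>The reversed word acts as the inverse. Since the images of the positive roots of
  \<open>J\<close> exhaust the negative ones, every negated simple root has a positive
  preimage.\<close>

lemma inverts_rev:
  assumes J: "J \<subseteq> idx G" and ws: "inverts J ws"
  shows "inverts J (rev ws)"
proof -
  have wsI: "set ws \<subseteq> idx G" and fin: "finite J"
    using J finite_idx finite_subset ws by (auto simp: inverts_def)
  have "pos (- word_act G (rev ws) (sroot G j))" if j: "j \<in> J" for j
  proof -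
    have "- sroot G j \<in> {b \<in> signed_roots. b \<in> root_span G J \<and> pos (- b)}"
      using j J pos_sroot sroot_signed_roots signed_roots_uminus
        root_span_uminus[OF root_span_sroot[OF fin j]] by auto
    then have "- sroot G j \<in> word_act G ws ` {b \<in> signed_roots. b \<in> root_span G J \<and> pos b}"
      unfolding inverts_pos_roots[OF assms] .
    then obtain b where b: "pos b" "word_act G ws b = - sroot G j" by force
    have "- word_act G (rev ws) (sroot G j) = word_act G (rev ws) (- sroot G j)"
      using fun_linear_uminus[OF fun_linear_word_act] by metis
    also have "\<dots> = b" using word_act_rev[OF wsI, of b] b by simp
    finally show ?thesis using b by simp
  qed
  then show ?thesis using ws by (simp add: inverts_def)
qed

text \<open>The inverse of one element composed with the other keeps the simple roots of
  \<open>J\<close> positive, hence is the identity.\<close>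

lemma inverts_unique:
  assumes J: "J \<subseteq> idx G" and ws: "inverts J ws" and us: "inverts J us" and m: "m \<in> weight_space G"
  shows "word_act G ws m = word_act G us m"
proof -
  have wsI: "set ws \<subseteq> idx G" "set ws \<subseteq> J" "set us \<subseteq> J" and fin: "finite J"
    using J finite_idx finite_subset ws us by (auto simp: inverts_def)
  have "pos (word_act G (rev ws @ us) (sroot G j))" if j: "j \<in> J" for j
  proof -
    let ?P = "{b \<in> signed_roots. b \<in> root_span G J \<and> pos b}"
    let ?N = "{b \<in> signed_roots. b \<in> root_span G J \<and> pos (- b)}"
    have "sroot G j \<in> ?P" using j J pos_sroot sroot_signed_roots root_span_sroot[OF fin j] by auto
    then have "word_act G us (sroot G j) \<in> ?N" using inverts_pos_roots[OF J us] by blast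
    then have "word_act G us (sroot G j) \<in> word_act G ws ` ?P" unfolding inverts_pos_roots[OF J ws] .
    then obtain b where b: "b \<in> ?P" "word_act G us (sroot G j) = word_act G ws b" by blast
    then have "word_act G (rev ws @ us) (sroot G j) = b" using word_act_rev[OF wsI(1)] by simp
    then show ?thesis using b by simp
  qed
  then have "word_act G (rev ws @ us) m = m"
    using word_act_identity_if_pos[OF J, of "rev ws @ us" m] wsI m by simp
  then have "word_act G ws (word_act G (rev ws) (word_act G us m)) = word_act G ws m" by simp
  then show ?thesis using word_act_rev'[OF wsI(1)] by simp
qed

text \<open>An element is determined by its values on the simple roots, which lie in the finite
  stable set \<open>signed_roots\<close>; \<open>F\<close> rebuilds it from its restriction to that
  set.\<close>

lemma finite_weyl_subgroup:
  assumes J: "J \<subseteq> idx G"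
  shows "finite (weyl_subgroup G J)"
proof -
  define F where "F t = restrict (\<lambda>m x. \<Sum>i\<in>idx G. coef m i * t (sroot G i) x) (weight_space G)"
    for t :: "('g \<Rightarrow> complex) \<Rightarrow> 'g \<Rightarrow> complex"
  have "weyl_elt G ws = F (restrict (word_act G ws) signed_roots)" for ws
  proof -
    have "word_act G ws m = (\<lambda>x. \<Sum>i\<in>idx G. coef m i * restrict (word_act G ws) signed_roots (sroot G i) x)"
      if "m \<in> weight_space G" for m
    proof -
      have "word_act G ws m = (\<lambda>x. \<Sum>i\<in>idx G. coef m i * word_act G ws (sroot G i) x)"
        by (subst coef_expand[OF that]) (rule fun_linear_sum[OF fun_linear_word_act])
      also have "\<dots> = (\<lambda>x. \<Sum>i\<in>idx G. coef m i * restrict (word_act G ws) signed_roots (sroot G i) x)"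
        using sroot_signed_roots by (intro ext sum.cong) auto
      finally show ?thesis .
    qed
    then show ?thesis unfolding weyl_elt_def F_def by (rule restrict_ext)
  qed
  then have "weyl_subgroup G J \<subseteq> F ` (signed_roots \<rightarrow>\<^sub>E signed_roots)"
    using word_act_signed_roots J by (fastforce simp: weyl_subgroup_def)
  then show ?thesis
    by (rule finite_subset) (intro finite_imageI finite_PiE finite_signed_roots)
qed

text \<open>If the element kept the simple root of some \<open>j\<close> positive, multiplying by
  the reflection in \<open>j\<close> on the right would lengthen it.\<close>

lemma maximal_length_inverts:
  assumes J: "J \<subseteq> idx G" and ws: "set ws \<subseteq> J"
    and max: "\<And>v. v \<in> weyl_subgroup G J \<Longrightarrow> weyl_length G J v \<le> weyl_length G J (weyl_elt G ws)"
  shows "inverts J ws"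
proof -
  have "pos (- word_act G ws (sroot G j))" if j: "j \<in> J" for j
  proof (rule ccontr)
    assume "\<not> pos (- word_act G ws (sroot G j))"
    moreover have "word_act G ws (sroot G j) \<in> signed_roots"
      using word_act_signed_roots sroot_signed_roots J j ws by blast
    ultimately have p: "pos (word_act G ws (sroot G j))" using signed_roots_pos_or_neg by blast
    have jI: "j \<in> idx G" using j J by blast
    have "set (ws @ [j]) \<subseteq> J" using ws j by simp
    then obtain vs where vs: "set vs \<subseteq> J" "length vs = weyl_length G J (weyl_elt G (ws @ [j]))"
      "weyl_elt G vs = weyl_elt G (ws @ [j])" using weyl_length_word by blast
    have eq: "word_act G vs m = word_act G ws (simple_refl G j m)" if "m \<in> weight_space G" for m
      using vs(3) that weyl_elt_eq_iff by (metis foldr.simps(1,2) foldr_append comp_apply id_apply)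
    have "word_act G vs (sroot G j) = word_act G ws (- sroot G j)"
      using eq[OF sroot_weight_space[OF jI]] simple_refl_sroot[OF jI] by metis
    also have "\<dots> = - word_act G ws (sroot G j)" by (rule fun_linear_uminus[OF fun_linear_word_act])
    finally have "pos (- word_act G vs (sroot G j))" using p by (simp only: minus_minus)
    \<comment> \<open>A shortest word for the product with the reflection makes the simple root of
      \<open>j\<close> negative. Exchange then writes the original element with one letter less, so
      the product is strictly longer.\<close>
    then obtain xs q ys where x: "vs = xs @ q # ys"
      "\<forall>m\<in>weight_space G. word_act G (xs @ ys) m = word_act G (vs @ [j]) m"
      using exchange[of vs j] vs J jI by blast
    have "word_act G (xs @ ys) m = word_act G ws m" if "m \<in> weight_space G" for m
      using x(2) that eq[of "simple_refl G j m"] simple_refl_weight_space[OF that sroot_weight_space[OF jI]]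
        simple_refl_simple_refl[OF jI] by simp
    then have "weyl_elt G ws = weyl_elt G (xs @ ys)" using weyl_elt_eq_iff by metis
    moreover have "set (xs @ ys) \<subseteq> J" using vs x by auto
    ultimately have "weyl_length G J (weyl_elt G ws) \<le> length (xs @ ys)" using weyl_length_le by metis
    moreover have "length vs \<le> weyl_length G J (weyl_elt G ws)"
      using max[OF weyl_elt_in_subgroup[OF \<open>set (ws @ [j]) \<subseteq> J\<close>]] vs(2) by simp
    ultimately show False using x(1) by simp
  qed
  then show ?thesis using ws by (simp add: inverts_def)
qed

text \<open>Finiteness provides an element of maximal length, and uniqueness of inverting elements
  makes the description by \<open>THE\<close> meaningful. Maximality is returned as well, for the
  comparison with the Weyl group of a component.\<close>

lemma longest_elt_inverts:
  assumes J: "J \<subseteq> idx G"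
  obtains ws where "inverts J ws" "longest_elt G J = weyl_elt G ws"
    "\<And>v. v \<in> weyl_subgroup G J \<Longrightarrow> weyl_length G J v \<le> weyl_length G J (weyl_elt G ws)"
proof -
  let ?W = "weyl_subgroup G J"
  let ?Q = "\<lambda>w. w \<in> ?W \<and> (\<forall>v\<in>?W. weyl_length G J v \<le> weyl_length G J w)"
  have "weyl_elt G [] \<in> ?W" by (rule weyl_elt_in_subgroup) simp
  then have "Max (weyl_length G J ` ?W) \<in> weyl_length G J ` ?W"
    using finite_weyl_subgroup[OF J] by (intro Max_in) auto
  then obtain w where "w \<in> ?W" "weyl_length G J w = Max (weyl_length G J ` ?W)" by auto
  then have w: "?Q w" using finite_weyl_subgroup[OF J] by simp
  have inv: "\<exists>ws. inverts J ws \<and> v = weyl_elt G ws" if "?Q v" for v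
  proof -
    obtain ws where "set ws \<subseteq> J" "v = weyl_elt G ws" using \<open>?Q v\<close> by (auto simp: weyl_subgroup_def)
    then show ?thesis using maximal_length_inverts[OF J] \<open>?Q v\<close> by blast
  qed
  have "v = w" if "?Q v" for v
    using inv[OF that] inv[OF w] inverts_unique[OF J] weyl_elt_eq_iff by metis
  then have "longest_elt G J = w" unfolding longest_elt_def using w by (intro the_equality) blast+
  then show thesis using inv[OF w] that w by metis
qed

lemma longest_eltI:
  assumes "J \<subseteq> idx G" "inverts J ws"
  shows "longest_elt G J = weyl_elt G ws"
  using longest_elt_inverts[OF assms(1)] assms inverts_unique weyl_elt_eq_iff by metis

text \<open>On the simple roots of \<open>J\<close> the map has a matrix of natural numbers whose
  square is the identity. Such a matrix is a permutation matrix, because no cancellation can occur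
  in the products.\<close>

lemma positive_involution_permutes:
  assumes J: "J \<subseteq> idx G" and lin: "fun_linear \<phi>"
    and span: "\<And>j. j \<in> J \<Longrightarrow> \<phi> (sroot G j) \<in> root_span G J"
    and pos: "\<And>j. j \<in> J \<Longrightarrow> pos (\<phi> (sroot G j))"
    and inv: "\<And>j. j \<in> J \<Longrightarrow> \<phi> (\<phi> (sroot G j)) = sroot G j"
  shows "\<exists>\<sigma>. \<sigma> permutes J \<and> (\<forall>j\<in>J. \<phi> (sroot G j) = sroot G (\<sigma> j))"
proof -
  have fin: "finite J" using J finite_idx finite_subset by blast
  define M where "M j k = coef (\<phi> (sroot G j)) k" for j k
  have expand: "\<phi> (sroot G j) = (\<lambda>x. \<Sum>k\<in>J. M j k * sroot G k x)" if "j \<in> J" for j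
    unfolding M_def by (rule root_spanD_coef(1)[OF J span[OF that]])
  have nat: "\<exists>n. M j k = of_nat n" if "j \<in> J" "k \<in> J" for j k
    using pos[OF that(1)] J that by (auto simp: pos_iff M_def Nats_def)
  then obtain N :: "nat \<Rightarrow> nat \<Rightarrow> nat" where N: "\<And>j k. j \<in> J \<Longrightarrow> k \<in> J \<Longrightarrow> M j k = of_nat (N j k)"
    by metis
  have square: "(\<Sum>k\<in>J. N j k * N k l) = (if l = j then 1 else 0)" if j: "j \<in> J" and l: "l \<in> J" for j l
  proof -
    have "sroot G j = (\<lambda>x. \<Sum>k\<in>J. M j k * \<phi> (sroot G k) x)"
      using inv[OF j] expand[OF j] fun_linear_sum[OF lin, of "M j" "sroot G" J] by simp
    also have "\<dots> = (\<lambda>x. \<Sum>l\<in>J. (\<Sum>k\<in>J. M j k * M k l) * sroot G l x)"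
    proof (rule ext)
      fix x
      have "(\<Sum>k\<in>J. M j k * \<phi> (sroot G k) x) = (\<Sum>k\<in>J. \<Sum>l\<in>J. M j k * M k l * sroot G l x)"
        by (intro sum.cong) (auto simp: expand sum_distrib_left mult.assoc)
      also have "\<dots> = (\<Sum>l\<in>J. \<Sum>k\<in>J. M j k * M k l * sroot G l x)" by (rule sum.swap)
      finally show "(\<Sum>k\<in>J. M j k * \<phi> (sroot G k) x) = (\<Sum>l\<in>J. (\<Sum>k\<in>J. M j k * M k l) * sroot G l x)"
        by (simp add: sum_distrib_right)
    qed
    finally have "coef (sroot G j) l = (\<Sum>k\<in>J. M j k * M k l)"
      using coef_root_span[OF J, of "sroot G j" "\<lambda>l. \<Sum>k\<in>J. M j k * M k l" l] l J by auto
    also have "\<dots> = of_nat (\<Sum>k\<in>J. N j k * N k l)" using j l by (simp add: N)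
    finally have "of_nat (\<Sum>k\<in>J. N j k * N k l) = (of_nat (if l = j then 1 else 0) :: complex)"
      using coef_sroot[of j l] j l J by (simp only: subset_iff) simp
    then show ?thesis by (simp only: of_nat_eq_iff)
  qed
  have image: "\<exists>k\<in>J. \<phi> (sroot G j) = sroot G k" if j: "j \<in> J" for j
  proof -
    have "(\<Sum>k\<in>J. N j k * N k j) \<noteq> 0" using square[OF j j] by simp
    \<comment> \<open>The diagonal entry of the square at \<open>j\<close> is 1, so some product N j
      k * N k j is nonzero. For \<open>l\<close> other than \<open>j\<close> the term N j k * N k l
      belongs to a vanishing entry of the square, which leaves N k j as the only nonzero entry of
      row \<open>k\<close>.\<close>
    then obtain k where k: "k \<in> J" "N j k * N k j \<noteq> 0" by (meson sum.neutral)
    have "N k l = 0" if l: "l \<in> J" "l \<noteq> j" for l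
      using square[OF j l(1)] l k fin by auto
    then have kj: "\<phi> (sroot G k) x = of_nat (N k j) * sroot G j x" for x
    proof -
      have "\<phi> (sroot G k) x = (\<Sum>l\<in>J. if l = j then of_nat (N k j) * sroot G j x else 0)"
        unfolding expand[OF k(1)] using N k(1) \<open>\<And>l. l \<in> J \<Longrightarrow> l \<noteq> j \<Longrightarrow> N k l = 0\<close>
        by (intro sum.cong) auto
      then show ?thesis using j fin by simp
    qed
    have "(\<Sum>l\<in>J. N k l * N l k) = (\<Sum>l\<in>J. if l = j then N k j * N j k else 0)"
      using \<open>\<And>l. l \<in> J \<Longrightarrow> l \<noteq> j \<Longrightarrow> N k l = 0\<close> by (intro sum.cong) auto
    then have "N k j = 1" using square[OF k(1) k(1)] j fin by simp
    then have "\<phi> (sroot G k) = sroot G j" using kj by auto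
    then have "\<phi> (sroot G j) = sroot G k" using inv[OF k(1)] by simp
    then show ?thesis using k by blast
  qed
  then obtain s where s: "\<And>j. j \<in> J \<Longrightarrow> s j \<in> J \<and> \<phi> (sroot G j) = sroot G (s j)" by metis
  define \<sigma> where "\<sigma> j = (if j \<in> J then s j else j)" for j
  have root_inj: "j = k" if "sroot G j = sroot G k" "j \<in> J" "k \<in> J" for j k
  proof (rule ccontr)
    assume "j \<noteq> k"
    then show False using coef_sroot[of j k] coef_sroot[of k k] that J by auto
  qed
  have "s (s j) = j" if "j \<in> J" for j
  proof -
    have "sroot G (s (s j)) = sroot G j" using s[of j] s[of "s j"] inv[of j] that by simp
    then show ?thesis using root_inj s that by blast
  qed
  then have "bij_betw \<sigma> J J"
    using s by (intro bij_betw_byWitness[of J \<sigma> \<sigma>]) (auto simp: \<sigma>_def)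
  then have "\<sigma> permutes J" by (rule bij_imp_permutes) (simp add: \<sigma>_def)
  then show ?thesis using s by (intro exI[of _ \<sigma>]) (simp add: \<sigma>_def)
qed

text \<open>The reversed word inverts the simple roots too, so by uniqueness the longest element is
  its own inverse.\<close>

lemma longest_elt_word:
  assumes J: "J \<subseteq> idx G"
  obtains ws where "set ws \<subseteq> J" "\<And>m. m \<in> weight_space G \<Longrightarrow> longest_elt G J m = word_act G ws m"
    "\<And>m. m \<in> weight_space G \<Longrightarrow> word_act G ws (word_act G ws m) = m" "inverts J ws"
proof -
  obtain ws where ws: "inverts J ws" "longest_elt G J = weyl_elt G ws" using longest_elt_inverts[OF J] .
  have wsI: "set ws \<subseteq> idx G" using ws J by (auto simp: inverts_def)
  have "word_act G ws (word_act G ws m) = m" if "m \<in> weight_space G" for m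
  proof -
    have "word_act G ws (word_act G ws m) = word_act G (rev ws) (word_act G ws m)"
      using inverts_unique[OF J ws(1) inverts_rev[OF J ws(1)]] word_act_weight_space[OF wsI that] by blast
    then show ?thesis using word_act_rev[OF wsI] by simp
  qed
  then show thesis using that ws weyl_elt_apply by (metis inverts_def)
qed

lemma longest_elt_weight_space:
  "J \<subseteq> idx G \<Longrightarrow> m \<in> weight_space G \<Longrightarrow> longest_elt G J m \<in> weight_space G"
  by (metis longest_elt_word subset_trans word_act_weight_space)

lemma longest_elt_involution:
  "J \<subseteq> idx G \<Longrightarrow> m \<in> weight_space G \<Longrightarrow> longest_elt G J (longest_elt G J m) = m"
  by (metis longest_elt_word longest_elt_weight_space)

text \<open>The opposition involution of the subdiagram \<open>J\<close>. Being a permutation of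
  \<open>J\<close>, it is the identity outside \<open>J\<close>.\<close>

definition opposition :: "nat set \<Rightarrow> nat \<Rightarrow> nat" where
  "opposition J = (SOME \<sigma>. \<sigma> permutes J \<and> (\<forall>j\<in>J. - longest_elt G J (sroot G j) = sroot G (\<sigma> j)))"

lemma
  assumes J: "J \<subseteq> idx G"
  shows opposition_permutes: "opposition J permutes J"
    and longest_elt_sroot: "j \<in> J \<Longrightarrow> longest_elt G J (sroot G j) = - sroot G (opposition J j)"
proof -
  obtain ws where ws: "set ws \<subseteq> J" "\<And>m. m \<in> weight_space G \<Longrightarrow> longest_elt G J m = word_act G ws m"
    "\<And>m. m \<in> weight_space G \<Longrightarrow> word_act G ws (word_act G ws m) = m" "inverts J ws"
    using longest_elt_word[OF J] by blast
  let ?f = "\<lambda>l. - word_act G ws l"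
  have fin: "finite J" using J finite_idx finite_subset by blast
  have "\<exists>\<sigma>. \<sigma> permutes J \<and> (\<forall>j\<in>J. ?f (sroot G j) = sroot G (\<sigma> j))"
  proof (rule positive_involution_permutes[OF J])
    show "fun_linear ?f" by (intro fun_linear_neg fun_linear_word_act)
    fix j assume j: "j \<in> J"
    show "pos (?f (sroot G j))" using ws(4) j by (simp add: inverts_def)
    have "word_act G ws (sroot G j) - sroot G j \<in> root_span G J" using word_act_root_span[OF fin ws(1)] .
    then have "(word_act G ws (sroot G j) - sroot G j) + sroot G j \<in> root_span G J"
      using root_span_sroot[OF fin j] root_span_add by blast
    then show "?f (sroot G j) \<in> root_span G J" using root_span_uminus by (simp add: fun_eq_iff)
    show "?f (?f (sroot G j)) = sroot G j"
      unfolding fun_linear_uminus[OF fun_linear_word_act] minus_minus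
      using ws(3) sroot_weight_space j J by blast
  qed
  then have "\<exists>\<sigma>. \<sigma> permutes J \<and> (\<forall>j\<in>J. - longest_elt G J (sroot G j) = sroot G (\<sigma> j))"
    using ws(2) sroot_weight_space J by (simp add: subset_iff)
  then have *: "opposition J permutes J \<and> (\<forall>j\<in>J. - longest_elt G J (sroot G j) = sroot G (opposition J j))"
    unfolding opposition_def by (rule someI_ex)
  then show "opposition J permutes J" by blast
  assume "j \<in> J"
  then have "- longest_elt G J (sroot G j) = sroot G (opposition J j)" using * by blast
  then show "longest_elt G J (sroot G j) = - sroot G (opposition J j)" by (metis minus_minus)
qed

text \<open>The negative of the longest element permutes the signed roots, so its action on simple
  roots determines the action on coroots by \<open>coroot_transport\<close>.\<close>

lemma longest_elt_coroot:
  assumes J: "J \<subseteq> idx G" and j: "j \<in> J" and m: "m \<in> weight_space G"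
  shows "longest_elt G J m (coroot G (opposition J j)) = - m (coroot G j)"
proof -
  obtain ws where ws: "set ws \<subseteq> J" "\<And>m. m \<in> weight_space G \<Longrightarrow> longest_elt G J m = word_act G ws m"
    using longest_elt_word[OF J] by metis
  have wsI: "set ws \<subseteq> idx G" using ws J by blast
  have oj: "opposition J j \<in> J" using permutes_in_image[OF opposition_permutes[OF J]] j by blast
  have "(- word_act G ws m) (coroot G (opposition J j)) = m (coroot G j)"
  proof (rule coroot_transport)
    show "fun_linear (\<lambda>l. - word_act G ws l)" by (intro fun_linear_neg fun_linear_word_act)
    show "(\<lambda>l. - word_act G ws l) ` signed_roots \<subseteq> signed_roots"
      using word_act_signed_roots[OF wsI] signed_roots_uminus by blast
    show "inj_on (\<lambda>l. - word_act G ws l) (weight_space G)"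
      using inj_on_word_act[OF wsI, of UNIV] by (auto simp: inj_on_def)
    have "- longest_elt G J (sroot G j) = sroot G (opposition J j)"
      using longest_elt_sroot[OF J j] by simp
    then show "- word_act G ws (sroot G j) = sroot G (opposition J j)"
      using ws(2) sroot_weight_space j J by (simp add: subset_iff)
  qed (use j oj J m in auto)
  then have "- word_act G ws m (coroot G (opposition J j)) = m (coroot G j)" by simp
  then show ?thesis using ws(2)[OF m] by (metis minus_minus)
qed

lemma opposition_cartan:
  assumes J: "J \<subseteq> idx G" and ij: "i \<in> J" "j \<in> J"
  shows "sroot G (opposition J i) (coroot G (opposition J j)) = sroot G i (coroot G j)"
proof -
  have "sroot G i \<in> weight_space G" using ij J sroot_weight_space by blast
  then have "longest_elt G J (sroot G i) (coroot G (opposition J j)) = - sroot G i (coroot G j)"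
    using longest_elt_coroot[OF J ij(2)] by blast
  then show ?thesis using longest_elt_sroot[OF J ij(1)] by simp
qed

text \<open>
  The Weyl group acts trivially on weights modulo roots.  Hence a character of that quotient, given
  by its values \<open>k\<close> on the fundamental weights modulo \<open>N\<close>, constrains the opposition.
\<close>

lemma opposition_character:
  fixes k :: "nat \<Rightarrow> int" and c :: "nat \<Rightarrow> nat \<Rightarrow> int"
  assumes J: "J \<subseteq> idx G"
    and c: "\<And>i j. i \<in> J \<Longrightarrow> j \<in> J \<Longrightarrow> sroot G i (coroot G j) = of_int (c i j)"
    and char: "\<And>i. i \<in> J \<Longrightarrow> N dvd (\<Sum>j\<in>J. k j * c i j)" and i: "i \<in> J"
  shows "N dvd k i + k (opposition J i)"
proof -
  have fin: "finite J" using J finite_idx finite_subset by blast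
  have iI: "i \<in> idx G" using i J by blast
  let ?w = "fund_weight G i" and ?d = "\<lambda>j. if j = i then 1 else 0 :: int"
  \<comment> \<open>\<open>b\<close> lists the coordinates of the image of \<open>?w\<close>. A
    letter \<open>a\<close> subtracts b(a) times row \<open>a\<close> of the Cartan matrix, on which
    the character vanishes modulo \<open>N\<close>.\<close>
  have act: "\<exists>b. (\<forall>j\<in>J. word_act G us ?w (coroot G j) = of_int (b j)) \<and>
    N dvd (\<Sum>j\<in>J. k j * b j) - (\<Sum>j\<in>J. k j * ?d j)" if "set us \<subseteq> J" for us
    using that
  proof (induction us)
    case Nil
    have "\<forall>j\<in>J. word_act G [] ?w (coroot G j) = of_int (?d j)"
      using fund_weight(2)[OF iI] J by auto
    then show ?case by (intro exI[of _ ?d]) simp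
  next
    case (Cons a us)
    then obtain b where b: "\<forall>j\<in>J. word_act G us ?w (coroot G j) = of_int (b j)"
      "N dvd (\<Sum>j\<in>J. k j * b j) - (\<Sum>j\<in>J. k j * ?d j)" by auto
    have a: "a \<in> J" using Cons by simp
    let ?b = "\<lambda>j. b j - b a * c a j"
    have "\<forall>j\<in>J. word_act G (a # us) ?w (coroot G j) = of_int (?b j)"
      using b(1) a c by (simp add: simple_refl_def)
    moreover have "(\<Sum>j\<in>J. k j * ?b j) = (\<Sum>j\<in>J. k j * b j) - b a * (\<Sum>j\<in>J. k j * c a j)"
      by (simp add: algebra_simps sum_subtractf sum_distrib_left)
    then have "(\<Sum>j\<in>J. k j * ?b j) - (\<Sum>j\<in>J. k j * ?d j) =
      ((\<Sum>j\<in>J. k j * b j) - (\<Sum>j\<in>J. k j * ?d j)) - b a * (\<Sum>j\<in>J. k j * c a j)" by simp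
    then have "N dvd (\<Sum>j\<in>J. k j * ?b j) - (\<Sum>j\<in>J. k j * ?d j)"
      using b(2) char[OF a] by (simp only: dvd_diff dvd_mult)
    ultimately show ?case by (intro exI[of _ ?b]) (rule conjI)
  qed
  obtain ws where ws: "set ws \<subseteq> J" "\<And>m. m \<in> weight_space G \<Longrightarrow> longest_elt G J m = word_act G ws m"
    using longest_elt_word[OF J] by metis
  obtain b where b: "\<forall>j\<in>J. word_act G ws ?w (coroot G j) = of_int (b j)"
    "N dvd (\<Sum>j\<in>J. k j * b j) - (\<Sum>j\<in>J. k j * ?d j)" using act[OF ws(1)] by blast
  let ?o = "opposition J"
  have o: "?o j \<in> J" if "j \<in> J" for j using permutes_in_image[OF opposition_permutes[OF J]] that by blast
  \<comment> \<open>The longest element sends the fundamental weight of \<open>i\<close> to minus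
    that of the opposite node, so the invariant value of the character is both k(i) and minus its
    value at that node.\<close>
  have bo: "b (?o j) = - ?d j" if j: "j \<in> J" for j
  proof -
    have "of_int (b (?o j)) = longest_elt G J ?w (coroot G (?o j))"
      using b(1) ws(2)[OF fund_weight(1)[OF iI]] o[OF j] by simp
    also have "\<dots> = of_int (- ?d j)"
      using longest_elt_coroot[OF J j fund_weight(1)[OF iI]] fund_weight(2)[OF iI] j J by auto
    finally show ?thesis by (simp only: of_int_eq_iff)
  qed
  have "(\<Sum>j\<in>J. k j * b j) = (\<Sum>j\<in>J. k (?o j) * b (?o j))"
    using sum.permute[OF opposition_permutes[OF J], of "\<lambda>j. k j * b j"] by (simp add: o_def)
  also have "\<dots> = (\<Sum>j\<in>J. if j = i then - k (?o i) else 0)" using bo by (intro sum.cong) auto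
  also have "\<dots> = - k (?o i)" using i fin by simp
  finally have "N dvd - k (?o i) - (\<Sum>j\<in>J. k j * ?d j)" using b(2) by simp
  moreover have "(\<Sum>j\<in>J. k j * ?d j) = k i" using i fin by (simp add: if_distrib cong: if_cong)
  moreover have "- k (?o i) - k i = - (k i + k (?o i))" by simp
  ultimately have "N dvd - (k i + k (?o i))" by metis
  then show ?thesis by (simp only: dvd_minus_iff)
qed

end

section \<open>The diagram automorphism of a maximally split involution\<close>

context semisimple
begin

lemma inj_sroot: "inj_on (sroot G) (idx G)"
proof (rule inj_onI, rule ccontr)
  fix j k assume *: "j \<in> idx G" "k \<in> idx G" "sroot G j = sroot G k" "j \<noteq> k"
  then show False using coef_sroot[of j k] coef_sroot[of k k] by auto
qed

lemma root_space_weight_unique: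
  assumes "x \<in> root_space G a" "x \<in> root_space G b" "x \<noteq> 0" "a \<in> weight_space G" "b \<in> weight_space G"
  shows "a = b"
proof (rule weight_eqI[OF assms(4,5)])
  fix h assume "h \<in> csa G"
  then have "brk G h x = smult G (a h) x" "brk G h x = smult G (b h) x"
    using assms(1,2) unfolding root_space_def by blast+
  then have "smult G (a h) x = smult G (b h) x" by (rule trans[OF sym])
  then show "a h = b h" using assms(3) by simp
qed

lemma w0_eq_opposition_iff:
  assumes m: "m \<in> weight_space G"
  shows "m = - w0 G m \<longleftrightarrow> (\<forall>j\<in>idx G. m (coroot G (opposition (idx G) j)) = m (coroot G j))"
proof
  assume eq: "m = - w0 G m"
  show "\<forall>j\<in>idx G. m (coroot G (opposition (idx G) j)) = m (coroot G j)"
  proof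
    fix j assume "j \<in> idx G"
    then have "(- w0 G m) (coroot G (opposition (idx G) j)) = m (coroot G j)"
      using longest_elt_coroot[OF order_refl _ m] by (simp add: w0_def)
    then show "m (coroot G (opposition (idx G) j)) = m (coroot G j)" using eq by metis
  qed
next
  assume *: "\<forall>j\<in>idx G. m (coroot G (opposition (idx G) j)) = m (coroot G j)"
  show "m = - w0 G m"
  proof (rule weights_eq_if_coroots[OF m])
    show "- w0 G m \<in> weight_space G"
      using longest_elt_weight_space[OF order_refl m] weight_space_uminus by (simp add: w0_def)
    fix k assume "k \<in> idx G"
    then obtain j where j: "j \<in> idx G" "k = opposition (idx G) j"
      using permutes_image[OF opposition_permutes[OF order_refl]] by blast
    then show "m (coroot G k) = (- w0 G m) (coroot G k)"
      using * longest_elt_coroot[OF order_refl j(1) m] by (simp add: w0_def)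
  qed
qed

end

locale split_pair = semisimple G for G :: "'g::ab_group_add lie_data" +
  fixes \<theta> :: "'g \<Rightarrow> 'g"
  assumes split: "maximally_split G \<theta>"
begin

abbreviation "J \<equiv> pi_Theta G \<theta>"
abbreviation "T \<equiv> Theta \<theta>"

sublocale th: Vector_Spaces.linear "smult G" "smult G" \<theta>
  using split by (simp add: maximally_split_def involutive_automorphism_def)

lemma theta_theta: "\<theta> (\<theta> x) = x"
  and theta_brk: "\<theta> (brk G x y) = brk G (\<theta> x) (\<theta> y)"
  using split by (auto simp: maximally_split_def involutive_automorphism_def)

lemma theta_csa_iff: "\<theta> h \<in> csa G \<longleftrightarrow> h \<in> csa G"
proof -
  have "\<theta> ` csa G = csa G" using split by (simp add: maximally_split_def)
  then show ?thesis using theta_theta by (metis imageI)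
qed

lemma J_subset: "J \<subseteq> idx G"
  by (auto simp: pi_Theta_def)

lemma finite_J: "finite J"
  using J_subset finite_idx finite_subset by blast

lemma Theta_Theta: "T (T m) = m"
  by (auto simp: Theta_def theta_theta)

lemma Theta_weight_space: "m \<in> weight_space G \<Longrightarrow> T m \<in> weight_space G"
  by (rule weight_spaceI) (auto simp: Theta_def th.add th.scale theta_csa_iff weight_space_add weight_space_scale weight_space_out)

lemma Theta_sroot: "j \<in> J \<Longrightarrow> T (sroot G j) = sroot G j"
  by (simp add: pi_Theta_def)

lemma theta_root_space: "x \<in> root_space G b \<Longrightarrow> \<theta> x \<in> root_space G (T b)"
proof -
  assume x: "x \<in> root_space G b"
  have "brk G h (\<theta> x) = smult G (T b h) (\<theta> x)" if "h \<in> csa G" for h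
  proof -
    have "brk G h (\<theta> x) = \<theta> (brk G (\<theta> h) x)" by (simp add: theta_brk theta_theta)
    also have "brk G (\<theta> h) x = smult G (b (\<theta> h)) x"
      using x that by (simp add: root_space_def theta_csa_iff)
    finally show ?thesis by (simp add: th.scale Theta_def)
  qed
  then show ?thesis by (simp add: root_space_def)
qed

lemma Theta_roots: "b \<in> roots G \<Longrightarrow> T b \<in> roots G"
proof -
  assume b: "b \<in> roots G"
  have "0 \<in> root_space G b" by (simp add: root_space_def br.zero)
  then obtain x where x: "x \<in> root_space G b" "x \<noteq> 0" using b by (auto simp: roots_def)
  have "\<theta> x \<noteq> 0" using x(2) theta_theta[of x] th.zero by metis
  moreover have "T b \<noteq> 0" using b Theta_Theta[of b] fun_linear_0[OF fun_linear_Theta, of \<theta>] by (fastforce simp: roots_def)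
  ultimately show ?thesis
    using theta_root_space[OF x(1)] Theta_weight_space roots_weight_space[OF b] by (auto simp: roots_def)
qed

lemma Theta_signed_roots: "b \<in> signed_roots \<Longrightarrow> T b \<in> signed_roots"
  using Theta_roots fun_linear_uminus[OF fun_linear_Theta] by (auto simp: signed_roots_def)

lemma theta_coroot: "j \<in> J \<Longrightarrow> \<theta> (coroot G j) = coroot G j"
  using split by (simp add: coroot_def theta_brk maximally_split_def)

text \<open>Maximal splitness speaks about root vectors: the image of \<open>gen_e G i\<close> lies
  in the space of some negative root. A nonzero vector has only one weight, so this root is the
  image of the simple root.\<close>

lemma Theta_sroot_neg: "i \<in> idx G \<Longrightarrow> i \<notin> J \<Longrightarrow> pos (- T (sroot G i))"
proof -
  assume i: "i \<in> idx G" "i \<notin> J"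
  then obtain b where b: "b \<in> neg_roots G" "\<theta> (gen_e G i) \<in> root_space G b - {0}"
    using split unfolding maximally_split_def by blast
  have "T (sroot G i) = b"
    using root_space_weight_unique[of "\<theta> (gen_e G i)" "T (sroot G i)" b] b theta_root_space[OF gen_e_root[OF i(1)]]
      Theta_weight_space[OF sroot_weight_space[OF i(1)]] by (auto simp: neg_roots_def roots_def)
  then show ?thesis using b by (simp add: neg_roots_def)
qed

text \<open>On \<open>J\<close> the involution fixes \<open>gen_e\<close> and \<open>gen_f\<close>,
  hence the coroots as well as the simple roots, and \<open>T\<close> commutes with the reflections
  in \<open>J\<close>.\<close>

lemma Theta_word_act: "set ws \<subseteq> J \<Longrightarrow> T (word_act G ws m) = word_act G ws (T m)"
proof (induction ws)
  case (Cons j ws)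
  then have j: "j \<in> J" by simp
  have "T (simple_refl G j l) = simple_refl G j (T l)" for l
    using fun_cong[OF Theta_sroot[OF j]] theta_coroot[OF j] by (auto simp: simple_refl_def Theta_def)
  then show ?case using Cons by simp
qed simp

lemma Theta_root_span: "z \<in> root_span G J \<Longrightarrow> T z = z"
  using root_span_fixed[OF fun_linear_Theta, of J] Theta_sroot by blast

text \<open>The automorphism \<open>d\<close> of the overview. On \<open>J\<close> it is the
  opposition of \<open>J\<close>, so there it may differ from the permutation \<open>p\<close> of
  the Satake diagram, which is the identity on \<open>J\<close>.\<close>

definition twist :: "nat \<Rightarrow> nat" where
  "twist = (SOME d. d permutes idx G \<and> (\<forall>i\<in>idx G. - longest_elt G J (T (sroot G i)) = sroot G (d i)))"

lemma
  shows twist_permutes: "twist permutes idx G"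
    and twist_sroot: "i \<in> idx G \<Longrightarrow> - longest_elt G J (T (sroot G i)) = sroot G (twist i)"
proof -
  obtain ws where ws: "set ws \<subseteq> J" "\<And>m. m \<in> weight_space G \<Longrightarrow> longest_elt G J m = word_act G ws m"
    "\<And>m. m \<in> weight_space G \<Longrightarrow> word_act G ws (word_act G ws m) = m" "inverts J ws"
    using longest_elt_word[OF J_subset] by blast
  have wsI: "set ws \<subseteq> idx G" using ws J_subset by blast
  let ?f = "\<lambda>l. - word_act G ws (T l)"
  have "\<exists>d. d permutes idx G \<and> (\<forall>i\<in>idx G. ?f (sroot G i) = sroot G (d i))"
  proof (rule positive_involution_permutes[OF order_refl])
    show "fun_linear ?f"
      by (intro fun_linear_neg fun_linear_comp[OF fun_linear_word_act fun_linear_Theta])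
    fix i assume i: "i \<in> idx G"
    have "?f (sroot G i) \<in> weight_space G"
      using i wsI by (intro weight_space_uminus word_act_weight_space Theta_weight_space sroot_weight_space)
    then show "?f (sroot G i) \<in> root_span G (idx G)" by (simp only: weight_space_root_span)
    have "?f (?f (sroot G i)) = word_act G ws (word_act G ws (T (T (sroot G i))))"
      unfolding fun_linear_uminus[OF fun_linear_Theta] fun_linear_uminus[OF fun_linear_word_act]
        Theta_word_act[OF ws(1)] minus_minus ..
    then show "?f (?f (sroot G i)) = sroot G i"
      using ws(3)[OF sroot_weight_space[OF i]] unfolding Theta_Theta by simp
    show "pos (?f (sroot G i))"
    proof (cases "i \<in> J")
      case True
      then show ?thesis using ws(4) Theta_sroot by (simp add: inverts_def)
    next
      case False
      \<comment> \<open>Off \<open>J\<close>, the longest element of \<open>J\<close> changes only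
        the coefficients of \<open>b\<close> on \<open>J\<close>. If it made \<open>b\<close>
        negative, all coefficients off \<open>J\<close> would vanish and \<open>T\<close> would fix
        \<open>b\<close>; but \<open>T b\<close> is the negative of the simple root of
        \<open>i\<close>, while \<open>b\<close> is positive.\<close>
      define b where "b = - T (sroot G i)"
      have bpos: "pos b" using Theta_sroot_neg[OF i False] by (simp add: b_def)
      have b: "b \<in> signed_roots"
        unfolding b_def by (intro signed_roots_uminus Theta_signed_roots sroot_signed_roots i)
      have bw: "b \<in> weight_space G" using signed_roots_weight_space[OF b] .
      have wb: "word_act G ws b \<in> signed_roots" using word_act_signed_roots[OF wsI b] .
      have "pos (word_act G ws b)"
      proof (rule ccontr)
        assume "\<not> pos (word_act G ws b)"
        then have neg: "pos (- word_act G ws b)" using signed_roots_pos_or_neg[OF wb] by blast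
        have "coef b k = 0" if k: "k \<in> idx G" "k \<notin> J" for k
        proof -
          have "coef (word_act G ws b) k = coef b k"
            using k ws(1) by (intro coef_word_act[OF wsI bw]) auto
          then have "- coef b k \<in> \<nat>"
            using neg k coef_uminus[OF signed_roots_weight_space[OF wb] k(1)] unfolding pos_iff by metis
          then show ?thesis using bpos k Nats_uminus_zero by (auto simp: pos_iff)
        qed
        then have "b x = (\<Sum>j\<in>J. coef b j * sroot G j x)" for x
          using fun_cong[OF coef_expand[OF bw], of x] J_subset finite_idx
            sum.mono_neutral_right[of "idx G" J "\<lambda>k. coef b k * sroot G k x"] by simp
        then have "b = (\<lambda>x. \<Sum>j\<in>J. coef b j * sroot G j x)" by (rule ext)
        then have "b \<in> root_span G J" using root_spanI by metis
        then have "b = T b" using Theta_root_span by metis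
        also have "\<dots> = - sroot G i"
          unfolding b_def fun_linear_uminus[OF fun_linear_Theta] Theta_Theta ..
        finally have "pos (- sroot G i)" using bpos by metis
        then show False
          using pos_sroot[OF i] pos_uminus_pos signed_roots_nonzero[OF sroot_signed_roots[OF i]] by blast
      qed
      then show ?thesis unfolding b_def fun_linear_uminus[OF fun_linear_word_act] .
    qed
  qed
  then have "\<exists>d. d permutes idx G \<and> (\<forall>i\<in>idx G. - longest_elt G J (T (sroot G i)) = sroot G (d i))"
    using ws(2) Theta_weight_space sroot_weight_space by simp
  then have *: "twist permutes idx G \<and> (\<forall>i\<in>idx G. - longest_elt G J (T (sroot G i)) = sroot G (twist i))"
    unfolding twist_def by (rule someI_ex)
  then show "twist permutes idx G"
    and "i \<in> idx G \<Longrightarrow> - longest_elt G J (T (sroot G i)) = sroot G (twist i)" by blast+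
qed

lemma twist_in: "i \<in> idx G \<Longrightarrow> twist i \<in> idx G"
  using permutes_in_image[OF twist_permutes] by blast

lemma twist_coroot:
  assumes i: "i \<in> idx G" and m: "m \<in> weight_space G"
  shows "longest_elt G J (T m) (coroot G (twist i)) = - m (coroot G i)"
proof -
  obtain ws where ws: "set ws \<subseteq> J" "\<And>m. m \<in> weight_space G \<Longrightarrow> longest_elt G J m = word_act G ws m"
    using longest_elt_word[OF J_subset] by metis
  have wsI: "set ws \<subseteq> idx G" using ws J_subset by blast
  have "(- word_act G ws (T m)) (coroot G (twist i)) = m (coroot G i)"
  proof (rule coroot_transport)
    show "fun_linear (\<lambda>l. - word_act G ws (T l))"
      by (intro fun_linear_neg fun_linear_comp[OF fun_linear_word_act fun_linear_Theta])
    show "(\<lambda>l. - word_act G ws (T l)) ` signed_roots \<subseteq> signed_roots"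
      using word_act_signed_roots[OF wsI] signed_roots_uminus Theta_signed_roots by blast
    show "inj_on (\<lambda>l. - word_act G ws (T l)) (weight_space G)"
    proof (rule inj_onI)
      fix l m assume "- word_act G ws (T l) = - word_act G ws (T m)"
      then have "word_act G ws (T l) = word_act G ws (T m)" by (metis minus_minus)
      then have "T l = T m" using word_act_rev[OF wsI] by metis
      then show "l = m" using Theta_Theta by metis
    qed
    show "- word_act G ws (T (sroot G i)) = sroot G (twist i)"
      using twist_sroot[OF i] ws(2)[OF Theta_weight_space[OF sroot_weight_space[OF i]]] by metis
  qed (use i twist_in m in auto)
  then have "- word_act G ws (T m) (coroot G (twist i)) = m (coroot G i)" by simp
  then show ?thesis using ws(2)[OF Theta_weight_space[OF m]] by (metis minus_minus)
qed

lemma twist_cartan: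
  assumes "i \<in> idx G" "j \<in> idx G"
  shows "sroot G (twist i) (coroot G (twist j)) = sroot G i (coroot G j)"
  using twist_coroot[OF assms(2) sroot_weight_space[OF assms(1)]]
    fun_cong[OF twist_sroot[OF assms(1)], of "coroot G (twist j)"] by simp

lemma twist_J: "j \<in> J \<Longrightarrow> twist j = opposition J j"
proof -
  assume j: "j \<in> J"
  then have jI: "j \<in> idx G" using J_subset by blast
  have "sroot G (twist j) = - longest_elt G J (sroot G j)" using twist_sroot[OF jI] Theta_sroot[OF j] by simp
  also have "\<dots> = sroot G (opposition J j)" using longest_elt_sroot[OF J_subset j] by simp
  finally show ?thesis
    using inj_sroot twist_in[OF jI] permutes_in_image[OF opposition_permutes[OF J_subset]] j J_subset
    by (meson inj_onD subset_iff)
qed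

text \<open>Coefficients are compared at \<open>p i\<close>, which lies off \<open>J\<close>. There
  the image of the simple root under \<open>T\<close> has coefficient -1, and the longest element of
  \<open>J\<close> leaves this coefficient alone.\<close>

lemma twist_satake_perm:
  assumes p: "satake_perm G \<theta> p" and i: "i \<in> idx G" "i \<notin> J"
  shows "twist i = p i"
proof (rule ccontr)
  assume ne: "twist i \<noteq> p i"
  have pI: "p i \<in> idx G" using p i permutes_in_image[of p "idx G" i] by (simp add: satake_perm_def)
  \<comment> \<open>\<open>p\<close> is injective and fixes \<open>J\<close> pointwise, so nothing
    outside \<open>J\<close> is sent into it.\<close>
  have pJ: "p i \<notin> J"
  proof
    assume "p i \<in> J"
    then have "p (p i) = p i" using p by (simp add: satake_perm_def)
    then have "p i = i" using p permutes_inj[of p "idx G"] by (auto simp: satake_perm_def dest: injD)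
    then show False using \<open>p i \<in> J\<close> i by simp
  qed
  obtain z where z: "z \<in> int_span J (sroot G)" "T (sroot G i) = - sroot G (p i) + z"
    using p i by (auto simp: satake_perm_def)
  have zJ: "z \<in> root_span G J" using z(1) by (auto simp: int_span_def root_span_def)
  obtain ws where ws: "set ws \<subseteq> J" "\<And>m. m \<in> weight_space G \<Longrightarrow> longest_elt G J m = word_act G ws m"
    using longest_elt_word[OF J_subset] by metis
  have wsI: "set ws \<subseteq> idx G" using ws J_subset by blast
  have Tw: "T (sroot G i) \<in> weight_space G" by (intro Theta_weight_space sroot_weight_space i)
  have nots: "p i \<notin> set ws" using ws pJ by blast
  have "sroot G (twist i) = - word_act G ws (T (sroot G i))"
    using twist_sroot[OF i(1)] ws(2)[OF Tw] by metis
  then have "coef (sroot G (twist i)) (p i) = - coef (T (sroot G i)) (p i)"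
    using coef_uminus[OF word_act_weight_space[OF wsI Tw] pI] coef_word_act[OF wsI Tw pI nots] by metis
  also have "coef (T (sroot G i)) (p i) = coef (- sroot G (p i)) (p i) + coef z (p i)"
    unfolding z(2) using pI root_span_weight_space[OF J_subset zJ] sroot_weight_space
    by (intro coef_add weight_space_uminus)
  also have "\<dots> = - 1"
    using root_spanD_coef(2)[OF J_subset zJ pI pJ] coef_uminus[OF sroot_weight_space[OF pI] pI]
      coef_sroot[OF pI pI] by simp
  finally show False using coef_sroot[OF twist_in[OF i(1)] pI] ne by simp
qed

section \<open>The defining condition of \<open>PZB\<close> in terms of twist and opposition\<close>

lemma weight_eq_on_permuted_coroots:
  assumes "d permutes idx G" "l \<in> weight_space G" "m \<in> weight_space G"
    and "\<And>j. j \<in> idx G \<Longrightarrow> l (coroot G (d j)) = m (coroot G (d j))"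
  shows "l = m"
proof (rule weights_eq_if_coroots[OF assms(2,3)])
  fix k assume "k \<in> idx G"
  then obtain j where "j \<in> idx G" "k = d j" using permutes_image[OF assms(1)] by blast
  then show "l (coroot G k) = m (coroot G k)" using assms(4) by blast
qed

lemma dominant_weights_weight_space: "m \<in> dominant_weights G \<Longrightarrow> m \<in> weight_space G"
  by (simp add: dominant_weights_def)

text \<open>\<open>v\<close> is mu - d mu. Since the longest element of \<open>J\<close> is an
  involution, it sends \<open>v\<close> to w0' mu + T mu, and moving one summand across gives the
  condition.\<close>

lemma PZB_condition_iff:
  assumes m: "m \<in> weight_space G"
  defines "v \<equiv> m + longest_elt G J (T m)"
  shows "T m = m + w0 G m - w0' G \<theta> m \<longleftrightarrow> longest_elt G J v = m + w0 G m"
proof -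
  obtain ws where ws: "set ws \<subseteq> J" "\<And>m. m \<in> weight_space G \<Longrightarrow> longest_elt G J m = word_act G ws m"
    "\<And>m. m \<in> weight_space G \<Longrightarrow> word_act G ws (word_act G ws m) = m"
    using longest_elt_word[OF J_subset] by metis
  have Tm: "T m \<in> weight_space G" using Theta_weight_space[OF m] .
  have "v \<in> weight_space G"
    unfolding v_def by (intro weight_space_plus m longest_elt_weight_space J_subset Tm)
  then have "longest_elt G J v = word_act G ws (m + word_act G ws (T m))"
    using ws(2) Tm by (simp only: v_def)
  also have "\<dots> = word_act G ws m + T m"
    unfolding fun_linear_add[OF fun_linear_word_act] ws(3)[OF Tm] ..
  also have "\<dots> = w0' G \<theta> m + T m" using ws(2)[OF m] by (simp only: w0'_def)
  finally show ?thesis by (metis add.commute diff_add_cancel eq_diff_eq)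
qed

lemma PZB_if_twist_opposition:
  assumes "\<And>i. i \<in> idx G \<Longrightarrow> twist i = opposition (idx G) i"
  shows "PZB G \<theta> = dominant_weights G"
proof -
  have "T m = m + w0 G m - w0' G \<theta> m" if m: "m \<in> weight_space G" for m
  proof -
    obtain ws where ws: "set ws \<subseteq> J" "\<And>m. m \<in> weight_space G \<Longrightarrow> longest_elt G J m = word_act G ws m"
      "\<And>m. m \<in> weight_space G \<Longrightarrow> word_act G ws (word_act G ws m) = m"
      using longest_elt_word[OF J_subset] by metis
    have Tm: "T m \<in> weight_space G" using Theta_weight_space[OF m] .
    \<comment> \<open>Both weights take the value - m(h_j) on the coroot of \<open>twist j\<close>,
      where h_j is the coroot of \<open>j\<close>; for \<open>w0\<close> this is where twist and
      opposition have to agree.\<close>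
    have eq: "longest_elt G J (T m) = w0 G m"
    proof (rule weight_eq_on_permuted_coroots[OF twist_permutes])
      fix j assume "j \<in> idx G"
      then show "longest_elt G J (T m) (coroot G (twist j)) = w0 G m (coroot G (twist j))"
        using twist_coroot[OF _ m] longest_elt_coroot[OF order_refl _ m] assms by (simp add: w0_def)
    qed (simp_all only: w0_def longest_elt_weight_space[OF J_subset Tm] longest_elt_weight_space[OF order_refl m])
    define v where "v = m + longest_elt G J (T m)"
    have v: "v \<in> weight_space G"
      unfolding v_def by (intro weight_space_plus m longest_elt_weight_space J_subset Tm)
    have vm: "v = m + word_act G ws (T m)" by (simp only: v_def ws(2)[OF Tm])
    have "T v = T m + word_act G ws m"
      unfolding vm fun_linear_add[OF fun_linear_Theta] Theta_word_act[OF ws(1)] Theta_Theta ..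
    then have "word_act G ws (T v) = v"
      unfolding vm by (simp only: fun_linear_add[OF fun_linear_word_act] ws(3)[OF m] add.commute)
    then have Tv: "T v = word_act G ws v" using ws(3)[OF Theta_weight_space[OF v]] by metis
    \<comment> \<open>\<open>z\<close> is a combination of roots of \<open>J\<close>, so
      \<open>T\<close> fixes it; but \<open>T\<close> also exchanges \<open>v\<close> with its image
      under the longest element and hence negates \<open>z\<close>.\<close>
    define z where "z = word_act G ws v - v"
    have "z \<in> root_span G J" unfolding z_def by (rule word_act_root_span[OF finite_J ws(1)])
    then have "z = T z" using Theta_root_span by metis
    also have "\<dots> = v - word_act G ws v"
      unfolding z_def fun_linear_diff[OF fun_linear_Theta] Theta_word_act[OF ws(1)]
        \<open>word_act G ws (T v) = v\<close> by (simp only: Tv)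
    finally have "z x = - z x" for x unfolding z_def by (metis fun_diff_def minus_diff_eq)
    then have "word_act G ws v = v" by (auto simp: z_def fun_eq_iff)
    then have "longest_elt G J v = m + w0 G m" using ws(2)[OF v] v_def eq by simp
    then show ?thesis using PZB_condition_iff[OF m] by (simp only: v_def)
  qed
  then show ?thesis using dominant_weights_weight_space by (auto simp: PZB_def)
qed

text \<open>Here mu - d mu is zero, so the left side of the rewritten condition disappears.\<close>

lemma PZB_if_twist_id:
  assumes "\<And>i. i \<in> idx G \<Longrightarrow> twist i = i"
  shows "PZB G \<theta> = {m \<in> dominant_weights G. m = - w0 G m}"
proof -
  have "T m = m + w0 G m - w0' G \<theta> m \<longleftrightarrow> m = - w0 G m" if m: "m \<in> weight_space G" for m
  proof -
    have Tm: "T m \<in> weight_space G" using Theta_weight_space[OF m] .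
    have "longest_elt G J (T m) = - m"
    proof (rule weights_eq_if_coroots)
      fix j assume "j \<in> idx G"
      then show "longest_elt G J (T m) (coroot G j) = (- m) (coroot G j)"
        using twist_coroot[OF _ m, of j] assms by simp
    qed (rule longest_elt_weight_space[OF J_subset Tm], rule weight_space_uminus[OF m])
    moreover have "longest_elt G J 0 = 0"
    proof -
      obtain ws where "longest_elt G J 0 = word_act G ws 0"
        using longest_elt_word[OF J_subset] zero_in_weight_space by metis
      then show ?thesis using fun_linear_0[OF fun_linear_word_act] by metis
    qed
    ultimately have "T m = m + w0 G m - w0' G \<theta> m \<longleftrightarrow> 0 = m + w0 G m"
      using PZB_condition_iff[OF m] by simp
    then show ?thesis by (metis add.right_neutral eq_neg_iff_add_eq_0)
  qed
  then show ?thesis using dominant_weights_weight_space by (auto simp: PZB_def)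
qed

text \<open>Here mu + w0 mu is zero for every mu. The longest element of \<open>J\<close> is
  invertible, so mu - d mu has to vanish.\<close>

lemma PZB_if_opposition_id:
  assumes "\<And>i. i \<in> idx G \<Longrightarrow> opposition (idx G) i = i"
  shows "PZB G \<theta> = {m \<in> dominant_weights G. \<forall>j\<in>idx G. m (coroot G (twist j)) = m (coroot G j)}"
proof -
  have "T m = m + w0 G m - w0' G \<theta> m \<longleftrightarrow> (\<forall>j\<in>idx G. m (coroot G (twist j)) = m (coroot G j))"
    if m: "m \<in> weight_space G" for m
  proof -
    have Tm: "T m \<in> weight_space G" using Theta_weight_space[OF m] .
    have LTm: "longest_elt G J (T m) \<in> weight_space G" by (intro longest_elt_weight_space J_subset Tm)
    let ?v = "m + longest_elt G J (T m)"
    have v: "?v \<in> weight_space G" by (intro weight_space_plus m LTm)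
    have "m = - w0 G m" using w0_eq_opposition_iff[OF m] assms by simp
    then have "m + w0 G m = 0" by (metis eq_neg_iff_add_eq_0)
    then have "T m = m + w0 G m - w0' G \<theta> m \<longleftrightarrow> longest_elt G J ?v = 0"
      using PZB_condition_iff[OF m] by simp
    also have "\<dots> \<longleftrightarrow> ?v = 0"
    proof -
      obtain ws where ws: "longest_elt G J 0 = word_act G ws 0"
        using longest_elt_word[OF J_subset] zero_in_weight_space by metis
      then have "longest_elt G J 0 = 0" using fun_linear_0[OF fun_linear_word_act] by metis
      then show ?thesis using longest_elt_involution[OF J_subset v] by metis
    qed
    also have "\<dots> \<longleftrightarrow> longest_elt G J (T m) = - m" by (metis add.commute eq_neg_iff_add_eq_0)
    also have "\<dots> \<longleftrightarrow> (\<forall>j\<in>idx G. m (coroot G (twist j)) = m (coroot G j))"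
    proof
      assume "longest_elt G J (T m) = - m"
      then show "\<forall>j\<in>idx G. m (coroot G (twist j)) = m (coroot G j)" using twist_coroot[OF _ m] by simp
    next
      assume *: "\<forall>j\<in>idx G. m (coroot G (twist j)) = m (coroot G j)"
      show "longest_elt G J (T m) = - m"
        by (rule weight_eq_on_permuted_coroots[OF twist_permutes])
          (use * twist_coroot[OF _ m] LTm weight_space_uminus[OF m] in auto)
    qed
    finally show ?thesis .
  qed
  then show ?thesis using dominant_weights_weight_space by (auto simp: PZB_def)
qed

end

section \<open>Automorphisms of Dynkin diagrams\<close>

definition diagram_aut :: "dynkin \<Rightarrow> (nat \<Rightarrow> nat) \<Rightarrow> bool" where
  "diagram_aut X d \<longleftrightarrow> d permutes {1..dynkin_rank X} \<and>
     (\<forall>i\<in>{1..dynkin_rank X}. \<forall>j\<in>{1..dynkin_rank X}. cartan_matrix X (d i) (d j) = cartan_matrix X i j)"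

lemma diagram_autD:
  assumes "diagram_aut X d"
  shows "d permutes {1..dynkin_rank X}" and "inj d"
    and "i \<in> {1..dynkin_rank X} \<Longrightarrow> d i \<in> {1..dynkin_rank X}"
    and "i \<in> {1..dynkin_rank X} \<Longrightarrow> j \<in> {1..dynkin_rank X} \<Longrightarrow> cartan_matrix X (d i) (d j) = cartan_matrix X i j"
  using assms permutes_inj permutes_in_image[of d] unfolding diagram_aut_def by blast+

text \<open>An injective map taking neighbours on a path to neighbours cannot turn back, so the
  first step fixes its direction and the range fixes its endpoints.\<close>

lemma chain_aut:
  fixes d :: "nat \<Rightarrow> nat"
  assumes inj: "inj d" and range: "\<And>i. i \<in> {1..n} \<Longrightarrow> d i \<in> {1..n}"
    and step: "\<And>i. i \<in> {1..<n} \<Longrightarrow> d (Suc i) = Suc (d i) \<or> d i = Suc (d (Suc i))"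
  shows "(\<forall>i\<in>{1..n}. d i = i) \<or> (\<forall>i\<in>{1..n}. d i = n + 1 - i)"
proof (cases "n \<le> 1")
  case True
  then show ?thesis using range by fastforce
next
  case False
  consider "d 2 = Suc (d 1)" | "d 1 = Suc (d 2)" using step[of 1] False by (auto simp: numeral_2_eq_2)
  then show ?thesis
  proof cases
    case 1
    have *: "d i = d 1 + i - 1 \<and> d (Suc i) = d 1 + i" if "1 \<le> i" "i < n" for i
      using that
    proof (induction i rule: nat_induct_at_least)
      case base
      then show ?case using 1 by (simp add: numeral_2_eq_2)
    next
      case (Suc i)
      then have IH: "d i = d 1 + i - 1" "d (Suc i) = d 1 + i" by auto
      \<comment> \<open>Of the two neighbours of the last image, one is already the image of
        \<open>i\<close>.\<close>
      have "d (Suc (Suc i)) \<noteq> d i" by (simp add: inj_eq[OF inj])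
      then show ?case using step[of "Suc i"] Suc.prems IH by auto
    qed
    have "d n = d 1 + n - 1" using *[of "n - 1"] False by auto
    then have "d 1 = 1" using range[of 1] range[of n] False by auto
    have "d i = i" if "i \<in> {1..n}" for i
      using *[of i] \<open>d n = d 1 + n - 1\<close> \<open>d 1 = 1\<close> that by (cases "i = n") auto
    then show ?thesis by blast
  next
    case 2
    have *: "d i + i = d 1 + 1 \<and> d (Suc i) + i = d 1" if "1 \<le> i" "i < n" for i
      using that
    proof (induction i rule: nat_induct_at_least)
      case base
      then show ?case using 2 by (simp add: numeral_2_eq_2)
    next
      case (Suc i)
      then have IH: "d i + i = d 1 + 1" "d (Suc i) + i = d 1" by auto
      have "d (Suc (Suc i)) \<noteq> d i" by (simp add: inj_eq[OF inj])
      then show ?case using step[of "Suc i"] Suc.prems IH by auto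
    qed
    have "1 \<le> n - 1" "n - 1 < n" "Suc (n - 1) = n" using False by auto
    then have "d n + (n - 1) = d 1" using *[of "n - 1"] by simp
    then have dn: "d n + n = d 1 + 1" using False by simp
    then have "d 1 = n" using range[of 1] range[of n] False by auto
    have "d i = n + 1 - i" if "i \<in> {1..n}" for i
      using *[of i] dn \<open>d 1 = n\<close> that by (cases "i = n") auto
    then show ?thesis by blast
  qed
qed

text \<open>Only the zero pattern of the matrix enters, so one argument serves types A, B and C; in
  the last two the reversal is then excluded by the asymmetric entry.\<close>

lemma linear_diagram_aut:
  assumes aut: "diagram_aut X d"
    and adj: "\<And>i j. i \<noteq> j \<Longrightarrow> cartan_matrix X i j \<noteq> 0 \<longleftrightarrow> j = Suc i \<or> i = Suc j"
  shows "(\<forall>i\<in>{1..dynkin_rank X}. d i = i) \<or> (\<forall>i\<in>{1..dynkin_rank X}. d i = dynkin_rank X + 1 - i)"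
proof (rule chain_aut)
  show "inj d" using diagram_autD(2)[OF aut] .
  show "d i \<in> {1..dynkin_rank X}" if "i \<in> {1..dynkin_rank X}" for i using diagram_autD(3)[OF aut that] .
  fix i assume i: "i \<in> {1..<dynkin_rank X}"
  then have "cartan_matrix X (d i) (d (Suc i)) \<noteq> 0"
    using diagram_autD(4)[OF aut, of i "Suc i"] adj[of i "Suc i"] by simp
  moreover have "d i \<noteq> d (Suc i)" by (simp_all add: inj_eq[OF diagram_autD(2)[OF aut]])
  ultimately show "d (Suc i) = Suc (d i) \<or> d i = Suc (d (Suc i))" using adj by blast
qed

lemma diagram_aut_A:
  "diagram_aut (TypeA n) d \<Longrightarrow> (\<forall>i\<in>{1..n}. d i = i) \<or> (\<forall>i\<in>{1..n}. d i = n + 1 - i)"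
  using linear_diagram_aut[of "TypeA n" d] by (auto simp: linked_def)

text \<open>The reversal would move the entry -2 at (n-1, n) to the position (2, 1), where the entry
  is -1.\<close>

lemma diagram_aut_B:
  assumes aut: "diagram_aut (TypeB n) d" and n: "n \<ge> 2"
  shows "\<forall>i\<in>{1..n}. d i = i"
proof (rule ccontr)
  assume no: "\<not> ?thesis"
  have "cartan_matrix (TypeB n) i j \<noteq> 0 \<longleftrightarrow> j = Suc i \<or> i = Suc j" if "i \<noteq> j" for i j
    using that n by (auto simp: linked_def)
  from linear_diagram_aut[OF aut this] no have "\<forall>i\<in>{1..n}. d i = n + 1 - i"
    unfolding dynkin_rank.simps by blast
  moreover have "n - 1 \<in> {1..n}" "n \<in> {1..n}" using n by auto
  ultimately show False using diagram_autD(4)[OF aut, of "n - 1" n] n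
    by (auto simp: linked_def split: if_splits)
qed

lemma diagram_aut_C:
  assumes aut: "diagram_aut (TypeC n) d" and n: "n \<ge> 2"
  shows "\<forall>i\<in>{1..n}. d i = i"
proof (rule ccontr)
  assume no: "\<not> ?thesis"
  have "cartan_matrix (TypeC n) i j \<noteq> 0 \<longleftrightarrow> j = Suc i \<or> i = Suc j" if "i \<noteq> j" for i j
    using that n by (auto simp: linked_def)
  from linear_diagram_aut[OF aut this] no have "\<forall>i\<in>{1..n}. d i = n + 1 - i"
    unfolding dynkin_rank.simps by blast
  moreover have "n - 1 \<in> {1..n}" "n \<in> {1..n}" using n by auto
  ultimately show False using diagram_autD(4)[OF aut, of n "n - 1"] n
    by (auto simp: linked_def split: if_splits)
qed

text \<open>The entry -2 occurs at a single position, which pins the two middle nodes; the ends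
  follow by adjacency and injectivity.\<close>

lemma diagram_aut_F4:
  assumes aut: "diagram_aut TypeF4 d"
  shows "\<forall>i\<in>{1..4}. d i = i"
proof -
  have r: "{1..4} = {1, 2, 3, 4 :: nat}" by auto
  have "cartan_matrix TypeF4 (d 2) (d 3) = -2"
    using diagram_autD(4)[OF aut, of 2 3] by simp
  then have "d 2 = 2" "d 3 = 3" by (auto simp: linked_def split: if_splits)
  moreover have "cartan_matrix TypeF4 (d 1) (d 2) = -1" "cartan_matrix TypeF4 (d 4) (d 3) = -1"
    using diagram_autD(4)[OF aut, of 1 2] diagram_autD(4)[OF aut, of 4 3] by (simp_all add: linked_def)
  moreover have "d 1 \<noteq> d 3" "d 4 \<noteq> d 2" by (simp_all add: inj_eq[OF diagram_autD(2)[OF aut]])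
  ultimately show ?thesis unfolding r by (auto simp: linked_def split: if_splits)
qed

lemma diagram_aut_G2:
  assumes aut: "diagram_aut TypeG2 d"
  shows "\<forall>i\<in>{1..2}. d i = i"
proof -
  have "cartan_matrix TypeG2 (d 2) (d 1) = -3"
    using diagram_autD(4)[OF aut, of 2 1] by simp
  then have "d 2 = 2" "d 1 = 1" by (auto simp: linked_def split: if_splits)
  moreover have "{1..2} = {1, 2 :: nat}" by auto
  ultimately show ?thesis by simp
qed

section \<open>Diagram automorphisms in type E\<close>

lemma linked_eq_minus_one: "linked E i j = -1 \<longleftrightarrow> i \<noteq> j \<and> ((i, j) \<in> E \<or> (j, i) \<in> E)"
  by (simp add: linked_def)

text \<open>The entries do not depend on \<open>n\<close>, so these are the neighbours in the
  diagram of E8 for every \<open>n\<close>.\<close>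

lemma cartan_E_adj:
  assumes "cartan_matrix (TypeE n) i j = -1"
  shows "i \<in> {1, 2, 3, 4, 5, 6, 7, 8}"
    and "i = 1 \<Longrightarrow> j = 3" and "i = 2 \<Longrightarrow> j = 4" and "i = 3 \<Longrightarrow> j = 1 \<or> j = 4"
    and "i = 4 \<Longrightarrow> j = 2 \<or> j = 3 \<or> j = 5" and "i = 5 \<Longrightarrow> j = 4 \<or> j = 6"
    and "i = 6 \<Longrightarrow> j = 5 \<or> j = 7" and "i = 7 \<Longrightarrow> j = 6 \<or> j = 8" and "i = 8 \<Longrightarrow> j = 7"
  using assms by (auto simp: linked_eq_minus_one)

lemma cartan_E_branch:
  assumes "cartan_matrix (TypeE n) v a = -1" "cartan_matrix (TypeE n) v b = -1" "cartan_matrix (TypeE n) v c = -1"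
    and "a \<noteq> b" "a \<noteq> c" "b \<noteq> c"
  shows "v = 4"
proof (rule ccontr)
  assume "v \<noteq> 4"
  then have "v = 1 \<or> v = 2 \<or> v = 3 \<or> v = 5 \<or> v = 6 \<or> v = 7 \<or> v = 8"
    using cartan_E_adj(1)[OF assms(1)] by simp
  then show False
    using cartan_E_adj(2-)[OF assms(1)] cartan_E_adj(2-)[OF assms(2)] cartan_E_adj(2-)[OF assms(3)] assms(4-6)
    by (elim disjE) fastforce+
qed

text \<open>Node 4 is the only branch node, and node 2 is its only neighbour of valency one, so both
  are fixed. What remains is whether the arms through 3 and 5 are exchanged, which is possible only
  if they have the same length.\<close>

lemma diagram_aut_E:
  assumes aut: "diagram_aut (TypeE n) d" and n: "n \<in> {6, 7, 8}"
  shows "(\<forall>i\<in>{1..n}. d i = i) \<or>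
    n = 6 \<and> d 1 = 6 \<and> d 2 = 2 \<and> d 3 = 5 \<and> d 4 = 4 \<and> d 5 = 3 \<and> d 6 = 1"
proof -
  let ?M = "cartan_matrix (TypeE n)"
  have keep: "?M (d i) (d j) = -1" if "?M i j = -1" "i \<in> {1..n}" "j \<in> {1..n}" for i j
    using diagram_autD(4)[OF aut] that by simp
  have inj: "d i = d j \<longleftrightarrow> i = j" for i j by (simp_all add: inj_eq[OF diagram_autD(2)[OF aut]])
  have n6: "n \<ge> 6" using n by auto
  have keep': "?M (d i) (d j) = -1" if "?M i j = -1" "1 \<le> i" "1 \<le> j" "i \<le> 6" "j \<le> 6" for i j
    by (rule keep[OF that(1)]) (use that n6 in simp_all)
  have e42: "?M (d 4) (d 2) = -1" by (rule keep') (simp_all add: linked_def)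
  have e43: "?M (d 4) (d 3) = -1" by (rule keep') (simp_all add: linked_def)
  have e45: "?M (d 4) (d 5) = -1" by (rule keep') (simp_all add: linked_def)
  have e31: "?M (d 3) (d 1) = -1" by (rule keep') (simp_all add: linked_def)
  have e56: "?M (d 5) (d 6) = -1" by (rule keep') (simp_all add: linked_def)
  have ne: "d 2 \<noteq> d 3" "d 2 \<noteq> d 5" "d 3 \<noteq> d 5" "d 1 \<noteq> d 4" "d 6 \<noteq> d 4" by (simp_all add: inj)
  have d4: "d 4 = 4" by (rule cartan_E_branch[OF e42 e43 e45 ne(1-3)])
  have nb: "d 2 \<in> {2, 3, 5}" "d 3 \<in> {2, 3, 5}" "d 5 \<in> {2, 3, 5}"
    using cartan_E_adj(5)[OF e42] cartan_E_adj(5)[OF e43] cartan_E_adj(5)[OF e45] d4 by auto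
  have d2: "d 2 = 2"
  proof (rule ccontr)
    assume "d 2 \<noteq> 2"
    then have d2: "d 2 = 3 \<or> d 2 = 5" using nb(1) by auto
    \<comment> \<open>A neighbour other than 4 of the supposed image of node 2: node 1 next to 3,
      node 6 next to 5. Its preimage is a neighbour of 2, hence 4; but 4 is fixed.\<close>
    define v where "v = (if d 2 = 3 then 1 else 6 :: nat)"
    have v: "v \<in> {1..n}" "?M (d 2) v = -1" "v \<noteq> 4" using d2 n6 by (auto simp: v_def linked_def)
    have "v \<in> d ` {1..n}" using permutes_image[OF diagram_autD(1)[OF aut]] v(1) by simp
    then obtain a where a: "a \<in> {1..n}" "d a = v" by blast
    have "?M 2 a = -1" using diagram_autD(4)[OF aut, of 2 a] a v(2) n6 by simp
    then have "a = 4" by (rule cartan_E_adj(3)) simp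
    then show False using a d4 v(3) by simp
  qed
  consider "d 3 = 3" "d 5 = 5" | "d 3 = 5" "d 5 = 3" using nb ne d2 by auto
  then show ?thesis
  proof cases
    case 1
    have d1: "d 1 = 1" using cartan_E_adj(4)[OF e31] 1 ne d4 by simp
    have d6: "d 6 = 6" using cartan_E_adj(6)[OF e56] 1 ne d4 by simp
    have d7: "d 7 = 7" if n7: "n \<ge> 7"
    proof -
      have "?M (d 6) (d 7) = -1" by (rule keep) (use n7 in \<open>simp_all add: linked_def\<close>)
      then show ?thesis using cartan_E_adj(7) d6 inj[of 7 5] 1 by auto
    qed
    have d8: "d 8 = 8" if n8: "n = 8"
    proof -
      have "?M (d 7) (d 8) = -1" by (rule keep) (use n8 in \<open>simp_all add: linked_def\<close>)
      then show ?thesis using cartan_E_adj(8) d7 n8 inj[of 8 6] d6 by auto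
    qed
    have "d i = i" if "i \<in> {1..n}" for i
    proof -
      have "i \<in> {1, 2, 3, 4, 5, 6} \<or> i = 7 \<and> n \<ge> 7 \<or> i = 8 \<and> n = 8" using that n by auto
      then show ?thesis using 1 d1 d2 d4 d6 d7 d8 by auto
    qed
    then show ?thesis by blast
  next
    case 2
    have d1: "d 1 = 6" using cartan_E_adj(6)[OF e31] 2 ne d4 by simp
    have d6: "d 6 = 1" using cartan_E_adj(4)[OF e56] 2 ne d4 by simp
    \<comment> \<open>Node 7 would go to a neighbour of 1, hence to 3, which is already the image of
      5.\<close>
    have "n = 6"
    proof (rule ccontr)
      assume "n \<noteq> 6"
      then have n7: "n \<ge> 7" using n6 by simp
      have "?M (d 6) (d 7) = -1" by (rule keep) (use n7 in \<open>simp_all add: linked_def\<close>)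
      then have "d 7 = 3" using cartan_E_adj(2) d6 by blast
      then show False using 2 inj[of 7 5] by simp
    qed
    then show ?thesis using 2 d1 d2 d4 d6 by blast
  qed
qed

section \<open>Rows of the Cartan matrix and diagram automorphisms in type D\<close>

lemma cartan_D_adj:
  assumes "n \<ge> 4"
  shows "cartan_matrix (TypeD n) i j = -1 \<longleftrightarrow>
    i \<le> n - 2 \<and> j = i + 1 \<or> j \<le> n - 2 \<and> i = j + 1 \<or> i = n - 2 \<and> j = n \<or> i = n \<and> j = n - 2"
  using assms by (auto simp: linked_eq_minus_one)

text \<open>In this shape, a combination of indicator functions of \<open>j\<close>, each term of a
  sum over \<open>j\<close> collapses separately. The term at j = i - 1 is correct also for i = 1,
  because the link set contains (0, 1).\<close>

lemma cartan_D_eq: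
  assumes "n \<ge> 4" "i \<ge> 1"
  shows "cartan_matrix (TypeD n) i j = (if j = i then 2 else 0)
    - (if j = i + 1 then if i \<le> n - 2 then 1 else 0 else 0) - (if j = i - 1 then if i \<le> n - 1 then 1 else 0 else 0)
    - (if j = n then if i = n - 2 then 1 else 0 else 0) - (if j = n - 2 then if i = n then 1 else 0 else 0)"
proof -
  obtain N k where "n = N + 4" "i = Suc k" using assms by (metis Suc_le_D add.commute le_add_diff_inverse One_nat_def)
  moreover have "cartan_matrix (TypeD n) i j = (if i = j then 2 else if
     i \<le> n - 2 \<and> j = i + 1 \<or> j \<le> n - 2 \<and> i = j + 1 \<or> i = n - 2 \<and> j = n \<or> i = n \<and> j = n - 2 then -1 else 0)"
     using cartan_D_adj[OF assms(1), of i j] by (auto simp: linked_def)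
  ultimately show ?thesis by (simp; arith)
qed

lemma mult_if: "(t::int) * (if P then a else b) = (if P then t * a else t * b)"
  by simp

text \<open>The hypothesis \<open>f r = 0\<close> lets the first node r + 1 be treated like an inner
  one, although its left neighbour \<open>r\<close> lies outside the range of summation.\<close>

lemma cartan_D_sum:
  fixes f :: "nat \<Rightarrow> int"
  assumes n: "n \<ge> 4" "r + 2 \<le> n" and i: "i \<in> {r+1..n}" and f: "f r = 0"
  shows "(\<Sum>j\<in>{r+1..n}. f j * cartan_matrix (TypeD n) i j) =
    f i * 2 - (if i \<le> n - 2 then f (i + 1) else 0) - (if i \<le> n - 1 then f (i - 1) else 0)
    - (if i = n - 2 then f n else 0) - (if i = n then f (n - 2) else 0)"
proof -
  have i1: "i \<ge> 1" using i by simp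
  have delta: "(\<Sum>j\<in>{r+1..n}. if j = k then if P then f j else 0 else 0) = (if P then f k else 0)"
    if "P \<Longrightarrow> k \<in> {r..n}" for k P
    using that f by (cases "k = r") auto
  have "(\<Sum>j\<in>{r+1..n}. f j * cartan_matrix (TypeD n) i j) =
    (\<Sum>j\<in>{r+1..n}. (if j = i then f j * 2 else 0) - (if j = i + 1 then if i \<le> n - 2 then f j else 0 else 0)
      - (if j = i - 1 then if i \<le> n - 1 then f j else 0 else 0) - (if j = n then if i = n - 2 then f j else 0 else 0)
      - (if j = n - 2 then if i = n then f j else 0 else 0))"
    unfolding cartan_D_eq[OF n(1) i1] right_diff_distrib mult_if mult_1_right mult_zero_right ..
  also have "\<dots> = (\<Sum>j\<in>{r+1..n}. if j = i then f j * 2 else 0)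
    - (if i \<le> n - 2 then f (i + 1) else 0) - (if i \<le> n - 1 then f (i - 1) else 0)
    - (if i = n - 2 then f n else 0) - (if i = n then f (n - 2) else 0)"
    unfolding sum_subtractf using n i by (subst delta, force)+ (rule refl)
  also have "(\<Sum>j\<in>{r+1..n}. if j = i then f j * 2 else 0) = f i * 2" using i by simp
  finally show ?thesis .
qed

text \<open>For n - r even the weights modulo roots of the tail form a group of exponent 2. This
  character takes different values on the last two fundamental weights. The parity of n - r enters
  in rows n - 1 and n.\<close>

lemma cartan_D_sum_even:
  assumes n: "n \<ge> 4" "r + 2 \<le> n"  and i: "i \<in> {r+1..n}" and ev: "even (n - r)"
  shows "2 dvd (\<Sum>j\<in>{r+1..n}. (if j = n then 0 else int j - int r) * cartan_matrix (TypeD n) i j)"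
proof -
  obtain m where "n - r = 2 * m" using ev by (rule evenE)
  then have m: "int n = int r + 2 * int m" using n by simp
  consider "i + 3 \<le> n" | "i = n - 2" | "i = n - 1" | "i = n" using i by fastforce
  then show ?thesis
  proof cases
    case 1
    then show ?thesis using n i by (subst cartan_D_sum[OF n i]) (simp_all add: of_nat_diff, arith)
  next
    case 2
    then have "(\<Sum>j\<in>{r+1..n}. (if j = n then 0 else int j - int r) * cartan_matrix (TypeD n) i j) = 0"
      using n by (subst cartan_D_sum[OF n i]) (simp_all add: of_nat_diff, arith)
    then show ?thesis by simp
  next
    case 3
    then have "(\<Sum>j\<in>{r+1..n}. (if j = n then 0 else int j - int r) * cartan_matrix (TypeD n) i j) = 2 * int m"
      using n m by (subst cartan_D_sum[OF n i]) (simp_all add: of_nat_diff, arith)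
    then show ?thesis by simp
  next
    case 4
    then have "(\<Sum>j\<in>{r+1..n}. (if j = n then 0 else int j - int r) * cartan_matrix (TypeD n) i j) = 2 * (1 - int m)"
      using n m by (subst cartan_D_sum[OF n i]) (simp_all add: of_nat_diff, arith)
    then show ?thesis by simp
  qed
qed

text \<open>For n - r odd the quotient is cyclic of order 4 and generated by a spin weight. The last
  two nodes get the opposite generators 1 and -1. Twice a generator is not 0 modulo 4, so the last
  node cannot be its own opposite.\<close>

lemma cartan_D_sum_odd:
  assumes n: "n \<ge> 4" "r + 2 \<le> n"  and i: "i \<in> {r+1..n}" and od: "odd (n - r)"
  shows "4 dvd (\<Sum>j\<in>{r+1..n}. (if j = n then -1 else if j = n - 1 then 1 else 2 * (int j - int r)) * cartan_matrix (TypeD n) i j)"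
    (is "4 dvd ?S")
proof -
  obtain m where "n - r = 2 * m + 1" using od by (rule oddE)
  then have m: "int n = int r + 2 * int m + 1" using n by simp
  consider "i + 3 \<le> n" | "i = n - 2" | "i = n - 1" | "i = n" using i by fastforce
  then have "?S = 0 \<or> ?S = 4 * int m \<or> ?S = 4 * (1 - int m) \<or> ?S = - 4 * int m"
  proof cases
    case 1
    then have "?S = 0" using n i by (subst cartan_D_sum[OF n i]) (simp_all add: of_nat_diff, arith)
    then show ?thesis by simp
  next
    case 2
    then have "?S = 4 * int m"
      using n m by (subst cartan_D_sum[OF n i]) (simp_all add: of_nat_diff, arith)
    then show ?thesis by simp
  next
    case 3
    then have "?S = 4 * (1 - int m)"
      using n m by (subst cartan_D_sum[OF n i]) (simp_all add: of_nat_diff, arith)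
    then show ?thesis by simp
  next
    case 4
    then have "?S = - 4 * int m"
      using n m by (subst cartan_D_sum[OF n i]) (simp_all add: of_nat_diff, arith)
    then show ?thesis by simp
  qed
  then show ?thesis by (elim disjE) (simp_all only: dvd_0_right dvd_triv_left minus_mult_left[symmetric] dvd_minus_iff)
qed

text \<open>Node n - 2 is the only one with three neighbours. For n \<ge> 5, n - 3 is the only one
  of these with a further neighbour, and the chain below it follows. In D4 the outer nodes may be
  permuted by triality, which fixing node 1 excludes.\<close>

lemma diagram_aut_D:
  assumes aut: "diagram_aut (TypeD n) d" and n: "n \<ge> 4" and fixed: "n \<ge> 5 \<or> d 1 = 1"
  shows "\<forall>i\<in>{1..n - 2}. d i = i"
    and "d n = n \<and> d (n - 1) = n - 1 \<or> d n = n - 1 \<and> d (n - 1) = n"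
proof -
  let ?M = "cartan_matrix (TypeD n)"
  have keep: "?M (d i) (d j) = -1" if "?M i j = -1" "i \<in> {1..n}" "j \<in> {1..n}" for i j
    using diagram_autD(4)[OF aut] that by simp
  have inj: "d i = d j \<longleftrightarrow> i = j" for i j by (simp_all add: inj_eq[OF diagram_autD(2)[OF aut]])
  have range: "1 \<le> d i" "d i \<le> n" if "i \<in> {1..n}" for i using diagram_autD(3)[OF aut] that by auto
  have e1: "?M (d (n - 2)) (d (n - 3)) = -1"
    by (rule keep, unfold cartan_D_adj[OF n], use n in auto)
  have e2: "?M (d (n - 2)) (d (n - 1)) = -1"
    by (rule keep, unfold cartan_D_adj[OF n], use n in auto)
  have e3: "?M (d (n - 2)) (d n) = -1"
    by (rule keep, unfold cartan_D_adj[OF n], use n in auto)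
  have ne: "d (n - 3) \<noteq> d (n - 1)" "d (n - 3) \<noteq> d n" "d (n - 1) \<noteq> d n" using n by (auto simp: inj)
  have dn2: "d (n - 2) = n - 2"
    using e1 e2 e3 ne n unfolding cartan_D_adj[OF n] by (elim disjE conjE) linarith+
  have dn3: "d (n - 3) = n - 3"
  proof (cases "n \<ge> 5")
    case True
    have "?M (d (n - 3)) (d (n - 4)) = -1"
      by (rule keep, unfold cartan_D_adj[OF n], use True in auto)
    moreover have "d (n - 4) \<noteq> d (n - 2)" using True by (auto simp: inj)
    ultimately show ?thesis using e1 n unfolding cartan_D_adj[OF n] dn2 by (elim disjE conjE) linarith+
  next
    case False
    then have "n = 4" using n by simp
    then show ?thesis using fixed by simp
  qed
  \<comment> \<open>Descent along the chain: the next image is a neighbour of a fixed node and, by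
    injectivity, not the fixed node before it. Two earlier values are needed, hence the strong
    induction.\<close>
  have fix_k: "d (n - 2 - k) = n - 2 - k" if "k \<le> n - 3" for k
    using that
  proof (induction k rule: less_induct)
    case (less k)
    consider "k = 0" | "k = 1" | l where "k = Suc (Suc l)" by (metis One_nat_def not0_implies_Suc)
    then show ?case
    proof cases
      case 3
      define w where "w = n - 5 - l"
      have w: "n - 2 - l = w + 3" "n - 2 - Suc l = w + 2" "n - 2 - k = w + 1" "w + 3 \<le> n - 2"
        using 3 less.prems n by (simp_all add: w_def)
      have IH: "d (w + 2) = w + 2" "d (w + 3) = w + 3"
        using less.IH[of "Suc l"] less.IH[of l] 3 less.prems w by simp_all
      have "?M (d (w + 2)) (d (w + 1)) = -1"
        by (rule keep, unfold cartan_D_adj[OF n]) (use w(4) in simp_all)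
      moreover have "d (w + 1) \<noteq> d (w + 3)" by (simp add: inj)
      ultimately have "d (w + 1) = w + 1"
        using w(4) unfolding cartan_D_adj[OF n] IH by (elim disjE conjE) simp_all
      then show ?thesis using w(3) by simp
    qed (use dn2 dn3 in auto)
  qed
  show low: "\<forall>i\<in>{1..n - 2}. d i = i"
  proof
    fix i assume "i \<in> {1..n - 2}"
    then have "n - 2 - i \<le> n - 3" "n - 2 - (n - 2 - i) = i" by auto
    then show "d i = i" using fix_k[of "n - 2 - i"] by simp
  qed
  have "d i \<in> {n - 1, n}" if "i \<in> {n - 1, n}" for i
  proof (rule ccontr)
    assume "d i \<notin> {n - 1, n}"
    moreover have "i \<in> {1..n}" using that n by auto
    ultimately have "d i \<in> {1..n - 2}" using range[of i] by auto
    then have "d (d i) = d i" using low by blast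
    then have "d i = i" by (simp add: inj)
    then show False using \<open>d i \<notin> {n - 1, n}\<close> that by simp
  qed
  then show "d n = n \<and> d (n - 1) = n - 1 \<or> d n = n - 1 \<and> d (n - 1) = n" using ne(3) by force
qed

section \<open>The opposition involution by type\<close>

context semisimple
begin

lemma has_type_cartan:
  "has_type G X \<Longrightarrow> i \<in> idx G \<Longrightarrow> j \<in> idx G \<Longrightarrow> sroot G i (coroot G j) = of_int (cartan_matrix X i j)"
  by (simp add: has_type_def)

lemma diagram_autI:
  assumes X: "has_type G X" and d: "d permutes idx G"
    and "\<And>i j. i \<in> idx G \<Longrightarrow> j \<in> idx G \<Longrightarrow> sroot G (d i) (coroot G (d j)) = sroot G i (coroot G j)"
  shows "diagram_aut X d"
proof -
  have idx: "idx G = {1..dynkin_rank X}" using X by (simp add: has_type_def)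
  have "cartan_matrix X (d i) (d j) = cartan_matrix X i j" if "i \<in> idx G" "j \<in> idx G" for i j
  proof -
    have "complex_of_int (cartan_matrix X (d i) (d j)) = of_int (cartan_matrix X i j)"
      using assms(3)[OF that] has_type_cartan[OF X] that permutes_in_image[OF d] by metis
    then show ?thesis by simp
  qed
  then show ?thesis using d by (simp add: diagram_aut_def idx)
qed

lemma opposition_diagram_aut: "has_type G X \<Longrightarrow> diagram_aut X (opposition (idx G))"
  by (rule diagram_autI) (auto intro: opposition_permutes opposition_cartan)

text \<open>Reflections in the other nodes of \<open>K\<close> fix the simple root of
  \<open>j\<close> and its own reflection negates it, so every word gives plus or minus this root.
  Positivity decides the sign.\<close>

lemma opposition_isolated:
  assumes K: "K \<subseteq> idx G" and j: "j \<in> K"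
    and isolated: "\<And>k. k \<in> K \<Longrightarrow> k \<noteq> j \<Longrightarrow> sroot G j (coroot G k) = 0"
  shows "opposition K j = j"
proof -
  have jI: "j \<in> idx G" using j K by blast
  have pm: "word_act G ws (sroot G j) = sroot G j \<or> word_act G ws (sroot G j) = - sroot G j"
    if "set ws \<subseteq> K" for ws
    using that
  proof (induction ws)
    case (Cons k ws)
    have "simple_refl G k (sroot G j) = sroot G j \<or> simple_refl G k (sroot G j) = - sroot G j"
      using isolated[of k] Cons.prems simple_refl_sroot[OF jI] by (cases "k = j") (auto simp: simple_refl_def)
    moreover have "simple_refl G k (- sroot G j) = - simple_refl G k (sroot G j)"
      by (rule fun_linear_uminus[OF fun_linear_simple_refl])
    moreover have "word_act G (k # ws) (sroot G j) = simple_refl G k (word_act G ws (sroot G j))" by simp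
    ultimately show ?case using Cons by (metis minus_minus list.set_intros(2) subset_iff)
  qed simp
  obtain ws where ws: "set ws \<subseteq> K" "\<And>m. m \<in> weight_space G \<Longrightarrow> longest_elt G K m = word_act G ws m"
    using longest_elt_word[OF K] by metis
  have oj: "opposition K j \<in> idx G" using permutes_in_image[OF opposition_permutes[OF K]] j K by blast
  have "sroot G (opposition K j) = - word_act G ws (sroot G j)"
    using longest_elt_sroot[OF K j] ws(2)[OF sroot_weight_space[OF jI]] by (metis minus_minus)
  then have "sroot G (opposition K j) = sroot G j \<or> sroot G (opposition K j) = - sroot G j"
    using pm[OF ws(1)] by (metis minus_minus)
  moreover have "sroot G (opposition K j) \<noteq> - sroot G j"
    using pos_sroot[OF oj] pos_sroot[OF jI] pos_uminus_pos[of "sroot G j"]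
      signed_roots_nonzero[OF sroot_signed_roots[OF jI]] by metis
  ultimately show ?thesis using inj_sroot oj jI by (meson inj_onD)
qed

section \<open>Oppositions computed from characters of weights modulo roots\<close>

lemma cartan_A_sum:
  fixes f :: "nat \<Rightarrow> int"
  assumes "i \<in> {1..n}"
  shows "(\<Sum>j\<in>{1..n}. f j * cartan_matrix (TypeA n) i j) =
    2 * f i - (if i < n then f (i + 1) else 0) - (if 1 < i then f (i - 1) else 0)"
proof -
  have "(\<Sum>j\<in>{1..n}. f j * cartan_matrix (TypeA n) i j) =
    (\<Sum>j\<in>{1..n}. (if j = i then 2 * f j else 0) - (if j = i + 1 then f j else 0) - (if j = i - 1 then f j else 0))"
    using assms by (intro sum.cong) (auto simp: linked_def)
  also have "\<dots> = 2 * f i - (if i < n then f (i + 1) else 0) - (if 1 < i then f (i - 1) else 0)"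
    using assms by (auto simp: sum_subtractf)
  finally show ?thesis .
qed

text \<open>The character takes the value j modulo n + 1 at node j. The row combinations vanish
  except in the last row, which gives n + 1. A trivial opposition would make n + 1 divide 2.\<close>

lemma opposition_A:
  assumes X: "has_type G (TypeA n)" and n: "n \<ge> 2" and i: "i \<in> {1..n}"
  shows "opposition (idx G) i = n + 1 - i"
proof -
  have idx: "idx G = {1..n}" using X by (simp add: has_type_def)
  have "int (n + 1) dvd int 1 + int (opposition (idx G) 1)"
  proof (rule opposition_character[OF order_refl])
    show "sroot G i (coroot G j) = of_int (cartan_matrix (TypeA n) i j)" if "i \<in> idx G" "j \<in> idx G" for i j
      using has_type_cartan[OF X that] .
    show "int (n + 1) dvd (\<Sum>j\<in>idx G. int j * cartan_matrix (TypeA n) i j)" if "i \<in> idx G" for i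
    proof -
      have "i \<in> {1..n}" using that idx by simp
      then have "(\<Sum>j\<in>idx G. int j * cartan_matrix (TypeA n) i j) = (if i = n then int (n + 1) else 0)"
        unfolding idx by (subst cartan_A_sum) (auto simp: of_nat_diff)
      then show ?thesis by simp
    qed
    show "1 \<in> idx G" using idx n by simp
  qed
  then have "opposition (idx G) 1 \<noteq> 1"
    using n by (auto dest!: zdvd_imp_le)
  then show ?thesis
    using diagram_aut_A[OF opposition_diagram_aut[OF X]] n i by auto
qed

lemma opposition_E6:
  assumes X: "has_type G (TypeE 6)"
  shows "opposition (idx G) 1 = 6"
proof -
  have idx: "idx G = {1, 2, 3, 4, 5, 6}" using X by (auto simp: has_type_def)
  \<comment> \<open>A character of order 3, with values 1, 0, 2, 0, 1, 2 at the nodes 1 to 6.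
    Opposite nodes need values with sum 0 modulo 3, so node 1 is not its own opposite.\<close>
  define k :: "nat \<Rightarrow> int" where "k j = (if j = 1 \<or> j = 5 then 1 else if j = 3 \<or> j = 6 then 2 else 0)" for j
  have "3 dvd k 1 + k (opposition (idx G) 1)"
  proof (rule opposition_character[OF order_refl])
    show "sroot G i (coroot G j) = of_int (cartan_matrix (TypeE 6) i j)" if "i \<in> idx G" "j \<in> idx G" for i j
      using has_type_cartan[OF X that] .
    show "3 dvd (\<Sum>j\<in>idx G. k j * cartan_matrix (TypeE 6) i j)" if "i \<in> idx G" for i
      using that unfolding idx by (auto simp: k_def linked_def)
    show "1 \<in> idx G" using idx by simp
  qed
  then have "opposition (idx G) 1 \<noteq> 1" by (auto simp: k_def)
  then show ?thesis
    using diagram_aut_E[OF opposition_diagram_aut[OF X]] by auto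
qed

text \<open>Stated for a tail of the diagram: r = 0 is the whole of D_n, and for r \<ge> 1 the tail
  is \<open>pi_Theta\<close> in (DI, case 1) and DII. The image of the last node is all that is
  needed, since diagram automorphisms leave only its exchange with n - 1 open.\<close>

lemma opposition_D:
  assumes X: "has_type G (TypeD n)" and r: "r + 2 \<le> n"
  shows "even (n - r) \<Longrightarrow> opposition {r+1..n} n \<noteq> n - 1"
    and "odd (n - r) \<Longrightarrow> opposition {r+1..n} n \<noteq> n"
proof -
  have idx: "idx G = {1..n}" and n: "n \<ge> 4" using X by (auto simp: has_type_def)
  have sub: "{r+1..n} \<subseteq> idx G" using idx by auto
  have c: "sroot G i (coroot G j) = of_int (cartan_matrix (TypeD n) i j)"
    if "i \<in> {r+1..n}" "j \<in> {r+1..n}" for i j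
    using has_type_cartan[OF X] that sub by blast
  have nin: "n \<in> {r+1..n}" using r by auto
  show "opposition {r+1..n} n \<noteq> n - 1" if ev: "even (n - r)"
  proof
    assume opp: "opposition {r+1..n} n = n - 1"
    define k :: "nat \<Rightarrow> int" where "k j = (if j = n then 0 else int j - int r)" for j
    have char: "2 dvd (\<Sum>j\<in>{r+1..n}. k j * cartan_matrix (TypeD n) i j)" if "i \<in> {r+1..n}" for i
      unfolding k_def by (rule cartan_D_sum_even[OF n r that ev])
    have "2 dvd k n + k (opposition {r+1..n} n)"
      by (rule opposition_character[OF sub c char nin])
    moreover have "n - 1 \<noteq> n" using r by simp
    ultimately have "2 dvd int (n - 1) - int r" unfolding opp k_def by simp
    then show False using ev r by (auto simp: of_nat_diff even_diff_nat)
  qed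
  show "opposition {r+1..n} n \<noteq> n" if od: "odd (n - r)"
  proof
    assume opp: "opposition {r+1..n} n = n"
    define k :: "nat \<Rightarrow> int" where
      "k j = (if j = n then -1 else if j = n - 1 then 1 else 2 * (int j - int r))" for j
    have char: "4 dvd (\<Sum>j\<in>{r+1..n}. k j * cartan_matrix (TypeD n) i j)" if "i \<in> {r+1..n}" for i
      unfolding k_def by (rule cartan_D_sum_odd[OF n r that od])
    have "4 dvd k n + k (opposition {r+1..n} n)"
      by (rule opposition_character[OF sub c char nin])
    then show False using opp by (simp add: k_def)
  qed
qed

text \<open>Triality leaves too many diagram automorphisms, but the two characters of order 2
  together take different values at all four nodes, and the opposition preserves both.\<close>

lemma opposition_D4:
  assumes X: "has_type G (TypeD 4)" and i: "i \<in> {1..4}"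
  shows "opposition (idx G) i = i"
proof -
  have idx: "idx G = {1, 2, 3, 4}" using X by (auto simp: has_type_def)
  have char: "2 dvd k i + k (opposition (idx G) i)"
    if "\<And>i. i \<in> idx G \<Longrightarrow> 2 dvd (\<Sum>j\<in>idx G. k j * cartan_matrix (TypeD 4) i j)" for k
  proof (rule opposition_character[OF order_refl])
    show "sroot G a (coroot G b) = of_int (cartan_matrix (TypeD 4) a b)" if "a \<in> idx G" "b \<in> idx G" for a b
      using has_type_cartan[OF X that] .
    show "i \<in> idx G" using i X by (simp add: has_type_def)
  qed (rule that)
  let ?k = "\<lambda>j. if j = 1 \<or> j = 3 then 1 else 0 :: int" and ?l = "\<lambda>j. if j = 1 \<or> j = 4 then 1 else 0 :: int"
  have "\<forall>i\<in>idx G. 2 dvd (\<Sum>j\<in>idx G. ?k j * cartan_matrix (TypeD 4) i j)"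
    unfolding idx by (simp add: linked_def)
  then have k: "2 dvd ?k i + ?k (opposition (idx G) i)" by (intro char[of ?k]) blast
  have "\<forall>i\<in>idx G. 2 dvd (\<Sum>j\<in>idx G. ?l j * cartan_matrix (TypeD 4) i j)"
    unfolding idx by (simp add: linked_def)
  then have l: "2 dvd ?l i + ?l (opposition (idx G) i)" by (intro char[of ?l]) blast
  have iI: "i \<in> idx G" using i X by (simp add: has_type_def)
  then have "opposition (idx G) i \<in> idx G"
    using permutes_in_image[OF opposition_permutes[OF order_refl]] by blast
  then have "opposition (idx G) i = 1 \<or> opposition (idx G) i = 2 \<or> opposition (idx G) i = 3 \<or> opposition (idx G) i = 4"
    by (simp add: idx)
  moreover have "i = 1 \<or> i = 2 \<or> i = 3 \<or> i = 4" using iI by (simp add: idx)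
  ultimately show ?thesis using k l by (elim disjE) simp_all
qed

lemma opposition_D_even:
  assumes X: "has_type G (TypeD n)" and "even n" and i: "i \<in> {1..n}"
  shows "opposition (idx G) i = i"
proof (cases "n = 4")
  case True
  then show ?thesis using opposition_D4 X i by blast
next
  case False
  have idx: "idx G = {1..n}" and n: "n \<ge> 4" using X by (auto simp: has_type_def)
  then have n5: "n \<ge> 5" using False by simp
  note D = diagram_aut_D[OF opposition_diagram_aut[OF X] n disjI1[OF n5]]
  have "opposition (idx G) n \<noteq> n - 1"
    using opposition_D(1)[OF X, of 0] n \<open>even n\<close> idx by simp
  then have "opposition (idx G) n = n" "opposition (idx G) (n - 1) = n - 1" using D(2) by auto
  moreover have "i \<in> {1..n - 2} \<or> i = n - 1 \<or> i = n" using i by auto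
  ultimately show ?thesis using D(1) by auto
qed

lemma opposition_D_odd:
  assumes X: "has_type G (TypeD n)" and "odd n" and i: "i \<in> {1..n}"
  shows "opposition (idx G) i = transpose (n - 1) n i"
proof -
  have idx: "idx G = {1..n}" and n: "n \<ge> 4" using X by (auto simp: has_type_def)
  then have n5: "n \<ge> 5" using \<open>odd n\<close> by (cases "n = 4") auto
  note D = diagram_aut_D[OF opposition_diagram_aut[OF X] n disjI1[OF n5]]
  have "opposition (idx G) n \<noteq> n"
    using opposition_D(2)[OF X, of 0] n \<open>odd n\<close> idx by simp
  then have "opposition (idx G) n = n - 1" "opposition (idx G) (n - 1) = n" using D(2) by auto
  moreover have "i \<in> {1..n - 2} \<or> i = n - 1 \<or> i = n" using i by auto
  moreover have "transpose (n - 1) n i = i" if "i \<in> {1..n - 2}" using that by (auto simp: transpose_def)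
  ultimately show ?thesis using D(1) by auto
qed

lemma D_weights_eq:
  assumes idx: "idx G = {1..n}" and n: "n \<ge> 2"
  shows "D_weights G n = {m \<in> dominant_weights G. m (coroot G (n - 1)) = m (coroot G n)}"
proof
  have split_sum: "(\<Sum>i\<in>{1..n}. g i) = (\<Sum>i\<in>{1..n - 2}. g i) + g (n - 1) + g n" for g :: "nat \<Rightarrow> complex"
  proof -
    have "{1..n} = insert n (insert (n - 1) {1..n - 2})" using n by auto
    moreover have "n \<notin> insert (n - 1) {1..n - 2}" "n - 1 \<notin> {1..n - 2}" using n by auto
    ultimately show ?thesis by (simp add: algebra_simps)
  qed
  show "D_weights G n \<subseteq> {m \<in> dominant_weights G. m (coroot G (n - 1)) = m (coroot G n)}"
  proof
    fix m assume "m \<in> D_weights G n"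
    then obtain c :: "nat \<Rightarrow> nat" and e :: nat where m: "m = (\<lambda>x. \<Sum>i\<in>{1..n - 2}. of_nat (c i) * fund_weight G i x) +
      (\<lambda>x. of_nat e * (fund_weight G (n - 1) x + fund_weight G n x))"
      by (auto simp: D_weights_def nat_span_def)
    define c' where "c' i = (if i \<in> {1..n - 2} then c i else e)" for i
    have m': "m = (\<lambda>x. \<Sum>i\<in>{1..n}. of_nat (c' i) * fund_weight G i x)"
      unfolding m split_sum using n by (auto simp: c'_def algebra_simps)
    have "m \<in> weight_space G" unfolding m' using idx fund_weight(1) by (intro weight_space_sum) auto
    moreover have val: "m (coroot G j) = of_nat (c' j)" if j: "j \<in> {1..n}" for j
    proof -
      have "m (coroot G j) = (\<Sum>i\<in>{1..n}. if i = j then of_nat (c' i) else 0)"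
        unfolding m' using idx fund_weight(2) j by (intro sum.cong) auto
      then show ?thesis using j by simp
    qed
    moreover have "c' (n - 1) = c' n" using n by (auto simp: c'_def)
    ultimately show "m \<in> {m \<in> dominant_weights G. m (coroot G (n - 1)) = m (coroot G n)}"
      using n by (simp add: dominant_weights_def idx)
  qed
  show "{m \<in> dominant_weights G. m (coroot G (n - 1)) = m (coroot G n)} \<subseteq> D_weights G n"
  proof
    fix m assume "m \<in> {m \<in> dominant_weights G. m (coroot G (n - 1)) = m (coroot G n)}"
    then have m: "m \<in> weight_space G" "\<forall>i\<in>{1..n}. m (coroot G i) \<in> \<nat>" "m (coroot G (n - 1)) = m (coroot G n)"
      by (auto simp: dominant_weights_def idx)
    then have "\<forall>i\<in>{1..n}. \<exists>k. m (coroot G i) = of_nat k" by (auto simp: Nats_def)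
    then obtain c :: "nat \<Rightarrow> nat" where c: "\<And>i. i \<in> {1..n} \<Longrightarrow> m (coroot G i) = of_nat (c i)" by metis
    have "m x = (\<Sum>i\<in>{1..n - 2}. of_nat (c i) * fund_weight G i x) +
      of_nat (c n) * (fund_weight G (n - 1) x + fund_weight G n x)" for x
    proof -
      have "m x = (\<Sum>i\<in>{1..n}. m (coroot G i) * fund_weight G i x)"
        using fun_cong[OF weight_expansion[OF m(1)], of x] by (simp only: idx)
      also have "\<dots> = (\<Sum>i\<in>{1..n - 2}. m (coroot G i) * fund_weight G i x) +
        m (coroot G n) * fund_weight G (n - 1) x + m (coroot G n) * fund_weight G n x"
        unfolding split_sum m(3) ..
      also have "(\<Sum>i\<in>{1..n - 2}. m (coroot G i) * fund_weight G i x) = (\<Sum>i\<in>{1..n - 2}. of_nat (c i) * fund_weight G i x)"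
        using c n by (intro sum.cong) auto
      finally show ?thesis using c[of n] n by (simp add: algebra_simps)
    qed
    then have "m = (\<lambda>x. \<Sum>i\<in>{1..n - 2}. of_nat (c i) * fund_weight G i x) +
      (\<lambda>x. of_nat (c n) * (fund_weight G (n - 1) x + fund_weight G n x))" by auto
    then show "m \<in> D_weights G n" unfolding D_weights_def nat_span_def by blast
  qed
qed

end

section \<open>Two interchanged simple components\<close>

context split_pair
begin

lemma interchanged_sym: "interchanged G \<theta> A B \<Longrightarrow> interchanged G \<theta> B A"
  unfolding interchanged_def by (metis Int_commute add.commute)

lemma
  assumes AB: "interchanged G \<theta> A B"
  shows component_subspace: "subspace A" and component_ideal: "a \<in> A \<Longrightarrow> brk G x a \<in> A"
    and component_Int: "A \<inter> B = {0}" and component_theta: "a \<in> A \<Longrightarrow> \<theta> a \<in> B"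
  using AB unfolding interchanged_def lie_ideal_def by blast+

lemma components_brk:
  assumes AB: "interchanged G \<theta> A B" and "a \<in> A" "b \<in> B"
  shows "brk G a b = 0"
proof -
  have "brk G a b \<in> B" using component_ideal[OF interchanged_sym[OF AB] \<open>b \<in> B\<close>] .
  moreover have "brk G b a \<in> A" using component_ideal[OF AB \<open>a \<in> A\<close>] .
  then have "brk G a b \<in> A" using component_subspace[OF AB] brk_anticomm[of a b] subspace_neg by metis
  ultimately show ?thesis using component_Int[OF AB] by blast
qed

text \<open>For \<open>k\<close> in the Cartan subalgebra, the brackets of \<open>k\<close> with the
  two components of \<open>h\<close> are opposite and lie in different ideals, so both vanish.
  Self-centralization then puts each component into \<open>csa G\<close>.\<close>

lemma csa_component:
  assumes AB: "interchanged G \<theta> A B" and h: "h \<in> csa G"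
  shows "\<exists>a\<in>csa G \<inter> A. \<exists>b\<in>csa G \<inter> B. h = a + b"
proof -
  note BA = interchanged_sym[OF AB]
  obtain a b where ab: "a \<in> A" "b \<in> B" "h = a + b" using AB unfolding interchanged_def by blast
  have zero: "brk G k a = 0 \<and> brk G k b = 0" if k: "k \<in> csa G" for k
  proof -
    have "brk G k a + brk G k b = 0" using csa_commute[OF k h] by (simp add: ab br.add)
    then have eq: "brk G k a = - brk G k b" by (simp add: eq_neg_iff_add_eq_0)
    have inA: "brk G k a \<in> A" using component_ideal[OF AB ab(1)] .
    have "- brk G k b \<in> B"
      using component_ideal[OF BA ab(2)] by (rule subspace_neg[OF component_subspace[OF BA]])
    then have "brk G k a = 0" using inA component_Int[OF AB] unfolding eq by blast
    then show ?thesis using eq by simp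
  qed
  have "a \<in> csa G" "b \<in> csa G" using zero csa_self_centralizing by blast+
  then show ?thesis using ab by blast
qed

lemma weight_zero_on_components:
  assumes AB: "interchanged G \<theta> A B" and l: "l \<in> weight_space G"
    and "\<And>x. x \<in> csa G \<inter> A \<Longrightarrow> l x = 0" "\<And>x. x \<in> csa G \<inter> B \<Longrightarrow> l x = 0"
  shows "l = 0"
proof (rule weight_eqI[OF l zero_in_weight_space])
  fix h assume "h \<in> csa G"
  then obtain a b where "a \<in> csa G \<inter> A" "b \<in> csa G \<inter> B" "h = a + b" using csa_component[OF AB] by blast
  then show "l h = 0 h" using assms(3)[of a] assms(4)[of b] weight_space_add[OF l] by simp
qed

text \<open>If \<open>gen_e G i\<close> has a nonzero component in \<open>B\<close>, comparing the
  \<open>B\<close>-parts of its eigenvector equation shows that the simple root vanishes on the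
  Cartan part of \<open>A\<close>. Nonzero components on both sides would make the root
  zero.\<close>

lemma gen_e_component:
  assumes AB: "interchanged G \<theta> A B" and i: "i \<in> idx G"
  shows "gen_e G i \<in> A \<or> gen_e G i \<in> B"
proof (rule ccontr)
  assume no: "\<not> ?thesis"
  note BA = interchanged_sym[OF AB]
  have vanish: "sroot G i h = 0" if AB: "interchanged G \<theta> A B" and h: "h \<in> csa G \<inter> A" and "gen_e G i \<notin> A" for A B h
  proof -
    note BA = interchanged_sym[OF AB]
    obtain a b where ab: "a \<in> A" "b \<in> B" "gen_e G i = a + b" using AB unfolding interchanged_def by blast
    have "b \<noteq> 0" using ab \<open>gen_e G i \<notin> A\<close> by auto
    have "brk G h (gen_e G i) = smult G (sroot G i h) (gen_e G i)"
      using gen_e_root[OF i] h by (simp add: root_space_def)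
    then have eq: "brk G h a - smult G (sroot G i h) a = smult G (sroot G i h) b"
      using components_brk[OF AB, of h b] h ab by (simp add: br.add scale_right_distrib)
    moreover have "brk G h a - smult G (sroot G i h) a \<in> A"
      using component_subspace[OF AB] component_ideal[OF AB] ab subspace_diff subspace_scale by blast
    moreover have "smult G (sroot G i h) b \<in> B"
      using component_subspace[OF BA] ab subspace_scale by blast
    ultimately have "smult G (sroot G i h) b \<in> A \<inter> B" by simp
    then show ?thesis using component_Int[OF AB] \<open>b \<noteq> 0\<close> by simp
  qed
  have "sroot G i = 0"
    using vanish[OF AB] vanish[OF BA] no sroot_weight_space[OF i]
    by (intro weight_zero_on_components[OF AB]) auto
  then show False using sroot_coroot[OF i] by simp
qed

lemma gen_e_nonzero: "i \<in> idx G \<Longrightarrow> gen_e G i \<noteq> 0"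
proof
  assume i: "i \<in> idx G" and "gen_e G i = 0"
  then have "coroot G i = 0" by (simp add: coroot_def bl.zero)
  moreover have "sroot G i 0 = 0"
    using weight_space_scale[OF sroot_weight_space[OF i] coroot_csa[OF i], of 0] by simp
  ultimately show False using sroot_coroot[OF i] by simp
qed

abbreviation comp_idx :: "'g set \<Rightarrow> nat set" where
  "comp_idx A \<equiv> {i \<in> idx G. gen_e G i \<in> A}"

lemma coroot_component:
  assumes AB: "interchanged G \<theta> A B" and i: "i \<in> comp_idx A"
  shows "coroot G i \<in> csa G \<inter> A"
proof -
  have "brk G (gen_f G i) (gen_e G i) \<in> A" using component_ideal[OF AB] i by blast
  then have "coroot G i \<in> A"
    using component_subspace[OF AB] subspace_neg brk_anticomm[of "gen_e G i"] by (metis coroot_def)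
  then show ?thesis using coroot_csa i by blast
qed

lemma sroot_component:
  assumes AB: "interchanged G \<theta> A B" and i: "i \<in> comp_idx A" and h: "h \<in> csa G \<inter> B"
  shows "sroot G i h = 0"
proof -
  have "smult G (sroot G i h) (gen_e G i) = brk G h (gen_e G i)"
    using gen_e_root[of i] i h by (simp add: root_space_def)
  also have "\<dots> = 0" using components_brk[OF interchanged_sym[OF AB]] h i by blast
  finally show ?thesis using gen_e_nonzero i by simp
qed

lemma pi_Theta_interchanged:
  assumes AB: "interchanged G \<theta> A B"
  shows "J = {}"
proof (rule ccontr)
  assume "J \<noteq> {}"
  then obtain i where i: "i \<in> J" by blast
  then have e: "\<theta> (gen_e G i) = gen_e G i" and iI: "i \<in> idx G"
    using split J_subset by (auto simp: maximally_split_def)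
  have "gen_e G i \<in> A \<inter> B"
    using gen_e_component[OF AB iI] component_theta[OF AB] component_theta[OF interchanged_sym[OF AB]] e
    by (metis IntI)
  then show False using component_Int[OF AB] gen_e_nonzero[OF iI] by blast
qed

lemma comp_idx_Un:
  assumes AB: "interchanged G \<theta> A B"
  shows "idx G = comp_idx A \<union> comp_idx B" and "comp_idx A \<inter> comp_idx B = {}"
  using gen_e_component[OF AB] component_Int[OF AB] gen_e_nonzero by auto

lemma component_simps:
  "csa (component G A) = csa G \<inter> A" "idx (component G A) = comp_idx A"
  "sroot (component G A) i = (\<lambda>x. if x \<in> A then sroot G i x else 0)"
  "coroot (component G A) i = coroot G i" "smult (component G A) = smult G"
  by (simp_all add: component_def coroot_def)

text \<open>Restriction to a component, extended by zero as required of the weights of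
  \<open>component G A\<close>.\<close>

definition res :: "'g set \<Rightarrow> ('g \<Rightarrow> complex) \<Rightarrow> 'g \<Rightarrow> complex" where
  "res A l = (\<lambda>x. if x \<in> csa G \<inter> A then l x else 0)"

lemma csa_Int_subspace: "interchanged G \<theta> A B \<Longrightarrow> subspace (csa G \<inter> A)"
  using csa_subspace component_subspace subspace_inter by blast

lemma res_weight_space:
  assumes AB: "interchanged G \<theta> A B" and l: "l \<in> weight_space G"
  shows "res A l \<in> weight_space (component G A)"
proof (rule weight_spaceI, unfold component_simps)
  fix x y assume xy: "x \<in> csa G \<inter> A" "y \<in> csa G \<inter> A"
  then have "x + y \<in> csa G \<inter> A" using csa_Int_subspace[OF AB] subspace_add by blast
  then show "res A l (x + y) = res A l x + res A l y"
    using xy weight_space_add[OF l] by (simp add: res_def)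
next
  fix c x assume x: "x \<in> csa G \<inter> A"
  then have "smult G c x \<in> csa G \<inter> A" using csa_Int_subspace[OF AB] subspace_scale by blast
  then show "res A l (smult G c x) = c * res A l x"
    using x weight_space_scale[OF l] by (simp add: res_def)
qed (auto simp: res_def)

text \<open>The Cartan subalgebra is the direct sum of its two parts. Linearity of \<open>f\<close>
  and \<open>g\<close> is assumed on the respective part only, so arbitrary formulas can be
  inserted.\<close>

lemma ex_weight_with_components:
  assumes AB: "interchanged G \<theta> A B"
    and f: "\<And>x y. x \<in> csa G \<inter> A \<Longrightarrow> y \<in> csa G \<inter> A \<Longrightarrow> f (x + y) = f x + f y"
      "\<And>c x. x \<in> csa G \<inter> A \<Longrightarrow> f (smult G c x) = c * f x"
    and g: "\<And>x y. x \<in> csa G \<inter> B \<Longrightarrow> y \<in> csa G \<inter> B \<Longrightarrow> g (x + y) = g x + g y"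
      "\<And>c x. x \<in> csa G \<inter> B \<Longrightarrow> g (smult G c x) = c * g x"
  shows "\<exists>l\<in>weight_space G. (\<forall>x\<in>csa G \<inter> A. l x = f x) \<and> (\<forall>x\<in>csa G \<inter> B. l x = g x)"
proof -
  note BA = interchanged_sym[OF AB]
  note sub = csa_Int_subspace[OF AB] csa_Int_subspace[OF BA]
  have uniq: "a = a' \<and> b = b'"
    if "a + b = a' + b'" "a \<in> csa G \<inter> A" "a' \<in> csa G \<inter> A" "b \<in> csa G \<inter> B" "b' \<in> csa G \<inter> B" for a b a' b'
  proof -
    have "a - a' = b' - b" using that(1) by (simp add: algebra_simps)
    moreover have "a - a' \<in> A" "b' - b \<in> B" using that subspace_diff sub by blast+
    ultimately have "b' - b \<in> A \<inter> B" by simp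
    then have "b' - b = 0" unfolding component_Int[OF AB] by simp
    then show ?thesis using \<open>a - a' = b' - b\<close> by simp
  qed
  obtain p q where pq: "\<And>h. h \<in> csa G \<Longrightarrow> p h \<in> csa G \<inter> A \<and> q h \<in> csa G \<inter> B \<and> h = p h + q h"
    using csa_component[OF AB] by metis
  define l where "l h = (if h \<in> csa G then f (p h) + g (q h) else 0)" for h
  have lval: "l (a + b) = f a + g b" if "a \<in> csa G \<inter> A" "b \<in> csa G \<inter> B" for a b
  proof -
    have "a + b \<in> csa G" using that csa_subspace subspace_add by blast
    then show ?thesis using pq[of "a + b"] uniq[of "p (a + b)" "q (a + b)" a b] that by (simp add: l_def)
  qed
  have zero: "0 \<in> csa G \<inter> A" "0 \<in> csa G \<inter> B" using sub subspace_0 by blast+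
  have f0: "f 0 = 0" "g 0 = 0" using f(2)[OF zero(1), of 0] g(2)[OF zero(2), of 0] by simp_all
  have "l \<in> weight_space G"
  proof (rule weight_spaceI)
    fix x y assume xy: "x \<in> csa G" "y \<in> csa G"
    have "x + y = (p x + p y) + (q x + q y)" using pq[OF xy(1)] pq[OF xy(2)] by (simp add: algebra_simps)
    moreover have "p x + p y \<in> csa G \<inter> A" "q x + q y \<in> csa G \<inter> B"
      using pq[OF xy(1)] pq[OF xy(2)] sub subspace_add by blast+
    ultimately have "l (x + y) = f (p x + p y) + g (q x + q y)" using lval by metis
    then show "l (x + y) = l x + l y" using f(1) g(1) pq[OF xy(1)] pq[OF xy(2)] xy by (simp add: l_def)
  next
    fix c x assume x: "x \<in> csa G"
    have "smult G c x = smult G c (p x) + smult G c (q x)" using pq[OF x] scale_right_distrib by metis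
    moreover have "smult G c (p x) \<in> csa G \<inter> A" "smult G c (q x) \<in> csa G \<inter> B"
      using pq[OF x] sub subspace_scale by blast+
    ultimately have "l (smult G c x) = f (smult G c (p x)) + g (smult G c (q x))" using lval by metis
    then show "l (smult G c x) = c * l x" using f(2) g(2) pq[OF x] x by (simp add: l_def algebra_simps)
  qed (simp add: l_def)
  moreover have "l x = f x" if "x \<in> csa G \<inter> A" for x using lval[OF that zero(2)] f0 by simp
  moreover have "l x = g x" if "x \<in> csa G \<inter> B" for x using lval[OF zero(1) that] f0 by simp
  ultimately show ?thesis by blast
qed

lemma res_surj:
  assumes AB: "interchanged G \<theta> A B" and m: "m \<in> weight_space (component G A)"
  shows "\<exists>l\<in>weight_space G. res A l = m"
proof -
  have lin: "m (x + y) = m x + m y" "m (smult G c x) = c * m x" if "x \<in> csa G \<inter> A" "y \<in> csa G \<inter> A" for x y c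
    using weight_space_add[OF m] weight_space_scale[OF m] that by (simp_all add: component_simps)
  have "\<exists>l\<in>weight_space G. (\<forall>x\<in>csa G \<inter> A. l x = m x) \<and> (\<forall>x\<in>csa G \<inter> B. l x = 0)"
    by (rule ex_weight_with_components[OF AB]) (use lin in auto)
  then obtain l where l: "l \<in> weight_space G" "\<forall>x\<in>csa G \<inter> A. l x = m x" by blast
  have "res A l x = m x" for x
    using l(2) weight_space_out[OF m, of x] by (auto simp: res_def component_simps)
  then show ?thesis using l(1) by blast
qed

lemma res_simple_refl:
  assumes AB: "interchanged G \<theta> A B" and i: "i \<in> comp_idx A" and l: "l \<in> weight_space G"
  shows "simple_refl (component G A) i (res A l) = res A (simple_refl G i l)"
proof (rule ext)
  fix x
  have "sroot G i x = 0" if "x \<notin> csa G" using weight_space_out[OF sroot_weight_space that] i by blast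
  then show "simple_refl (component G A) i (res A l) x = res A (simple_refl G i l) x"
    using coroot_component[OF AB i] by (auto simp: simple_refl_def res_def component_simps)
qed

lemma res_word_act:
  assumes AB: "interchanged G \<theta> A B" and "set ws \<subseteq> comp_idx A" and l: "l \<in> weight_space G"
  shows "word_act (component G A) ws (res A l) = res A (word_act G ws l)"
  using assms(2)
proof (induction ws)
  case (Cons i ws)
  then have "word_act G ws l \<in> weight_space G" by (intro word_act_weight_space l) auto
  then show ?case using Cons res_simple_refl[OF AB, of i "word_act G ws l"] by simp
qed simp

lemma word_act_other_component:
  assumes AB: "interchanged G \<theta> A B" and "set ws \<subseteq> comp_idx A" and x: "x \<in> csa G \<inter> B"
  shows "word_act G ws l x = l x"
  using assms(2)
proof (induction ws)
  case (Cons i ws)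
  then show ?case using sroot_component[OF AB _ x, of i] by (simp add: simple_refl_def)
qed simp

text \<open>\<open>component G A\<close> is no instance of the locale: its bracket lives on the
  whole type, where \<open>csa G \<inter> A\<close> is not self-centralizing. Its Weyl elements are
  therefore compared with those of \<open>G\<close>. A word of reflections from \<open>A\<close>
  acts trivially on the Cartan part of \<open>B\<close>, so its action on the part in
  \<open>A\<close> determines it.\<close>

lemma weyl_elt_component_eq_iff:
  assumes AB: "interchanged G \<theta> A B" and ws: "set ws \<subseteq> comp_idx A" and us: "set us \<subseteq> comp_idx A"
  shows "weyl_elt (component G A) ws = weyl_elt (component G A) us \<longleftrightarrow> weyl_elt G ws = weyl_elt G us"
proof -
  have "(\<forall>m\<in>weight_space (component G A). word_act (component G A) ws m = word_act (component G A) us m)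
    \<longleftrightarrow> (\<forall>l\<in>weight_space G. res A (word_act G ws l) = res A (word_act G us l))"
    using res_surj[OF AB] res_weight_space[OF AB] res_word_act[OF AB ws] res_word_act[OF AB us] by metis
  also have "\<dots> \<longleftrightarrow> (\<forall>l\<in>weight_space G. word_act G ws l = word_act G us l)"
  proof (intro ball_cong refl iffI)
    fix l assume l: "l \<in> weight_space G" and eq: "res A (word_act G ws l) = res A (word_act G us l)"
    have "word_act G ws l - word_act G us l = 0"
    proof (rule weight_zero_on_components[OF AB])
      show "word_act G ws l - word_act G us l \<in> weight_space G"
        using ws us by (intro weight_space_minus word_act_weight_space l) auto
      show "(word_act G ws l - word_act G us l) x = 0" if "x \<in> csa G \<inter> A" for x
        using fun_cong[OF eq, of x] that by (simp add: res_def)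
      show "(word_act G ws l - word_act G us l) x = 0" if "x \<in> csa G \<inter> B" for x
        using word_act_other_component[OF AB ws that] word_act_other_component[OF AB us that] by simp
    qed
    then show "word_act G ws l = word_act G us l" by (metis eq_iff_diff_eq_0)
  qed simp
  finally show ?thesis by (simp only: weyl_elt_eq_iff)
qed

lemma weyl_length_component:
  assumes AB: "interchanged G \<theta> A B" and ws: "set ws \<subseteq> comp_idx A"
  shows "weyl_length (component G A) (comp_idx A) (weyl_elt (component G A) ws) =
    weyl_length G (comp_idx A) (weyl_elt G ws)"
proof -
  have "(\<exists>us. set us \<subseteq> comp_idx A \<and> length us = k \<and> weyl_elt (component G A) ws = weyl_elt (component G A) us) \<longleftrightarrow>
    (\<exists>us. set us \<subseteq> comp_idx A \<and> length us = k \<and> weyl_elt G ws = weyl_elt G us)" for k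
    using weyl_elt_component_eq_iff[OF AB ws] by blast
  then show ?thesis unfolding weyl_length_def by presburger
qed

text \<open>Lengths agree in \<open>G\<close> and in the component, so an element of maximal length
  in the component is given by a word that inverts the simple roots of \<open>A\<close> in
  \<open>G\<close>, where uniqueness is known.\<close>

lemma w0_component:
  assumes AB: "interchanged G \<theta> A B"
  obtains ws where "inverts (comp_idx A) ws"
    "\<And>l. l \<in> weight_space G \<Longrightarrow> w0 (component G A) (res A l) = res A (word_act G ws l)"
proof -
  let ?K = "component G A" and ?I = "comp_idx A"
  have sub: "?I \<subseteq> idx G" by blast
  obtain ws where ws: "inverts ?I ws"
    "\<And>v. v \<in> weyl_subgroup G ?I \<Longrightarrow> weyl_length G ?I v \<le> weyl_length G ?I (weyl_elt G ws)"
    using longest_elt_inverts[OF sub] by blast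
  have wsI: "set ws \<subseteq> ?I" using ws(1) by (simp add: inverts_def)
  have "longest_elt ?K ?I = weyl_elt ?K ws"
    unfolding longest_elt_def
  proof (rule the_equality, intro conjI ballI)
    show "weyl_elt ?K ws \<in> weyl_subgroup ?K ?I" using wsI by (rule weyl_elt_in_subgroup)
    fix v assume "v \<in> weyl_subgroup ?K ?I"
    then obtain us where us: "set us \<subseteq> ?I" "v = weyl_elt ?K us" by (auto simp: weyl_subgroup_def)
    then show "weyl_length ?K ?I v \<le> weyl_length ?K ?I (weyl_elt ?K ws)"
      using ws(2)[OF weyl_elt_in_subgroup[OF us(1)]] weyl_length_component[OF AB] wsI by simp
  next
    fix v assume v: "v \<in> weyl_subgroup ?K ?I \<and> (\<forall>u\<in>weyl_subgroup ?K ?I. weyl_length ?K ?I u \<le> weyl_length ?K ?I v)"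
    then obtain us where us: "set us \<subseteq> ?I" "v = weyl_elt ?K us" by (auto simp: weyl_subgroup_def)
    have "inverts ?I us"
    proof (rule maximal_length_inverts[OF sub us(1)])
      fix u assume "u \<in> weyl_subgroup G ?I"
      then obtain xs where xs: "set xs \<subseteq> ?I" "u = weyl_elt G xs" by (auto simp: weyl_subgroup_def)
      have "weyl_length ?K ?I (weyl_elt ?K xs) \<le> weyl_length ?K ?I v"
        using v weyl_elt_in_subgroup[OF xs(1)] by blast
      then show "weyl_length G ?I u \<le> weyl_length G ?I (weyl_elt G us)"
        using weyl_length_component[OF AB] xs us by simp
    qed
    then have "weyl_elt G us = weyl_elt G ws"
      using inverts_unique[OF sub _ ws(1)] weyl_elt_eq_iff by blast
    then show "v = weyl_elt ?K ws" using weyl_elt_component_eq_iff[OF AB us(1) wsI] us(2) by simp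
  qed
  then have "w0 ?K (res A l) = res A (word_act G ws l)" if "l \<in> weight_space G" for l
    using weyl_elt_apply[OF res_weight_space[OF AB that]] res_word_act[OF AB wsI that]
    by (simp add: w0_def component_simps)
  then show thesis using that ws(1) by blast
qed

text \<open>Inverting words of the two components, put together, invert all simple roots and hence
  represent \<open>w0 G\<close>. The letters from \<open>B\<close> do not affect the restriction to
  \<open>A\<close>.\<close>

lemma res_w0:
  assumes AB: "interchanged G \<theta> A B" and l: "l \<in> weight_space G"
  shows "res A (w0 G l) = w0 (component G A) (res A l)"
proof -
  note BA = interchanged_sym[OF AB]
  let ?I = "comp_idx A" and ?K = "comp_idx B"
  obtain ws where ws: "inverts ?I ws"
    "\<And>l. l \<in> weight_space G \<Longrightarrow> w0 (component G A) (res A l) = res A (word_act G ws l)"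
    using w0_component[OF AB] by blast
  have subB: "?K \<subseteq> idx G" by blast
  obtain us where us: "set us \<subseteq> ?K"
    "\<And>m. m \<in> weight_space G \<Longrightarrow> longest_elt G ?K m = word_act G us m"
    "\<And>m. m \<in> weight_space G \<Longrightarrow> word_act G us (word_act G us m) = m" "inverts ?K us"
    using longest_elt_word[OF subB] by blast
  have wsI: "set ws \<subseteq> ?I" using ws(1) by (simp add: inverts_def)
  have fixed: "word_act G xs (sroot G i) = sroot G i"
    if "interchanged G \<theta> A B" "set xs \<subseteq> comp_idx B" "i \<in> comp_idx A" for A B xs i
  proof (rule word_act_fixed)
    fix j assume "j \<in> set xs"
    then show "sroot G i (coroot G j) = 0"
      using sroot_component[OF that(1,3)] coroot_component[OF interchanged_sym[OF that(1)], of j] that(2) by blast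
  qed
  have "inverts (idx G) (ws @ us)"
    unfolding inverts_def
  proof (intro conjI ballI)
    show "set (ws @ us) \<subseteq> idx G" using wsI us(1) by auto
    fix i assume "i \<in> idx G"
    then consider "i \<in> ?I" | "i \<in> ?K" using comp_idx_Un(1)[OF AB] by blast
    then show "pos (- word_act G (ws @ us) (sroot G i))"
    proof cases
      case 1
      then show ?thesis unfolding word_act_append fixed[OF AB us(1) 1] using ws(1) unfolding inverts_def by blast
    next
      case 2
      have k: "opposition ?K i \<in> ?K" using permutes_in_image[OF opposition_permutes[OF subB]] 2 by blast
      have us_i: "word_act G us (sroot G i) = - sroot G (opposition ?K i)"
        using longest_elt_sroot[OF subB 2] us(2) sroot_weight_space \<open>i \<in> idx G\<close> by metis
      have "word_act G (ws @ us) (sroot G i) = - sroot G (opposition ?K i)"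
        unfolding word_act_append us_i fun_linear_uminus[OF fun_linear_word_act] fixed[OF BA wsI k] ..
      then show ?thesis using pos_sroot[of "opposition ?K i"] k subB by (simp only: minus_minus) blast
    qed
  qed
  then have "w0 G = weyl_elt G (ws @ us)" unfolding w0_def by (intro longest_eltI) auto
  then have "w0 G l = word_act G ws (word_act G us l)" using weyl_elt_apply[OF l] by simp
  moreover have "res A (word_act G us l) = res A l"
    using word_act_other_component[OF BA us(1)] by (auto simp: res_def)
  moreover have "word_act G us l \<in> weight_space G" using us(1) by (intro word_act_weight_space l) auto
  ultimately show ?thesis using res_word_act[OF AB wsI] ws(2)[OF l] l by metis
qed

section \<open>The condition of \<open>PZB\<close> when no simple root is fixed\<close>

lemma longest_elt_empty: "m \<in> weight_space G \<Longrightarrow> longest_elt G {} m = m"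
proof -
  assume m: "m \<in> weight_space G"
  have "longest_elt G {} = weyl_elt G []" by (rule longest_eltI) (auto simp: inverts_def)
  then show ?thesis using weyl_elt_apply[OF m, of "[]"] by simp
qed

text \<open>For empty \<open>J\<close>, \<open>T\<close> sends each simple root to minus its twist,
  so it conjugates the reflection in \<open>i\<close> to the one in \<open>twist i\<close>. The
  twisted word of the longest element again inverts all simple roots and thus represents the same
  element.\<close>

lemma Theta_w0_commute:
  assumes J: "J = {}" and l: "l \<in> weight_space G"
  shows "T (w0 G l) = w0 G (T l)"
proof -
  have Tsroot: "T (sroot G i) = - sroot G (twist i)" if "i \<in> idx G" for i
    using twist_sroot[OF that] longest_elt_empty[OF Theta_weight_space[OF sroot_weight_space[OF that]]]
    unfolding J by (metis minus_minus)
  have Tcoroot: "T m (coroot G (twist i)) = - m (coroot G i)" if "i \<in> idx G" "m \<in> weight_space G" for i m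
    using twist_coroot[OF that] longest_elt_empty[OF Theta_weight_space[OF that(2)]] unfolding J by simp
  have word: "T (word_act G ws m) = word_act G (map twist ws) (T m)"
    if "set ws \<subseteq> idx G" "m \<in> weight_space G" for ws m
    using that(1)
  proof (induction ws)
    case (Cons i ws)
    then have i: "i \<in> idx G" and ws: "set ws \<subseteq> idx G" by auto
    let ?m = "word_act G ws m"
    have m: "?m \<in> weight_space G" using word_act_weight_space[OF ws that(2)] .
    have "T (simple_refl G i ?m) x = simple_refl G (twist i) (T ?m) x" for x
      using fun_cong[OF Tsroot[OF i], of x] Tcoroot[OF i m] by (simp add: simple_refl_def Theta_def)
    then have "T (simple_refl G i ?m) = simple_refl G (twist i) (T ?m)" by blast
    then show ?case using Cons.IH[OF ws] by simp
  qed simp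
  obtain ws where ws: "set ws \<subseteq> idx G"
    "\<And>m. m \<in> weight_space G \<Longrightarrow> longest_elt G (idx G) m = word_act G ws m"
    "\<And>m. m \<in> weight_space G \<Longrightarrow> word_act G ws (word_act G ws m) = m" "inverts (idx G) ws"
    using longest_elt_word[OF order_refl] by blast
  have "inverts (idx G) (map twist ws)"
    unfolding inverts_def
  proof (intro conjI ballI)
    show "set (map twist ws) \<subseteq> idx G" using ws(1) twist_in by auto
    fix k assume "k \<in> idx G"
    then obtain i where i: "i \<in> idx G" "k = twist i" using permutes_image[OF twist_permutes] by blast
    let ?o = "opposition (idx G) i"
    have o: "?o \<in> idx G" using permutes_in_image[OF opposition_permutes[OF order_refl]] i by blast
    have sr: "word_act G ws (sroot G i) = - sroot G ?o"
      using longest_elt_sroot[OF order_refl i(1)] ws(2)[OF sroot_weight_space[OF i(1)]] by simp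
    have "- word_act G (map twist ws) (sroot G k) = word_act G (map twist ws) (T (sroot G i))"
      unfolding Tsroot[OF i(1)] fun_linear_uminus[OF fun_linear_word_act] i(2) ..
    also have "\<dots> = T (- sroot G ?o)" using word[OF ws(1) sroot_weight_space[OF i(1)]] sr by simp
    also have "\<dots> = sroot G (twist ?o)"
      unfolding fun_linear_uminus[OF fun_linear_Theta] Tsroot[OF o] minus_minus ..
    finally show "pos (- word_act G (map twist ws) (sroot G k))" using pos_sroot[OF twist_in[OF o]] by simp
  qed
  then have "word_act G (map twist ws) (T l) = word_act G ws (T l)"
    using inverts_unique[OF order_refl _ ws(4) Theta_weight_space[OF l]] by blast
  then show ?thesis
    using word[OF ws(1) l] ws(2)[OF l] ws(2)[OF Theta_weight_space[OF l]] by (simp add: w0_def)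
qed

text \<open>The condition is T l = w0 l. It suffices to test it on \<open>A\<close>: the difference
  u of the two sides satisfies w0 u = - T u. If u vanishes on \<open>A\<close>, so does w0 u by
  \<open>res_w0\<close>, hence so does T u, which means that u vanishes on \<open>B\<close>.\<close>

lemma PZB_condition_interchanged:
  assumes AB: "interchanged G \<theta> A B" and l: "l \<in> weight_space G"
  shows "T l = l + w0 G l - w0' G \<theta> l \<longleftrightarrow> (\<forall>x\<in>csa G \<inter> A. l (\<theta> x) = w0 G l x)"
proof -
  note J = pi_Theta_interchanged[OF AB]
  have "T l = l + w0 G l - w0' G \<theta> l \<longleftrightarrow> T l = w0 G l"
    using longest_elt_empty[OF l] by (simp add: w0'_def J)
  also have "\<dots> \<longleftrightarrow> (\<forall>x\<in>csa G \<inter> A. T l x = w0 G l x)"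
  proof
    assume agree: "\<forall>x\<in>csa G \<inter> A. T l x = w0 G l x"
    define u where "u = T l - w0 G l"
    have wl: "w0 G l \<in> weight_space G" unfolding w0_def by (intro longest_elt_weight_space l order_refl)
    have Tl: "T l \<in> weight_space G" using Theta_weight_space[OF l] .
    have u: "u \<in> weight_space G" unfolding u_def by (intro weight_space_minus wl Tl)
    have uA: "u x = 0" if "x \<in> csa G \<inter> A" for x using agree that by (simp add: u_def)
    obtain ws where ws: "\<And>m. m \<in> weight_space G \<Longrightarrow> w0 G m = word_act G ws m"
      using longest_elt_word[OF order_refl] unfolding w0_def by metis
    have "w0 G u = w0 G (T l) - w0 G (w0 G l)"
      using ws[OF u] ws[OF Tl] ws[OF wl] fun_linear_diff[OF fun_linear_word_act] unfolding u_def by metis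
    also have "\<dots> = T (w0 G l) - T (T l)"
      using Theta_w0_commute[OF J l] longest_elt_involution[OF order_refl l] Theta_Theta by (simp add: w0_def)
    also have "\<dots> = - T u" unfolding u_def fun_linear_diff[OF fun_linear_Theta] by (rule minus_diff_eq[symmetric])
    finally have wu: "w0 G u = - T u" .
    have "res A u = res A 0" using uA by (auto simp: res_def)
    then have "res A (w0 G u) = res A (w0 G 0)" using res_w0[OF AB] u zero_in_weight_space by metis
    also have "w0 G 0 = 0" using ws[OF zero_in_weight_space] fun_linear_0[OF fun_linear_word_act] by metis
    finally have r: "res A (- T u) = res A 0" using wu by metis
    have uB: "u x = 0" if x: "x \<in> csa G \<inter> B" for x
    proof -
      have "\<theta> x \<in> csa G \<inter> A" using x theta_csa_iff component_theta[OF interchanged_sym[OF AB]] by blast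
      then have "(- T u) (\<theta> x) = 0" using fun_cong[OF r, of "\<theta> x"] by (simp add: res_def)
      then show ?thesis by (simp add: Theta_def theta_theta)
    qed
    have "u = 0" by (rule weight_zero_on_components[OF AB u uA uB])
    then show "T l = w0 G l" by (simp add: u_def)
  qed simp
  finally show ?thesis by (simp add: Theta_def)
qed

lemma pair_weight_eqI:
  assumes AB: "interchanged G \<theta> A B" and l: "l \<in> weight_space G"
    and "\<And>x. x \<in> csa G \<inter> A \<Longrightarrow> l x = \<mu> x" "\<And>x. x \<in> csa G \<inter> B \<Longrightarrow> l x = \<nu> (- \<theta> x)"
  shows "pair_weight G \<theta> A B \<mu> \<nu> = l"
  unfolding pair_weight_def
proof (rule the_equality)
  fix m assume m: "m \<in> weight_space G \<and> (\<forall>x\<in>csa G \<inter> A. m x = \<mu> x) \<and> (\<forall>x\<in>csa G \<inter> B. m x = \<nu> (- \<theta> x))"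
  have "m - l = 0"
    by (rule weight_zero_on_components[OF AB]) (use m l assms(3,4) in \<open>auto intro: weight_space_minus\<close>)
  then show "m = l" by simp
qed (use assms in blast)

text \<open>The longest element acts componentwise, so a simple root vanishing on \<open>A\<close>
  has an opposite vanishing on \<open>A\<close>.\<close>

lemma opposition_component:
  assumes AB: "interchanged G \<theta> A B" and k: "k \<in> idx G" and o: "opposition (idx G) k \<in> comp_idx A"
  shows "k \<in> comp_idx A"
proof (rule ccontr)
  assume "k \<notin> comp_idx A"
  then have kB: "k \<in> comp_idx B" using comp_idx_Un(1)[OF AB] k by blast
  have ks: "sroot G k \<in> weight_space G" using sroot_weight_space[OF k] .
  have "res A (sroot G k) = res A 0"
    using sroot_component[OF interchanged_sym[OF AB] kB] by (auto simp: res_def)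
  then have "res A (w0 G (sroot G k)) = res A (w0 G 0)"
    using res_w0[OF AB ks] res_w0[OF AB zero_in_weight_space] by metis
  moreover have "w0 G 0 = 0"
    using longest_elt_word[OF order_refl] zero_in_weight_space fun_linear_0[OF fun_linear_word_act] by (metis w0_def)
  ultimately have r: "res A (- sroot G (opposition (idx G) k)) = res A 0"
    using longest_elt_sroot[OF order_refl k] by (simp add: w0_def)
  have "sroot G (opposition (idx G) k) = 0"
  proof (rule weight_zero_on_components[OF AB])
    show "sroot G (opposition (idx G) k) x = 0" if "x \<in> csa G \<inter> A" for x
      using fun_cong[OF r, of x] that by (simp add: res_def)
  qed (use o sroot_weight_space sroot_component[OF AB o] in auto)
  then show False using signed_roots_nonzero[OF sroot_signed_roots] o by blast
qed

text \<open>For empty \<open>J\<close> the twist is minus \<open>T\<close>, which carries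
  functionals vanishing on \<open>A\<close> to functionals vanishing on \<open>B\<close>.\<close>

lemma twist_component:
  assumes AB: "interchanged G \<theta> A B" and i: "i \<in> comp_idx B"
  shows "twist i \<in> comp_idx A"
proof (rule ccontr)
  assume no: "twist i \<notin> comp_idx A"
  have iI: "i \<in> idx G" using i by blast
  then have tB: "twist i \<in> comp_idx B" using comp_idx_Un(1)[OF AB] twist_in no by blast
  note J = pi_Theta_interchanged[OF AB] and BA = interchanged_sym[OF AB]
  have t: "sroot G (twist i) = - T (sroot G i)"
    using twist_sroot[OF iI] longest_elt_empty[OF Theta_weight_space[OF sroot_weight_space[OF iI]]] J by simp
  have "sroot G (twist i) = 0"
  proof (rule weight_zero_on_components[OF AB])
    show "sroot G (twist i) x = 0" if "x \<in> csa G \<inter> B" for x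
    proof -
      have "\<theta> x \<in> csa G \<inter> A" using that theta_csa_iff component_theta[OF BA] by blast
      then show ?thesis using sroot_component[OF BA i] t by (simp add: Theta_def)
    qed
  qed (use twist_in[OF iI] sroot_weight_space sroot_component[OF BA tB] in auto)
  then show False using signed_roots_nonzero[OF sroot_signed_roots[OF twist_in[OF iI]]] by blast
qed

lemma PZB_interchanged:
  assumes AB: "interchanged G \<theta> A B"
  shows "PZB G \<theta> = {pair_weight G \<theta> A B \<mu> (- w0 (component G A) \<mu>) | \<mu>.
    \<mu> \<in> dominant_weights (component G A)}"
proof -
  note BA = interchanged_sym[OF AB] and J = pi_Theta_interchanged[OF AB]
  have thetaB: "\<theta> x \<in> csa G \<inter> A" if "x \<in> csa G \<inter> B" for x
    using that theta_csa_iff component_theta[OF BA] by blast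
  have thetaA: "\<theta> x \<in> csa G \<inter> B" if "x \<in> csa G \<inter> A" for x
    using that theta_csa_iff component_theta[OF AB] by blast
  \<comment> \<open>The sign in the second entry cancels the one in the identification of
    \<open>B\<close> with \<open>A\<close> by minus \<theta>.\<close>
  have partner: "(- w0 (component G A) (res A l)) (- \<theta> x) = w0 G l (\<theta> x)"
    if l: "l \<in> weight_space G" and x: "x \<in> csa G \<inter> B" for l x
  proof -
    have wl: "w0 G l \<in> weight_space G" unfolding w0_def by (intro longest_elt_weight_space l order_refl)
    have neg: "- \<theta> x \<in> csa G \<inter> A" using thetaB[OF x] csa_Int_subspace[OF AB] subspace_neg by blast
    have "w0 (component G A) (res A l) (- \<theta> x) = w0 G l (- \<theta> x)"
      using res_w0[OF AB l] neg by (metis res_def)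
    also have "\<dots> = - w0 G l (\<theta> x)"
      using weight_space_scale[OF wl, of "\<theta> x" "- 1"] thetaB[OF x] by simp
    finally show ?thesis by simp
  qed
  have cond: "T l = l + w0 G l - w0' G \<theta> l \<longleftrightarrow>
      (\<forall>x\<in>csa G \<inter> B. l x = (- w0 (component G A) (res A l)) (- \<theta> x))"
    if l: "l \<in> weight_space G" for l
  proof -
    have "(\<forall>x\<in>csa G \<inter> A. l (\<theta> x) = w0 G l x) \<longleftrightarrow> (\<forall>x\<in>csa G \<inter> B. l x = w0 G l (\<theta> x))"
      using thetaA thetaB theta_theta by metis
    then show ?thesis using PZB_condition_interchanged[OF AB l] partner[OF l] by simp
  qed
  show ?thesis
  proof (intro equalityI subsetI)
    fix l assume "l \<in> PZB G \<theta>"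
    then have dom: "l \<in> dominant_weights G" and eq: "T l = l + w0 G l - w0' G \<theta> l" by (auto simp: PZB_def)
    have l: "l \<in> weight_space G" using dom by (rule dominant_weights_weight_space)
    have "pair_weight G \<theta> A B (res A l) (- w0 (component G A) (res A l)) = l"
      using cond[OF l] eq by (intro pair_weight_eqI[OF AB l]) (auto simp: res_def)
    moreover have "res A l \<in> dominant_weights (component G A)"
      using res_weight_space[OF AB l] dom coroot_component[OF AB]
      by (auto simp: dominant_weights_def component_simps res_def)
    ultimately show "l \<in> {pair_weight G \<theta> A B \<mu> (- w0 (component G A) \<mu>) | \<mu>. \<mu> \<in> dominant_weights (component G A)}"
      by (intro CollectI exI[of _ "res A l"]) simp
  next
    fix l assume "l \<in> {pair_weight G \<theta> A B \<mu> (- w0 (component G A) \<mu>) | \<mu>. \<mu> \<in> dominant_weights (component G A)}"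
    then obtain \<mu> where \<mu>: "\<mu> \<in> dominant_weights (component G A)"
      "l = pair_weight G \<theta> A B \<mu> (- w0 (component G A) \<mu>)" by blast
    have \<mu>w: "\<mu> \<in> weight_space (component G A)" using \<mu>(1) by (simp add: dominant_weights_def)
    then obtain l0 where l0: "l0 \<in> weight_space G" "res A l0 = \<mu>" using res_surj[OF AB] by blast
    have wl0: "w0 G l0 \<in> weight_space G" unfolding w0_def by (intro longest_elt_weight_space l0 order_refl)
    \<comment> \<open>\<open>l0\<close> is any weight restricting to \<mu>. By \<open>res_w0\<close>
      the values of \<open>w0 G l0\<close> on \<open>A\<close> depend on \<mu> only, and \<theta>
      transports them to \<open>B\<close>.\<close>
    have "\<exists>m\<in>weight_space G. (\<forall>x\<in>csa G \<inter> A. m x = \<mu> x) \<and> (\<forall>x\<in>csa G \<inter> B. m x = w0 G l0 (\<theta> x))"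
    proof (rule ex_weight_with_components[OF AB])
      show "\<mu> (x + y) = \<mu> x + \<mu> y" if "x \<in> csa G \<inter> A" "y \<in> csa G \<inter> A" for x y
        using weight_space_add[OF \<mu>w] that by (simp add: component_simps)
      show "\<mu> (smult G c x) = c * \<mu> x" if "x \<in> csa G \<inter> A" for c x
        using weight_space_scale[OF \<mu>w] that by (simp add: component_simps)
    qed (use weight_space_add[OF wl0] weight_space_scale[OF wl0] theta_csa_iff th.add th.scale in auto)
    then obtain m where m: "m \<in> weight_space G" "\<forall>x\<in>csa G \<inter> A. m x = \<mu> x" "\<forall>x\<in>csa G \<inter> B. m x = w0 G l0 (\<theta> x)"
      by blast
    have "res A m x = \<mu> x" for x
      using m(2) weight_space_out[OF \<mu>w, of x] by (auto simp: res_def component_simps)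
    then have rm: "res A m = \<mu>" by blast
    have mB: "m x = (- w0 (component G A) (res A m)) (- \<theta> x)" if "x \<in> csa G \<inter> B" for x
      using partner[OF l0(1) that] m(3) that l0(2) rm by simp
    then have C: "T m = m + w0 G m - w0' G \<theta> m" using cond[OF m(1)] by blast
    then have Tm: "T m = w0 G m" using longest_elt_empty[OF m(1)] by (simp add: w0'_def J)
    have lm: "l = m" unfolding \<mu>(2) using m(2) mB rm by (intro pair_weight_eqI[OF AB m(1)]) auto
    have domA: "m (coroot G i) \<in> \<nat>" if "i \<in> comp_idx A" for i
      using \<mu>(1) m(2) coroot_component[OF AB that] that by (auto simp: dominant_weights_def component_simps)
    \<comment> \<open>The twist moves \<open>i\<close> into \<open>A\<close> and the opposition
      preserves \<open>A\<close>, so T m = w0 m identifies the coordinate at \<open>i\<close> with a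
      coordinate at a node of \<open>A\<close>.\<close>
    have domB: "m (coroot G i) \<in> \<nat>" if i: "i \<in> comp_idx B" for i
    proof -
      have iI: "i \<in> idx G" using i by blast
      have tA: "twist i \<in> comp_idx A" using twist_component[OF AB i] .
      then obtain k where k: "k \<in> idx G" "twist i = opposition (idx G) k"
        using permutes_image[OF opposition_permutes[OF order_refl]] by blast
      have kA: "k \<in> comp_idx A" using opposition_component[OF AB k(1)] k(2) tA by simp
      have "- m (coroot G i) = T m (coroot G (twist i))"
        using twist_coroot[OF iI m(1)] longest_elt_empty[OF Theta_weight_space[OF m(1)]] J by simp
      also have "\<dots> = - m (coroot G k)"
        using longest_elt_coroot[OF order_refl k(1) m(1)] k(2) Tm by (simp add: w0_def)
      finally show ?thesis using domA[OF kA] by simp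
    qed
    have "m \<in> dominant_weights G"
      unfolding dominant_weights_def using m(1) domA domB comp_idx_Un(1)[OF AB] by blast
    then show "l \<in> PZB G \<theta>" using C lm by (simp add: PZB_def)
  qed
qed

end

section \<open>The weights by type\<close>

context split_pair
begin

lemma twist_diagram_aut: "has_type G X \<Longrightarrow> diagram_aut X twist"
  by (rule diagram_autI) (auto intro: twist_permutes twist_cartan)

text \<open>Twist and opposition are both diagram automorphisms, so they agree when only the
  identity is available.\<close>

lemma PZB_if_rigid:
  assumes X: "has_type G X" and rigid: "\<And>d. diagram_aut X d \<Longrightarrow> \<forall>i\<in>{1..dynkin_rank X}. d i = i"
  shows "PZB G \<theta> = dominant_weights G"
proof (rule PZB_if_twist_opposition)
  fix i assume "i \<in> idx G"
  then have "i \<in> {1..dynkin_rank X}" using X by (simp add: has_type_def)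
  then show "twist i = opposition (idx G) i"
    using rigid[OF twist_diagram_aut[OF X]] rigid[OF opposition_diagram_aut[OF X]] by simp
qed

lemma PZB_no_diagram_aut:
  assumes "has_type G (TypeB n) \<or> has_type G (TypeC n) \<or> has_type G (TypeE 7) \<or>
      has_type G (TypeE 8) \<or> has_type G TypeF4 \<or> has_type G TypeG2"
  shows "PZB G \<theta> = dominant_weights G"
  using assms
proof (elim disjE)
  assume X: "has_type G (TypeB n)"
  then have "n \<ge> 2" by (simp add: has_type_def)
  then show ?thesis using diagram_aut_B by (intro PZB_if_rigid[OF X]) simp
next
  assume X: "has_type G (TypeC n)"
  then have "n \<ge> 2" by (simp add: has_type_def)
  then show ?thesis using diagram_aut_C by (intro PZB_if_rigid[OF X]) simp
next
  assume X: "has_type G (TypeE 7)"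
  show ?thesis
  proof (rule PZB_if_rigid[OF X])
    fix d assume "diagram_aut (TypeE 7) d"
    then show "\<forall>i\<in>{1..dynkin_rank (TypeE 7)}. d i = i" using diagram_aut_E[of 7 d] by simp
  qed
next
  assume X: "has_type G (TypeE 8)"
  show ?thesis
  proof (rule PZB_if_rigid[OF X])
    fix d assume "diagram_aut (TypeE 8) d"
    then show "\<forall>i\<in>{1..dynkin_rank (TypeE 8)}. d i = i" using diagram_aut_E[of 8 d] by simp
  qed
next
  assume X: "has_type G TypeF4"
  show ?thesis using diagram_aut_F4 by (intro PZB_if_rigid[OF X]) simp
next
  assume X: "has_type G TypeG2"
  show ?thesis using diagram_aut_G2 by (intro PZB_if_rigid[OF X]) simp
qed

text \<open>Off \<open>J\<close> the twist is the trivial \<open>p\<close>; on \<open>J\<close> it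
  is the opposition of \<open>J\<close>, which fixes isolated nodes.\<close>

lemma twist_id_if_isolated:
  assumes p: "satake_perm G \<theta> id"
    and isolated: "\<And>j k. j \<in> J \<Longrightarrow> k \<in> J \<Longrightarrow> k \<noteq> j \<Longrightarrow> sroot G j (coroot G k) = 0"
    and i: "i \<in> idx G"
  shows "twist i = i"
proof (cases "i \<in> J")
  case True
  then show ?thesis using twist_J[OF True] opposition_isolated[OF J_subset True] isolated by simp
next
  case False
  then show ?thesis using twist_satake_perm[OF p i] by simp
qed

lemma has_type_orthogonal:
  assumes X: "has_type G X" and jk: "j \<in> idx G" "k \<in> idx G" "cartan_matrix X j k = 0"
  shows "sroot G j (coroot G k) = 0"
  using has_type_cartan[OF X jk(1,2)] jk(3) by simp

lemma twist_id_AI: "type_AI G \<theta> n \<Longrightarrow> i \<in> idx G \<Longrightarrow> twist i = i"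
  and twist_id_DI_case3: "type_DI_case3 G \<theta> n \<Longrightarrow> i \<in> idx G \<Longrightarrow> twist i = i"
  and twist_id_EI: "type_EI G \<theta> \<Longrightarrow> i \<in> idx G \<Longrightarrow> twist i = i"
  by (rule twist_id_if_isolated; force simp: type_AI_def type_DI_case3_def type_EI_def satake_type_def)+

lemma twist_id_AII:
  assumes "type_AII G \<theta> n" and i: "i \<in> idx G"
  shows "twist i = i"
proof (rule twist_id_if_isolated[OF _ _ i])
  have X: "has_type G (TypeA n)" and J: "J = {i \<in> {1..n}. odd i}" and p: "satake_perm G \<theta> id"
    using assms(1) by (auto simp: type_AII_def satake_type_def)
  show "satake_perm G \<theta> id" by (rule p)
  fix j k assume jk: "j \<in> J" "k \<in> J" "k \<noteq> j"
  then have "odd j" "odd k" by (simp_all add: J)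
  then have "k \<noteq> j + 1" "j \<noteq> k + 1" by auto
  then have "cartan_matrix (TypeA n) j k = 0" using jk(3) by (simp add: linked_def)
  then show "sroot G j (coroot G k) = 0" using has_type_orthogonal[OF X] jk J_subset by blast
qed

lemma twist_id_DIII_case1:
  assumes "type_DIII_case1 G \<theta> n" and i: "i \<in> idx G"
  shows "twist i = i"
proof (rule twist_id_if_isolated[OF _ _ i])
  have n: "even n" and X: "has_type G (TypeD n)" and p: "satake_perm G \<theta> id"
    and J: "J = {2 * j - 1 | j. 1 \<le> j \<and> j \<le> n div 2}"
    using assms(1) by (auto simp: type_DIII_case1_def satake_type_def)
  show "satake_perm G \<theta> id" by (rule p)
  fix j k assume jk: "j \<in> J" "k \<in> J" "k \<noteq> j"
  then have "odd j" "odd k" by (auto simp: J)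
  \<comment> \<open>Nodes of \<open>J\<close> are odd, so they are not consecutive; as
    \<open>n\<close> is even, the extra link between n - 2 and n does not occur either.\<close>
  then have "k \<noteq> j + 1" "j \<noteq> k + 1" "k \<noteq> n" "j \<noteq> n" using n by auto
  then have "cartan_matrix (TypeD n) j k = 0" using jk(3) by (simp add: linked_def)
  then show "sroot G j (coroot G k) = 0" using has_type_orthogonal[OF X] jk J_subset by blast
qed

text \<open>The nodes of \<open>J\<close> form a D4 and are not isolated. But node 1 lies off
  \<open>J\<close> and is fixed by \<open>p\<close>, while the nontrivial automorphism of E6 moves
  it.\<close>

lemma twist_id_EIV:
  assumes "type_EIV G \<theta>" and i: "i \<in> idx G"
  shows "twist i = i"
proof -
  have X: "has_type G (TypeE 6)" and J: "J = {2, 3, 4, 5}" and p: "satake_perm G \<theta> id"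
    using assms(1) by (auto simp: type_EIV_def satake_type_def)
  have idx: "idx G = {1..6}" using X by (simp add: has_type_def)
  have "twist 1 = 1" using twist_satake_perm[OF p, of 1] by (simp add: J idx)
  then show ?thesis using diagram_aut_E[OF twist_diagram_aut[OF X]] i idx by auto
qed

lemma twist_opposition_E6:
  assumes X: "has_type G (TypeE 6)" and t: "twist 1 = 6" and i: "i \<in> idx G"
  shows "twist i = opposition (idx G) i"
proof -
  have idx: "idx G = {1..6}" using X by (simp add: has_type_def)
  have t': "twist 1 = 6 \<and> twist 2 = 2 \<and> twist 3 = 5 \<and> twist 4 = 4 \<and> twist 5 = 3 \<and> twist 6 = 1"
    using diagram_aut_E[OF twist_diagram_aut[OF X]] t by auto
  have o: "opposition (idx G) 1 = 6 \<and> opposition (idx G) 2 = 2 \<and> opposition (idx G) 3 = 5 \<and>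
    opposition (idx G) 4 = 4 \<and> opposition (idx G) 5 = 3 \<and> opposition (idx G) 6 = 1"
    using diagram_aut_E[OF opposition_diagram_aut[OF X]] opposition_E6[OF X] by auto
  have "i = 1 \<or> i = 2 \<or> i = 3 \<or> i = 4 \<or> i = 5 \<or> i = 6" using i unfolding idx atLeastAtMost_iff by linarith
  then show ?thesis using t' o by (elim disjE) simp_all
qed

lemma twist_opposition_A:
  assumes X: "has_type G (TypeA n)" and n: "n \<ge> 2" and t: "twist 1 = n" and i: "i \<in> idx G"
  shows "twist i = opposition (idx G) i"
proof -
  have idx: "idx G = {1..n}" using X by (simp add: has_type_def)
  have "\<not> (\<forall>i\<in>{1..n}. twist i = i)"
  proof
    assume "\<forall>i\<in>{1..n}. twist i = i"
    then have "twist 1 = 1" using n by simp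
    then show False using t n by simp
  qed
  then have "\<forall>i\<in>{1..n}. twist i = n + 1 - i" using diagram_aut_A[OF twist_diagram_aut[OF X]] by blast
  then show ?thesis using opposition_A[OF X n] i idx by simp
qed

lemma twist_D:
  assumes X: "has_type G (TypeD n)" and fixed: "n \<ge> 5 \<or> twist 1 = 1"
  shows "(\<forall>i\<in>idx G. twist i = i) \<and> twist n = n \<or>
    (\<forall>i\<in>idx G. twist i = transpose (n - 1) n i) \<and> twist n = n - 1"
proof -
  have idx: "idx G = {1..n}" and n: "n \<ge> 4" using X by (auto simp: has_type_def)
  note D = diagram_aut_D[OF twist_diagram_aut[OF X] n fixed]
  have cases: "i \<in> {1..n - 2} \<or> i = n - 1 \<or> i = n" if "i \<in> {1..n}" for i using that by auto
  have tr: "transpose (n - 1) n i = i" if "i \<in> {1..n - 2}" for i using that by (auto simp: transpose_def)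
  from D(2) show ?thesis
  proof
    assume "twist n = n \<and> twist (n - 1) = n - 1"
    then show ?thesis using D(1) cases idx by metis
  next
    assume t: "twist n = n - 1 \<and> twist (n - 1) = n"
    then have "twist i = transpose (n - 1) n i" if "i \<in> idx G" for i
      using cases[of i] tr[of i] D(1) that idx by auto
    then show ?thesis using t by blast
  qed
qed

text \<open>One value of the twist off \<open>J\<close>, read from \<open>p\<close>, is enough: node
  1 in types A and E6, node n in type D. It shows that the twist is the nontrivial automorphism,
  which is the opposition.\<close>

lemma PZB_AIII_AIV_EII_EIII_DIII_case2:
  assumes "(\<exists>r. type_AIII G \<theta> n r) \<or> type_AIV G \<theta> n \<or> type_EII G \<theta> \<or> type_EIII G \<theta> \<or>
    type_DIII_case2 G \<theta> n"
  shows "PZB G \<theta> = dominant_weights G"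
proof -
  consider r where "type_AIII G \<theta> n r \<or> type_AIV G \<theta> n \<and> r = 1" | "type_EII G \<theta> \<or> type_EIII G \<theta>"
    | "type_DIII_case2 G \<theta> n" using assms by blast
  then show ?thesis
  proof cases
    case 1
    then have X: "has_type G (TypeA n)" and p: "satake_perm G \<theta> (A_perm n r)" and n: "n \<ge> 2" "r \<ge> 1"
      and J: "J = {r+1..n-r}"
      by (auto simp: type_AIII_def type_AIV_def satake_type_def numeral_2_eq_2)
    have idx: "idx G = {1..n}" using X by (simp add: has_type_def)
    have "twist 1 = n" using twist_satake_perm[OF p, of 1] n by (simp add: J idx A_perm_def)
    then show ?thesis by (intro PZB_if_twist_opposition twist_opposition_A[OF X n(1)])
  next
    case 2
    then have X: "has_type G (TypeE 6)" by (auto simp: type_EII_def type_EIII_def satake_type_def)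
    have idx: "idx G = {1..6}" using X by (simp add: has_type_def)
    have "1 \<notin> J" using 2 by (auto simp: type_EII_def type_EIII_def satake_type_def)
    moreover obtain p where "satake_perm G \<theta> p" "p 1 = 6"
      using 2 that[of "transpose 1 6 \<circ> transpose 3 5"] that[of "transpose 1 6"]
      by (auto simp: type_EII_def type_EIII_def satake_type_def transpose_def)
    ultimately have "twist 1 = 6" using twist_satake_perm[of p 1] by (simp add: idx)
    then show ?thesis by (intro PZB_if_twist_opposition twist_opposition_E6[OF X])
  next
    case 3
    then have X: "has_type G (TypeD n)" and p: "satake_perm G \<theta> (transpose (n - 1) n)" and od: "odd n"
      and J: "J = {2 * j - 1 | j. 1 \<le> j \<and> j \<le> (n - 1) div 2}"
      by (auto simp: type_DIII_case2_def satake_type_def)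
    have idx: "idx G = {1..n}" and n: "n \<ge> 4" using X by (auto simp: has_type_def)
    then have n5: "n \<ge> 5" using od by (cases "n = 4") auto
    \<comment> \<open>The largest node of \<open>J\<close> is n - 2.\<close>
    have "n \<notin> J" using n by (auto simp: J)
    then have "twist n = n - 1" using twist_satake_perm[OF p, of n] n by (simp add: idx)
    then have "\<forall>i\<in>idx G. twist i = transpose (n - 1) n i" using twist_D[OF X disjI1[OF n5]] n by auto
    then show ?thesis using opposition_D_odd[OF X od] idx by (intro PZB_if_twist_opposition) simp
  qed
qed

lemma agree_under_transpose_iff:
  assumes idx: "idx G = {1..n}" and n: "n \<ge> 2"
  shows "(\<forall>j\<in>idx G. m (coroot G (transpose (n - 1) n j)) = m (coroot G j)) \<longleftrightarrow>
    m (coroot G (n - 1)) = m (coroot G n)"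
proof
  assume *: "\<forall>j\<in>idx G. m (coroot G (transpose (n - 1) n j)) = m (coroot G j)"
  have "n \<in> idx G" using idx n by simp
  with * have "m (coroot G (transpose (n - 1) n n)) = m (coroot G n)" by blast
  then show "m (coroot G (n - 1)) = m (coroot G n)" by simp
next
  assume "m (coroot G (n - 1)) = m (coroot G n)"
  then show "\<forall>j\<in>idx G. m (coroot G (transpose (n - 1) n j)) = m (coroot G j)"
    by (simp add: transpose_def)
qed

text \<open>For even \<open>n\<close> the opposition is trivial and equals the twist. For odd
  \<open>n\<close> it exchanges the last two nodes, so mu = - w0 mu equates the last two
  coordinates.\<close>

lemma PZB_D_twist_id:
  assumes X: "has_type G (TypeD n)" and twist: "\<forall>i\<in>idx G. twist i = i"
  shows "PZB G \<theta> = (if even n then dominant_weights G else D_weights G n)"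
proof -
  have idx: "idx G = {1..n}" and n: "n \<ge> 2" using X by (auto simp: has_type_def)
  show ?thesis
  proof (cases "even n")
    case True
    have "PZB G \<theta> = dominant_weights G"
      by (rule PZB_if_twist_opposition) (use twist opposition_D_even[OF X True] idx in simp)
    then show ?thesis using True by simp
  next
    case False
    have "m = - w0 G m \<longleftrightarrow> m (coroot G (n - 1)) = m (coroot G n)" if "m \<in> dominant_weights G" for m
    proof -
      have "m \<in> weight_space G" using dominant_weights_weight_space that .
      then have "m = - w0 G m \<longleftrightarrow> (\<forall>j\<in>idx G. m (coroot G (opposition (idx G) j)) = m (coroot G j))"
        by (rule w0_eq_opposition_iff)
      also have "\<dots> \<longleftrightarrow> (\<forall>j\<in>idx G. m (coroot G (transpose (n - 1) n j)) = m (coroot G j))"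
        using opposition_D_odd[OF X False] idx by simp
      finally show ?thesis using agree_under_transpose_iff[OF idx n] by blast
    qed
    then show ?thesis
      using False twist PZB_if_twist_id D_weights_eq[OF idx n] by auto
  qed
qed

lemma PZB_D_twist_transpose:
  assumes X: "has_type G (TypeD n)" and twist: "\<forall>i\<in>idx G. twist i = transpose (n - 1) n i"
  shows "PZB G \<theta> = (if odd n then dominant_weights G else D_weights G n)"
proof -
  have idx: "idx G = {1..n}" and n: "n \<ge> 2" using X by (auto simp: has_type_def)
  show ?thesis
  proof (cases "odd n")
    case True
    have "PZB G \<theta> = dominant_weights G"
      by (rule PZB_if_twist_opposition) (use twist opposition_D_odd[OF X True] idx in simp)
    then show ?thesis using True by simp
  next
    case False
    then have "PZB G \<theta> = {m \<in> dominant_weights G. \<forall>j\<in>idx G. m (coroot G (twist j)) = m (coroot G j)}"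
      using opposition_D_even[OF X] idx by (intro PZB_if_opposition_id) simp
    also have "\<dots> = {m \<in> dominant_weights G. \<forall>j\<in>idx G. m (coroot G (transpose (n - 1) n j)) = m (coroot G j)}"
      using twist by auto
    also have "\<dots> = D_weights G n"
      unfolding agree_under_transpose_iff[OF idx n] D_weights_eq[OF idx n] ..
    finally show ?thesis using False by simp
  qed
qed

text \<open>Node 1 is off \<open>J\<close> and fixed, which excludes triality. Node n lies in
  \<open>J\<close>, so its twist is the opposition of the tail and depends on the parity of n - r.
  The opposition of the whole diagram depends on the parity of n, and comparing the two leaves the
  parity of r.\<close>

lemma PZB_DI_case1_DII:
  assumes "type_DI_case1 G \<theta> n r \<or> type_DII G \<theta> n r"
  shows "PZB G \<theta> = (if even r then dominant_weights G else D_weights G n)"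
proof -
  have X: "has_type G (TypeD n)" and p: "satake_perm G \<theta> id" and J: "J = {r+1..n}"
    using assms by (auto simp: type_DI_case1_def type_DII_def satake_type_def)
  have idx: "idx G = {1..n}" and n: "n \<ge> 4" using X by (auto simp: has_type_def)
  have r: "1 \<le> r" "r + 2 \<le> n" using assms n by (auto simp: type_DI_case1_def type_DII_def)
  have "twist 1 = 1" using twist_satake_perm[OF p, of 1] r n by (simp add: J idx)
  note D = twist_D[OF X disjI2[OF this]]
  have tn: "twist n = opposition {r+1..n} n" using twist_J[of n] r n by (simp add: J)
  show ?thesis
  proof (cases "even (n - r)")
    case True
    then have "twist n \<noteq> n - 1" using opposition_D(1)[OF X r(2)] tn by simp
    then have "\<forall>i\<in>idx G. twist i = i" using D by blast
    then show ?thesis using PZB_D_twist_id[OF X] True r by simp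
  next
    case False
    then have "twist n \<noteq> n" using opposition_D(2)[OF X r(2)] tn by simp
    then have "\<forall>i\<in>idx G. twist i = transpose (n - 1) n i" using D by blast
    then show ?thesis using PZB_D_twist_transpose[OF X] False r by simp
  qed
qed

text \<open>With \<open>J\<close> empty the twist is \<open>p\<close> on every node, so D4 needs no
  separate argument for the twist.\<close>

lemma PZB_DI_case2:
  assumes "type_DI_case2 G \<theta> n"
  shows "PZB G \<theta> = (if odd n then dominant_weights G else D_weights G n)"
proof -
  have X: "has_type G (TypeD n)" and p: "satake_perm G \<theta> (transpose (n - 1) n)" and J: "J = {}"
    using assms by (auto simp: type_DI_case2_def satake_type_def)
  then have "\<forall>i\<in>idx G. twist i = transpose (n - 1) n i" using twist_satake_perm[OF p] by blast
  then show ?thesis using PZB_D_twist_transpose[OF X] by simp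
qed

end

theorem proposition9p1:
  fixes G :: "'g::ab_group_add lie_data" and \<theta> :: "'g \<Rightarrow> 'g" and n :: nat
  assumes "semisimple_lie_algebra G" and "idx G = {1..n}"
    and "maximally_split G \<theta>" and "irreducible_pair G \<theta>"
  shows
    "(\<forall>A B. interchanged G \<theta> A B \<longrightarrow>
        PZB G \<theta> = {pair_weight G \<theta> A B \<mu> (- w0 (component G A) \<mu>) | \<mu>.
                    \<mu> \<in> dominant_weights (component G A)}) \<and>
     (has_type G (TypeB n) \<or> has_type G (TypeC n) \<or> has_type G (TypeE 7) \<or>
      has_type G (TypeE 8) \<or> has_type G TypeF4 \<or> has_type G TypeG2 \<longrightarrow>
        PZB G \<theta> = dominant_weights G) \<and>
     (type_AI G \<theta> n \<or> type_AII G \<theta> n \<or> type_DI_case3 G \<theta> n \<or> type_DIII_case1 G \<theta> n \<or>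
      type_EI G \<theta> \<or> type_EIV G \<theta> \<longrightarrow>
        PZB G \<theta> = {\<mu> \<in> dominant_weights G. \<mu> = - w0 G \<mu>}) \<and>
     ((\<exists>r. type_AIII G \<theta> n r) \<or> type_AIV G \<theta> n \<or> type_EII G \<theta> \<or> type_EIII G \<theta> \<or>
      type_DIII_case2 G \<theta> n \<longrightarrow>
        PZB G \<theta> = dominant_weights G) \<and>
     (\<forall>r. type_DI_case1 G \<theta> n r \<or> type_DII G \<theta> n r \<longrightarrow>
        PZB G \<theta> = (if even r then dominant_weights G else D_weights G n)) \<and>
     (type_DI_case2 G \<theta> n \<longrightarrow>
        PZB G \<theta> = (if odd n then dominant_weights G else D_weights G n))"
proof -
  interpret split_pair G \<theta> using assms by unfold_locales
  have "PZB G \<theta> = {\<mu> \<in> dominant_weights G. \<mu> = - w0 G \<mu>}"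
    if "type_AI G \<theta> n \<or> type_AII G \<theta> n \<or> type_DI_case3 G \<theta> n \<or> type_DIII_case1 G \<theta> n \<or>
      type_EI G \<theta> \<or> type_EIV G \<theta>"
  proof (rule PZB_if_twist_id)
    show "twist i = i" if "i \<in> idx G" for i
      using \<open>type_AI G \<theta> n \<or> _\<close> that twist_id_AI twist_id_AII twist_id_DI_case3 twist_id_DIII_case1
        twist_id_EI twist_id_EIV by blast
  qed
  then show ?thesis
    by (intro conjI allI impI)
      (simp_all only: PZB_interchanged PZB_no_diagram_aut PZB_AIII_AIV_EII_EIII_DIII_case2 PZB_DI_case1_DII PZB_DI_case2)
qed

end
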